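(* Let $S^{(2)}_n$ and $S^{(3)}_n$ be the regions defined in the context and $\operatorname{T}$ the number of tilings. (a) For every integer $n\ge0$, $$\operatorname{T}(S^{(2)}_{4n})=7^{n(2n+1)}2^{12n^2-2n},\qquad \operatorname{T}(S^{(2)}_{4n+1})=5\cdot7^{n(2n+2)}2^{12n^2+4n},$$ $$\operatorname{T}(S^{(2)}_{4n+2})=7^{n(2n+3)+1}2^{12n^2+10n+2},\qquad \operatorname{T}(S^{(2)}_{4n+3})=7^{n(2n+4)+2}2^{12n^2+16n+5}.$$ (b) For every integer $n\ge0$, $$\operatorname{T}(S^{(3)}_{4n})=7^{n(2n-1)}2^{n(12n+2)},\qquad \operatorname{T}(S^{(3)}_{4n+1})=7^{2n^2}2^{n(12n+8)+1},$$ $$\operatorname{T}(S^{(3)}_{4n+2})=7^{n(2n+1)}2^{n(12n+14)+4},\qquad \operatorname{T}(S^{(3)}_{4n+3})=5\cdot7^{2n(n+1)}2^{n(12n+20)+8}.$$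
   Context: Tilings: given a subdivision of the plane into elementary regions, a tile is the union of two elementary regions sharing an edge; a tiling of a region (finite connected union of elementary regions) is a covering of it by tiles without gaps or overlaps; $\operatorname{T}(R)$ is the number of tilings of $R$. Node replacements for the unit square lattice (nodes $\mathbb{Z}^2$). First node replacement at a node $O$: add new vertices $O\pm(\tfrac12,0)$ at the midpoints of the two horizontal unit edges at $O$, and join each of them by straight segments to $O+(0,1)$ and to $O-(0,1)$; all existing segments are kept. Second node replacement at $O$: add new vertices $O\pm(0,\tfrac12)$ and join each of them by straight segments to $O+(1,0)$ and to $O-(1,0)$; all existing segments are kept. The lattice: start with the unit square lattice with every second diagonal drawn in, i.e. with all lines $y-x=2c$ and $x+y=2c$ ($c\in\mathbb{Z}$) added. For all integers $k,l$, apply the first node replacement at the nodes $(4k+3,4l)$ and $(4k+1,4l+2)$, and the second node replacement at the nodes $(4k+1,4l)$ and $(4k+3,4l+2)$. The elementary regions of the resulting subdivision are all triangles. For $n\ge1$ let $\mathbb{D}_n(0,0)=\{(x,y):|x-n|+|y|\le n\}$ be the diamond of side-length $n\sqrt2$ with western vertex $(0,0)$. $S^{(2)}_n$ is the union of all elementary regions lying completely inside $\mathbb{D}_n(0,0)$ together with all elementary regions that are obtuse triangles having an edge on the boundary of $\mathbb{D}_n(0,0)$. $S^{(3)}_n$ is the union of all elementary regions lying completely inside $\mathbb{D}_n(0,0)$ together with all elementary regions that are right isosceles triangles having their hypotenuse on the boundary of $\mathbb{D}_n(0,0)$. Convention: $S^{(2)}_0$, $S^{(3)}_0$ are empty with $\operatorname{T}=1$.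 *)

theory Defs
  imports "HOL-Analysis.Analysis"
begin

type_synonym point = "real \<times> real"

text \<open>
  A subdivision of the plane is given by the set \<open>G\<close> of all points on the drawn lines and
  segments; its elementary regions are the closed faces of \<open>G\<close>.
\<close>

definition elementary_regions :: "point set \<Rightarrow> point set set" where
  "elementary_regions G = closure ` components (- G)"

text \<open>
  Edges of elementary regions are edges in the sense of \<^const>\<open>edge_of\<close> (one-dimensional faces
  of a convex set). This is the right notion for the lattice below, all of whose elementary
  regions are triangles that meet edge to edge.
\<close>

definition tiles :: "point set \<Rightarrow> point set set" where
  "tiles G = {e \<union> f | e f. e \<in> elementary_regions G \<and> f \<in> elementary_regions G \<and> e \<noteq> f \<and>
                           (\<exists>g. g edge_of e \<and> g edge_of f)}"

definition tilings :: "point set \<Rightarrow> point set \<Rightarrow> point set set set" where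
  "tilings G R = {\<T>. \<T> \<subseteq> tiles G \<and> \<Union>\<T> = R \<and>
                      pairwise (\<lambda>s t. interior s \<inter> interior t = {}) \<T>}"

text \<open>
  For the empty region the only tiling is the empty set of tiles, so the count is 1, in accordance
  with the usual convention.
\<close>

definition num_tilings :: "point set \<Rightarrow> point set \<Rightarrow> nat" where
  "num_tilings G R = card (tilings G R)"

text \<open>The segments added by the two node replacements at the node \<open>p\<close>.\<close>

definition first_node_replacement :: "point \<Rightarrow> point set" where
  "first_node_replacement p =
     (\<Union>m \<in> {p + (1/2, 0), p - (1/2, 0)}. \<Union>q \<in> {p + (0, 1), p - (0, 1)}. closed_segment m q)"

definition second_node_replacement :: "point \<Rightarrow> point set" where
  "second_node_replacement p =
     (\<Union>m \<in> {p + (0, 1/2), p - (0, 1/2)}. \<Union>q \<in> {p + (1, 0), p - (1, 0)}. closed_segment m q)"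

definition diagonal_square_lattice :: "point set" where
  "diagonal_square_lattice =
     {(x, y). x \<in> \<int> \<or> y \<in> \<int>} \<union>
     {(x, y). \<exists>c::int. y - x = 2 * of_int c \<or> x + y = 2 * of_int c}"

definition replaced_lattice :: "point set" where
  "replaced_lattice = diagonal_square_lattice \<union>
     (\<Union>(k::int). \<Union>(l::int).
        first_node_replacement (4 * of_int k + 3, 4 * of_int l) \<union>
        first_node_replacement (4 * of_int k + 1, 4 * of_int l + 2) \<union>
        second_node_replacement (4 * of_int k + 1, 4 * of_int l) \<union>
        second_node_replacement (4 * of_int k + 3, 4 * of_int l + 2))"

text \<open>The diamond of side length \<open>n * sqrt 2\<close> with western vertex \<open>(0, 0)\<close>.\<close>

definition diamond :: "nat \<Rightarrow> point set" where
  "diamond n = {(x, y). \<bar>x - real n\<bar> + \<bar>y\<bar> \<le> real n}"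

text \<open>The angle at \<open>b\<close> is obtuse iff the inner product of the two sides leaving \<open>b\<close> is negative.\<close>

definition obtuse_triangle :: "point set \<Rightarrow> bool" where
  "obtuse_triangle e \<longleftrightarrow>
     (\<exists>a b c. \<not> collinear {a, b, c} \<and> e = convex hull {a, b, c} \<and> (a - b) \<bullet> (c - b) < 0)"

text \<open>The hypotenuse is passed as the argument \<open>h\<close>; the right angle is at \<open>b\<close>.\<close>

definition right_isosceles_triangle :: "point set \<Rightarrow> point set \<Rightarrow> bool" where
  "right_isosceles_triangle e h \<longleftrightarrow>
     (\<exists>a b c. \<not> collinear {a, b, c} \<and> e = convex hull {a, b, c} \<and>
              (a - b) \<bullet> (c - b) = 0 \<and> dist a b = dist c b \<and> h = closed_segment a c)"

text \<open>
  The diamond is bounded by lines of the lattice, so every elementary region lies inside or outside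
  of it. The regions contributed by the second set in each union and not by the first one are
  those attached to the boundary of the diamond from outside.
\<close>

definition S2 :: "nat \<Rightarrow> point set" where
  "S2 n = \<Union>({e \<in> elementary_regions replaced_lattice. e \<subseteq> diamond n} \<union>
            {e \<in> elementary_regions replaced_lattice. obtuse_triangle e \<and>
               (\<exists>g. g edge_of e \<and> g \<subseteq> frontier (diamond n))})"

definition S3 :: "nat \<Rightarrow> point set" where
  "S3 n = \<Union>({e \<in> elementary_regions replaced_lattice. e \<subseteq> diamond n} \<union>
            {e \<in> elementary_regions replaced_lattice.
               \<exists>h. right_isosceles_triangle e h \<and> h \<subseteq> frontier (diamond n)})"

end

theory Submission
  imports Defs
begin

text \<open>
  The lattice splits into squares with diagonals of length two ("cities") centred at the odd integer
  points; every city carries four or eight triangles, and a tile either stays inside one city or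
  crosses the common side of two cities. Recording which sides are crossed turns the tilings of both
  families of regions into weighted perfect matchings of an Aztec diamond whose vertices are the sides
  of the cities. Urban renewal at all faces of one parity shrinks the Aztec diamond by one and yields
  explicit new weights; two such steps lead from the weights of one family to those of the other, so
  that \<open>T(S3 (n+2)) = 2^(4n+4) * T(S2 n)\<close> and \<open>T(S2 (n+2)) = 28^(n+1) * T(S3 n)\<close>.
\<close>

section \<open>Weighted perfect matchings\<close>

text \<open>A crossing tile uses one triangle of each of two cities, so the cities are not
  independent. Neighbouring cities have opposite types, plain or replaced. If every crossing is
  charged to the city of one fixed type, the triangle of the other city at that side is the only
  shared vertex there: its own city or the neighbour covers it. These triangles are the Aztec
  vertices. The scheme needs one at every outer side: the obtuse triangles attached in
  \<open>S2\<close> are those of replaced cities, the right isosceles ones attached in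
  \<open>S3\<close> those of plain cities, so both regions give complete Aztec diamonds. Counting
  inside one city, normalised at the empty set, gives weights \<open>a\<close>, \<open>b\<close>,
  \<open>c\<close> equal to 1/2, 3/2, 1/2 for \<open>S2\<close> and 1, 3/5, 1/5 for
  \<open>S3\<close>. Renewal at the city faces turns either triple into the other. Renewal at the
  remaining faces then produces \<open>a^2 + b * c\<close>, which is 1/4 + 3/4 = 1 or 1 + 3/25 =
  28/25; the latter is the origin of the prime 7. It also exchanges \<open>b\<close> and
  \<open>c\<close>, which a translation by two undoes.\<close>

definition matchings :: "('e \<Rightarrow> 'v set) \<Rightarrow> 'e set \<Rightarrow> 'v set \<Rightarrow> 'e set set" where
  "matchings d E V = {M. M \<subseteq> E \<and> disjoint_family_on d M \<and> (\<Union>e\<in>M. d e) = V}"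

definition mweight :: "('e \<Rightarrow> 'v set) \<Rightarrow> ('e \<Rightarrow> real) \<Rightarrow> 'e set \<Rightarrow> 'v set \<Rightarrow> real" where
  "mweight d w E V = (\<Sum>M\<in>matchings d E V. \<Prod>e\<in>M. w e)"

text \<open>One way of deciding, for each vertex of \<open>V\<close>, which cell covers it.
  \<open>PiE\<close> fixes the values outside \<open>C\<close>, so sums over splittings meet every
  distribution just once.\<close>

definition splittings :: "'c set \<Rightarrow> ('c \<Rightarrow> 'v set) \<Rightarrow> 'v set \<Rightarrow> ('c \<Rightarrow> 'v set) set" where
  "splittings C K V = {Y \<in> PiE C (\<lambda>c. Pow (K c)). disjoint_family_on Y C \<and> (\<Union>c\<in>C. Y c) = V}"

lemma finite_matchings: "finite E \<Longrightarrow> finite (matchings d E V)"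
  by (rule finite_subset[of _ "Pow E"]) (auto simp: matchings_def)

lemma mweight_one: "mweight d (\<lambda>_. 1) E V = card (matchings d E V)"
  by (simp add: mweight_def)

lemma matchings_restrict: "matchings d E V = matchings d {e\<in>E. d e \<subseteq> V} V"
  by (auto simp: matchings_def)

lemma mweight_restrict: "mweight d w E V = mweight d w {e\<in>E. d e \<subseteq> V} V"
  unfolding mweight_def by (subst matchings_restrict) simp

lemma mweight_empty: "mweight d w {} V = of_bool (V = {})"
proof -
  have "matchings d {} V = (if V = {} then {{}} else {})"
    by (auto simp: matchings_def disjoint_family_on_def)
  then show ?thesis by (simp add: mweight_def)
qed

text \<open>Case distinction on whether \<open>e\<close> is used. Repeated over an explicit edge
  list it evaluates the small graphs of single faces and cities.\<close>

lemma mweight_insert: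
  assumes "finite E" "e \<notin> E" "d e \<noteq> {}"
  shows "mweight d w (insert e E) V =
    mweight d w E V + (if d e \<subseteq> V then w e * mweight d w E (V - d e) else 0)"
proof -
  let ?A = "matchings d E V" and ?B = "matchings d E (V - d e)"
  have eq: "matchings d (insert e E) V = ?A \<union> (if d e \<subseteq> V then insert e ` ?B else {})"
  proof (intro equalityI subsetI)
    fix M assume M: "M \<in> matchings d (insert e E) V"
    show "M \<in> ?A \<union> (if d e \<subseteq> V then insert e ` ?B else {})"
    proof (cases "e \<in> M")
      case True
      have dis: "d e \<inter> d x = {}" if "x \<in> M - {e}" for x
        using M True that by (auto simp: matchings_def disjoint_family_on_def)
      have sub: "d e \<subseteq> V" using M True by (auto simp: matchings_def)
      have "(\<Union>x\<in>M - {e}. d x) = V - d e"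
        using M True dis by (auto simp: matchings_def)
      moreover have "M - {e} \<subseteq> E" "disjoint_family_on d (M - {e})"
        using M by (auto simp: matchings_def disjoint_family_on_def)
      ultimately have B: "M - {e} \<in> ?B" by (simp add: matchings_def)
      have "M = insert e (M - {e})" using True by auto
      then have "M \<in> insert e ` ?B" using B by (rule image_eqI)
      then show ?thesis using sub by simp
    next
      case False
      then show ?thesis using M by (auto simp: matchings_def)
    qed
  next
    fix M assume M: "M \<in> ?A \<union> (if d e \<subseteq> V then insert e ` ?B else {})"
    show "M \<in> matchings d (insert e E) V"
    proof (cases "M \<in> ?A")
      case True
      then show ?thesis by (auto simp: matchings_def)
    next
      case False
      with M obtain N where N: "M = insert e N" "N \<in> ?B" and sub: "d e \<subseteq> V"
        by (auto split: if_splits)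
      have "d e \<inter> d x = {}" if "x \<in> N" for x using N that by (auto simp: matchings_def)
      then have "disjoint_family_on d (insert e N)"
        using N by (auto simp: matchings_def disjoint_family_on_def)
      then show ?thesis using N sub by (auto simp: matchings_def)
    qed
  qed
  have notin: "e \<notin> M" if "M \<in> ?B \<or> M \<in> ?A" for M
    using that assms by (auto simp: matchings_def)
  have fin: "finite M" if "M \<in> ?B" for M
    using that assms(1) by (auto simp: matchings_def intro: finite_subset)
  have "inj_on (insert e) ?B"
  proof (rule inj_onI)
    fix M N assume "M \<in> ?B" "N \<in> ?B" "insert e M = insert e N"
    then show "M = N" using insert_ident[of e M N] notin by simp
  qed
  then have "(\<Sum>M\<in>insert e ` ?B. \<Prod>e\<in>M. w e) = (\<Sum>M\<in>?B. \<Prod>e\<in>insert e M. w e)"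
    by (simp add: sum.reindex)
  also have "\<dots> = (\<Sum>M\<in>?B. w e * (\<Prod>e\<in>M. w e))"
    by (intro sum.cong refl prod.insert) (auto simp: fin notin)
  finally have 1: "(\<Sum>M\<in>insert e ` ?B. \<Prod>e\<in>M. w e) = w e * mweight d w E (V - d e)"
    by (simp add: mweight_def sum_distrib_left)
  have "?A \<inter> insert e ` ?B = {}" using notin by auto
  then have 2: "(\<Sum>M\<in>?A \<union> insert e ` ?B. \<Prod>e\<in>M. w e) =
      (\<Sum>M\<in>?A. \<Prod>e\<in>M. w e) + (\<Sum>M\<in>insert e ` ?B. \<Prod>e\<in>M. w e)"
    by (intro sum.union_disjoint finite_imageI finite_matchings assms(1))
  show ?thesis
  proof (cases "d e \<subseteq> V")
    case True
    show ?thesis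
      unfolding mweight_def[of d w "insert e E"] eq using True 1 2 by (simp add: mweight_def)
  next
    case False
    show ?thesis
      unfolding mweight_def[of d w "insert e E"] eq using False by (simp add: mweight_def)
  qed
qed

text \<open>Isomorphic weighted graphs have the same matching sum. Injectivity of \<open>g\<close>
  is asked on the endpoints and on \<open>V\<close> together, because disjointness and covering both
  have to be reflected.\<close>

lemma mweight_reindex:
  assumes f: "inj_on f E" and g: "inj_on g ((\<Union>e\<in>E. d e) \<union> V)"
    and d: "\<And>e. e \<in> E \<Longrightarrow> d' (f e) = g ` d e"
    and w: "\<And>e. e \<in> E \<Longrightarrow> w' (f e) = w e"
  shows "mweight d' w' (f ` E) (g ` V) = mweight d w E V"
proof -
  have dU: "(\<Union>e\<in>M. d' (f e)) = g ` (\<Union>e\<in>M. d e)" if "M \<subseteq> E" for M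
  proof -
    have "(\<Union>e\<in>M. d' (f e)) = (\<Union>e\<in>M. g ` d e)" using that d by (intro SUP_cong) auto
    then show ?thesis by (simp add: image_UN)
  qed
  have dis: "d' (f a) \<inter> d' (f b) = {} \<longleftrightarrow> d a \<inter> d b = {}" if "a \<in> E" "b \<in> E" for a b
  proof -
    have "g ` d a \<inter> g ` d b = g ` (d a \<inter> d b)"
      using that by (intro inj_on_image_Int[OF g, symmetric]) auto
    then show ?thesis using d that by simp
  qed
  have cov: "g ` (\<Union>e\<in>M. d e) = g ` V \<longleftrightarrow> (\<Union>e\<in>M. d e) = V" if "M \<subseteq> E" for M
    using that by (intro inj_on_image_eq_iff[OF g]) auto
  have djf: "disjoint_family_on d' (f ` M) \<longleftrightarrow> disjoint_family_on d M" if "M \<subseteq> E" for M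
  proof -
    have "f a = f b \<longleftrightarrow> a = b" "d' (f a) \<inter> d' (f b) = {} \<longleftrightarrow> d a \<inter> d b = {}"
      if "a \<in> M" "b \<in> M" for a b
      using that \<open>M \<subseteq> E\<close> dis inj_on_eq_iff[OF f] by blast+
    then show ?thesis unfolding disjoint_family_on_def ball_simps by simp
  qed
  have img: "matchings d' (f ` E) (g ` V) = (`) f ` matchings d E V"
  proof (intro equalityI subsetI)
    fix N assume N: "N \<in> matchings d' (f ` E) (g ` V)"
    then obtain M where M: "M \<subseteq> E" "N = f ` M" by (auto simp: matchings_def subset_image_iff)
    then show "N \<in> (`) f ` matchings d E V"
      using N dU[OF M(1)] cov[OF M(1)] djf[OF M(1)] by (auto simp: matchings_def)
  next
    fix N assume "N \<in> (`) f ` matchings d E V"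
    then obtain M where M: "M \<subseteq> E" "N = f ` M" "M \<in> matchings d E V"
      by (auto simp: matchings_def)
    then show "N \<in> matchings d' (f ` E) (g ` V)"
      using dU[OF M(1)] djf[OF M(1)] by (auto simp: matchings_def)
  qed
  have inj: "inj_on ((`) f) (matchings d E V)"
    using inj_on_image_eq_iff[OF f] by (auto simp: inj_on_def matchings_def)
  have "(\<Prod>e\<in>f ` M. w' e) = (\<Prod>e\<in>M. w e)" if "M \<in> matchings d E V" for M
  proof -
    have "M \<subseteq> E" using that by (auto simp: matchings_def)
    then show ?thesis using w f
      by (subst prod.reindex) (auto intro: inj_on_subset prod.cong)
  qed
  then show ?thesis
    unfolding mweight_def img using inj by (subst sum.reindex) auto
qed

text \<open>When the edges are partitioned into cells, a matching amounts to one partial matching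
  per cell, and these have to cover disjoint vertex sets with union \<open>V\<close>. The cells
  interact only through the sets \<open>Y c\<close> they cover, and for a fixed splitting the sum
  factorises.\<close>

lemma mweight_split:
  fixes d :: "'e \<Rightarrow> 'v set"
  assumes C: "finite C" and disj: "disjoint_family_on Ec C"
    and fin: "\<And>c. c \<in> C \<Longrightarrow> finite (Ec c)" "\<And>c. c \<in> C \<Longrightarrow> finite (K c)"
    and K: "\<And>c e. c \<in> C \<Longrightarrow> e \<in> Ec c \<Longrightarrow> d e \<subseteq> K c"
  shows "mweight d w (\<Union>c\<in>C. Ec c) V =
    (\<Sum>Y\<in>splittings C K V. \<Prod>c\<in>C. mweight d w (Ec c) (Y c))"
proof -
  let ?G = "\<lambda>Y. PiE C (\<lambda>c. matchings d (Ec c) (Y c))"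
  let ?E = "\<Union>c\<in>C. Ec c"
  have finS: "finite (splittings C K V)"
    by (rule finite_subset[of _ "PiE C (\<lambda>c. Pow (K c))"])
       (auto simp: splittings_def intro!: finite_PiE C fin)
  have finG: "finite (?G Y)" for Y
    by (intro finite_PiE C finite_matchings fin)
  have uniq: "c = c'" if "e \<in> Ec c" "e \<in> Ec c'" "c \<in> C" "c' \<in> C" for e c c'
    using disj that by (auto simp: disjoint_family_on_def)
  have part: "(\<Union>c\<in>C. g c) \<inter> Ec c = g c" if "\<And>c. c \<in> C \<Longrightarrow> g c \<subseteq> Ec c" "c \<in> C" for g c
    using that uniq by blast
  have "(\<Sum>Y\<in>splittings C K V. \<Prod>c\<in>C. mweight d w (Ec c) (Y c)) =
    (\<Sum>Y\<in>splittings C K V. \<Sum>g\<in>?G Y. \<Prod>c\<in>C. \<Prod>e\<in>g c. w e)"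
    unfolding mweight_def
    by (intro sum.cong refl prod_sum_PiE C finite_matchings fin)
  also have "\<dots> = (\<Sum>(Y, g)\<in>Sigma (splittings C K V) ?G. \<Prod>c\<in>C. \<Prod>e\<in>g c. w e)"
    using finS finG by (intro sum.Sigma) auto
  also have "\<dots> = (\<Sum>M\<in>matchings d ?E V. \<Prod>e\<in>M. w e)"
  \<comment> \<open>A matching is cut into its traces \<open>M \<inter> Ec c\<close>; the set
    covered by each trace recovers the splitting, so the pair is determined by the union.\<close>
  proof (rule sum.reindex_bij_witness[where
        i = "\<lambda>M. (restrict (\<lambda>c. \<Union>e\<in>M \<inter> Ec c. d e) C, restrict (\<lambda>c. M \<inter> Ec c) C)"
        and j = "\<lambda>(Y, g). \<Union>c\<in>C. g c"], goal_cases)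
    case (1 a)
    then obtain Y g where a: "a = (Y, g)" and Y: "Y \<in> splittings C K V" and g: "g \<in> ?G Y"
      by auto
    have sub: "g c \<subseteq> Ec c" and U: "(\<Union>e\<in>g c. d e) = Y c" if "c \<in> C" for c
      using g that by (auto simp: PiE_def Pi_def matchings_def)
    have "restrict (\<lambda>c. (\<Union>c\<in>C. g c) \<inter> Ec c) C = g"
      using g part[OF sub] by (auto simp: PiE_def extensional_def restrict_def fun_eq_iff)
    moreover have "restrict (\<lambda>c. \<Union>e\<in>(\<Union>c\<in>C. g c) \<inter> Ec c. d e) C = Y"
      using Y part[OF sub] U
      by (auto simp: splittings_def PiE_def extensional_def restrict_def fun_eq_iff)
    ultimately show ?case using a by simp
  next
    case (2 a)
    then obtain Y g where a: "a = (Y, g)" and Y: "Y \<in> splittings C K V" and g: "g \<in> ?G Y"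
      by auto
    have sub: "g c \<subseteq> Ec c" and U: "(\<Union>e\<in>g c. d e) = Y c" and D: "disjoint_family_on d (g c)"
      if "c \<in> C" for c
      using g that by (auto simp: PiE_def Pi_def matchings_def)
    have "d e \<inter> d e' = {}" if e: "e \<in> g c" "e' \<in> g c'" "c \<in> C" "c' \<in> C" "e \<noteq> e'" for e e' c c'
    proof (cases "c = c'")
      case True
      then show ?thesis using D e by (auto simp: disjoint_family_on_def)
    next
      case False
      then have "Y c \<inter> Y c' = {}" using Y e by (auto simp: splittings_def disjoint_family_on_def)
      then show ?thesis using U[OF e(3)] U[OF e(4)] e by blast
    qed
    then have "disjoint_family_on d (\<Union>c\<in>C. g c)" by (auto simp: disjoint_family_on_def)
    moreover have "(\<Union>e\<in>(\<Union>c\<in>C. g c). d e) = V"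
      using U Y by (auto simp: splittings_def)
    ultimately show ?case using a sub by (auto simp: matchings_def)
  next
    case (3 M)
    then show ?case by (auto simp: matchings_def)
  next
    case (4 M)
    then have M: "M \<subseteq> ?E" "disjoint_family_on d M" "(\<Union>e\<in>M. d e) = V"
      by (auto simp: matchings_def)
    have "d e \<inter> d e' = {}"
      if "e \<in> M \<inter> Ec c" "e' \<in> M \<inter> Ec c'" "c \<in> C" "c' \<in> C" "c \<noteq> c'" for e e' c c'
      using that uniq[of e c c'] M(2) unfolding disjoint_family_on_def by (metis Int_iff)
    then have "disjoint_family_on (restrict (\<lambda>c. \<Union>e\<in>M \<inter> Ec c. d e) C) C"
      by (auto simp: disjoint_family_on_def) blast
    moreover have "disjoint_family_on d (M \<inter> Ec c)" for c
      using M(2) by (auto simp: disjoint_family_on_def)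
    moreover have "(\<Union>c\<in>C. \<Union>e\<in>M \<inter> Ec c. d e) = V"
      using M(1) unfolding M(3)[symmetric] by blast
    ultimately show ?case
      using K by (auto simp: splittings_def matchings_def PiE_def Pi_def)
  next
    case (5 a)
    then obtain Y g where a: "a = (Y, g)" and Y: "Y \<in> splittings C K V" and g: "g \<in> ?G Y"
      by auto
    have sub: "g c \<subseteq> Ec c" if "c \<in> C" for c
      using g that by (auto simp: PiE_def Pi_def matchings_def)
    have "(\<Prod>e\<in>(\<Union>c\<in>C. g c). w e) = (\<Prod>c\<in>C. \<Prod>e\<in>g c. w e)"
    proof (intro prod.UNION_disjoint C ballI impI)
      show "finite (g c)" if "c \<in> C" for c using sub fin that by (meson finite_subset)
      show "g c \<inter> g c' = {}" if "c \<in> C" "c' \<in> C" "c \<noteq> c'" for c c'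
        using sub[OF that(1)] sub[OF that(2)] uniq that by blast
    qed
    then show ?case using a by simp
  qed
  finally show ?thesis by (simp add: mweight_def)
qed

text \<open>A private vertex in \<open>own c\<close> can only be covered within \<open>c\<close>, so
  the freedom of a splitting lies in the ports alone. The map \<open>\<phi>\<close> separates the
  names of the ports from the vertices that realise them, so that differently built graphs give sums
  over the same splittings.\<close>

lemma mweight_split_ports:
  fixes d :: "'e \<Rightarrow> 'v set" and \<phi> :: "'u \<Rightarrow> 'v"
  assumes C: "finite C" and disj: "disjoint_family_on Ec C"
    and fin: "\<And>c. c \<in> C \<Longrightarrow> finite (Ec c)" "\<And>c. c \<in> C \<Longrightarrow> finite (K c)"
      "\<And>c. c \<in> C \<Longrightarrow> finite (own c)"
    and sub: "\<And>c e. c \<in> C \<Longrightarrow> e \<in> Ec c \<Longrightarrow> d e \<subseteq> own c \<union> \<phi> ` K c"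
    and inj: "inj_on \<phi> (\<Union>c\<in>C. K c)"
    and own: "disjoint_family_on own C"
      "\<And>c c'. c \<in> C \<Longrightarrow> c' \<in> C \<Longrightarrow> own c \<inter> \<phi> ` K c' = {}"
    and U: "U \<subseteq> (\<Union>c\<in>C. K c)"
  shows "mweight d w (\<Union>c\<in>C. Ec c) ((\<Union>c\<in>C. own c) \<union> \<phi> ` U) =
    (\<Sum>Y\<in>splittings C K U. \<Prod>c\<in>C. mweight d w (Ec c) (own c \<union> \<phi> ` Y c))"
proof -
  let ?K = "\<lambda>c. own c \<union> \<phi> ` K c" and ?V = "(\<Union>c\<in>C. own c) \<union> \<phi> ` U"
  have own': "\<phi> k \<notin> own c'" if "c \<in> C" "k \<in> K c" "c' \<in> C" for c c' k
    using own(2)[OF that(3,1)] that(2) by auto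
  \<comment> \<open>All of \<open>own c\<close> must go to \<open>c\<close>: no other cell has these
    vertices, neither as private ones nor as ports.\<close>
  have recover: "X c = own c \<union> \<phi> ` {k\<in>K c. \<phi> k \<in> X c}"
    if XS: "X \<in> splittings C ?K ?V" and c: "c \<in> C" for X c
  proof -
    have X: "\<And>c. c \<in> C \<Longrightarrow> X c \<subseteq> ?K c" "(\<Union>c\<in>C. X c) = ?V"
      using XS by (auto simp: splittings_def PiE_def Pi_def)
    have "own c \<subseteq> X c"
    proof
      fix v assume v: "v \<in> own c"
      then have "v \<in> (\<Union>c\<in>C. X c)" using X(2) c by blast
      then obtain c' where c': "c' \<in> C" "v \<in> X c'" by blast
      have "v \<notin> \<phi> ` K c'" using own(2)[OF c c'(1)] v by blast
      then have "v \<in> own c'" using X(1)[OF c'(1)] c' by blast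
      then have "c' = c" using own(1) v c c' unfolding disjoint_family_on_def by blast
      then show "v \<in> X c" using c' by simp
    qed
    then show ?thesis using X(1)[OF c] c by blast
  qed
  have "mweight d w (\<Union>c\<in>C. Ec c) ?V =
    (\<Sum>X\<in>splittings C ?K ?V. \<Prod>c\<in>C. mweight d w (Ec c) (X c))"
    by (intro mweight_split C disj fin sub finite_UnI finite_imageI)
  also have "\<dots> = (\<Sum>Y\<in>splittings C K U. \<Prod>c\<in>C. mweight d w (Ec c) (own c \<union> \<phi> ` Y c))"
  proof (rule sum.reindex_bij_witness[where
        i = "\<lambda>Y. restrict (\<lambda>c. own c \<union> \<phi> ` Y c) C"
        and j = "\<lambda>X. restrict (\<lambda>c. {k\<in>K c. \<phi> k \<in> X c}) C"], goal_cases)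
    case (1 X)
    then have X: "X \<in> extensional C" by (auto simp: splittings_def PiE_def)
    have "restrict (\<lambda>c. own c \<union> \<phi> ` restrict (\<lambda>c. {k\<in>K c. \<phi> k \<in> X c}) C c) C c = X c" for c
    proof (cases "c \<in> C")
      case True
      then show ?thesis by (simp only: restrict_apply' recover[OF 1 True, symmetric])
    next
      case False
      then show ?thesis using extensional_arb[OF X False] by simp
    qed
    then show ?case by (rule ext)
  next
    case (2 X)
    then have X: "\<And>c. c \<in> C \<Longrightarrow> X c \<subseteq> ?K c" "disjoint_family_on X C" "(\<Union>c\<in>C. X c) = ?V"
      by (auto simp: splittings_def PiE_def Pi_def)
    have "disjoint_family_on (restrict (\<lambda>c. {k\<in>K c. \<phi> k \<in> X c}) C) C"
      using X(2) by (auto simp: disjoint_family_on_def)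
    moreover have "(\<Union>c\<in>C. {k\<in>K c. \<phi> k \<in> X c}) = U"
    proof (intro equalityI subsetI)
      fix k assume "k \<in> (\<Union>c\<in>C. {k\<in>K c. \<phi> k \<in> X c})"
      then obtain c where c: "c \<in> C" "k \<in> K c" "\<phi> k \<in> X c" by auto
      then have "\<phi> k \<in> (\<Union>c\<in>C. X c)" by blast
      then have "\<phi> k \<in> ?V" by (simp only: X(3))
      then have "\<phi> k \<in> \<phi> ` U" using own'[OF c(1,2)] by auto
      then show "k \<in> U" using inj_on_image_mem_iff[OF inj _ U, of k] c by auto
    next
      fix k assume k: "k \<in> U"
      then have "\<phi> k \<in> (\<Union>c\<in>C. X c)" unfolding X(3) by blast
      then obtain c where c: "c \<in> C" "\<phi> k \<in> X c" by blast
      have kK: "k \<in> (\<Union>c\<in>C. K c)" and KK: "K c \<subseteq> (\<Union>c\<in>C. K c)" using k U c(1) by auto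
      have "\<phi> k \<notin> own c" using kK own' c(1) by auto
      then have "\<phi> k \<in> \<phi> ` K c" using X(1)[OF c(1)] c(2) by auto
      then have "k \<in> K c" using inj_on_image_mem_iff[OF inj kK KK] by simp
      then show "k \<in> (\<Union>c\<in>C. {k\<in>K c. \<phi> k \<in> X c})" using c by auto
    qed
    ultimately show ?case by (auto simp: splittings_def)
  next
    case (3 Y)
    then have Y: "\<And>c. c \<in> C \<Longrightarrow> Y c \<subseteq> K c" "Y \<in> extensional C"
      by (auto simp: splittings_def PiE_def Pi_def)
    have "{k \<in> K c. \<phi> k \<in> own c \<union> \<phi> ` Y c} = Y c" if "c \<in> C" for c
    proof -
      have YK: "Y c \<subseteq> (\<Union>c\<in>C. K c)" using Y(1)[OF that] that by auto
      have "\<phi> k \<in> \<phi> ` Y c \<longleftrightarrow> k \<in> Y c" if "k \<in> K c" for k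
        using inj_on_image_mem_iff[OF inj _ YK, of k] that \<open>c \<in> C\<close> by auto
      then show ?thesis using Y(1)[OF that] own'[OF that _ that] by auto
    qed
    then show ?case using Y(2) by (auto simp: fun_eq_iff restrict_def extensional_def)
  next
    case (4 Y)
    then have Y: "\<And>c. c \<in> C \<Longrightarrow> Y c \<subseteq> K c" "disjoint_family_on Y C" "(\<Union>c\<in>C. Y c) = U"
      by (auto simp: splittings_def PiE_def Pi_def)
    have \<phi>Y: "\<phi> ` Y c \<inter> \<phi> ` Y c' = {}" if c: "c \<in> C" "c' \<in> C" "c \<noteq> c'" for c c'
    proof -
      have "\<phi> ` Y c \<inter> \<phi> ` Y c' = \<phi> ` (Y c \<inter> Y c')"
        using c Y(1)[OF c(1)] Y(1)[OF c(2)] by (intro inj_on_image_Int[OF inj, symmetric]) auto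
      then show ?thesis using Y(2) c by (auto simp: disjoint_family_on_def)
    qed
    have oY: "own c \<inter> \<phi> ` Y c' = {}" if "c \<in> C" "c' \<in> C" for c c'
      using own(2)[OF that] Y(1)[OF that(2)] by blast
    have "(own c \<union> \<phi> ` Y c) \<inter> (own c' \<union> \<phi> ` Y c') = {}"
      if "c \<in> C" "c' \<in> C" "c \<noteq> c'" for c c'
    proof -
      have "own c \<inter> own c' = {}" using own(1) that by (auto simp: disjoint_family_on_def)
      then show ?thesis
        using \<phi>Y[OF that] oY[OF that(1,2)] oY[OF that(2,1)] by blast
    qed
    then have "disjoint_family_on (restrict (\<lambda>c. own c \<union> \<phi> ` Y c) C) C"
      by (auto simp: disjoint_family_on_def)
    moreover have "(\<Union>c\<in>C. own c \<union> \<phi> ` Y c) = ?V" using Y(3) by auto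
    moreover have "own c \<union> \<phi> ` Y c \<subseteq> own c \<union> \<phi> ` K c" if "c \<in> C" for c
      using Y(1)[OF that] by blast
    ultimately show ?case unfolding splittings_def
      by (simp add: restrict_PiE_iff del: Un_subset_iff)
  next
    case (5 X)
    show ?case
      by (rule prod.cong[OF refl]) (simp only: restrict_apply' recover[OF 5, symmetric])
  qed
  finally show ?thesis .
qed

text \<open>
  Urban renewal in disguise: if a cell with weights \<open>f\<close> also satisfies \<open>f(Y) = D * g(K - Y)\<close>, then
  passing to complements in all cells removes the vertices that lie in one cell only.
\<close>

lemma splittings_complement:
  assumes C: "finite C"
    and UU: "\<And>v. card {c\<in>C. v \<in> K c} = of_bool (v \<in> U) + of_bool (v \<in> U')"
    and Y: "Y \<in> splittings C K U"
  shows "restrict (\<lambda>c. K c - Y c) C \<in> splittings C K U'"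
proof -
  have sub: "Y c \<subseteq> K c" if "c \<in> C" for c using Y that by (auto simp: splittings_def PiE_def Pi_def)
  \<comment> \<open>Membership is handled by counting cells: each vertex of \<open>U\<close> is in
    exactly one \<open>Y c\<close>, and subtracting this from the incidence count in the hypothesis
    leaves \<open>of_bool (v \<in> U')\<close>.\<close>
  have one: "card {c\<in>C. v \<in> Y c} = of_bool (v \<in> U)" for v
  proof (cases "v \<in> U")
    case True
    then obtain c where c: "c \<in> C" "v \<in> Y c" using Y by (auto simp: splittings_def)
    moreover have "x = c" if "x \<in> C" "v \<in> Y x" for x
      using Y c that unfolding splittings_def disjoint_family_on_def by blast
    ultimately have "{c\<in>C. v \<in> Y c} = {c}" by blast
    then show ?thesis using True by simp
  next
    case False
    then have empty: "{c\<in>C. v \<in> Y c} = {}" using Y by (auto simp: splittings_def)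
    show ?thesis unfolding empty using False by simp
  qed
  have two: "card {c\<in>C. v \<in> K c - Y c} = of_bool (v \<in> U')" for v
  proof -
    have "{c\<in>C. v \<in> K c - Y c} = {c\<in>C. v \<in> K c} - {c\<in>C. v \<in> Y c}" by auto
    moreover have "{c\<in>C. v \<in> Y c} \<subseteq> {c\<in>C. v \<in> K c}" using sub by auto
    ultimately show ?thesis using C UU[of v] one[of v] by (simp add: card_Diff_subset)
  qed
  have "disjoint_family_on (restrict (\<lambda>c. K c - Y c) C) C"
    unfolding disjoint_family_on_def
  proof (intro ballI impI, rule ccontr)
    fix c c' assume c: "c \<in> C" "c' \<in> C" "c \<noteq> c'"
      "restrict (\<lambda>c. K c - Y c) C c \<inter> restrict (\<lambda>c. K c - Y c) C c' \<noteq> {}"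
    then obtain v where "v \<in> K c - Y c" "v \<in> K c' - Y c'" by auto
    then have "{c, c'} \<subseteq> {c\<in>C. v \<in> K c - Y c}" using c by auto
    then have "card {c, c'} \<le> card {c\<in>C. v \<in> K c - Y c}" using C by (intro card_mono) auto
    then show False using c(3) two[of v] by (cases "v \<in> U'") auto
  qed
  moreover have "(\<Union>c\<in>C. K c - Y c) = U'"
  proof -
    have "v \<in> (\<Union>c\<in>C. K c - Y c) \<longleftrightarrow> card {c\<in>C. v \<in> K c - Y c} \<noteq> 0" for v
      using C by auto
    then show ?thesis using two by auto
  qed
  ultimately show ?thesis by (auto simp: splittings_def)
qed

text \<open>Complementing in every cell is an involution, and the incidence hypothesis is symmetric
  in \<open>U\<close> and \<open>U'\<close>, so the two sets of splittings correspond
  bijectively.\<close>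

lemma sum_splittings_complement:
  assumes C: "finite C"
    and UU: "\<And>v. card {c\<in>C. v \<in> K c} = of_bool (v \<in> U) + of_bool (v \<in> U')"
  shows "(\<Sum>Y\<in>splittings C K U. \<Prod>c\<in>C. f c (K c - Y c)) = (\<Sum>Y\<in>splittings C K U'. \<Prod>c\<in>C. f c (Y c))"
proof -
  have UU': "card {c\<in>C. v \<in> K c} = of_bool (v \<in> U') + of_bool (v \<in> U)" for v
    using UU by simp
  have twice: "restrict (\<lambda>c. K c - restrict (\<lambda>c. K c - Y c) C c) C = Y"
    if "Y \<in> splittings C K W" for Y W
  proof -
    have "Y c \<subseteq> K c" if "c \<in> C" for c
      using \<open>Y \<in> splittings C K W\<close> that by (auto simp: splittings_def PiE_def Pi_def)
    moreover have "Y \<in> extensional C" using that by (auto simp: splittings_def PiE_def)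
    ultimately show ?thesis
      by (auto simp: fun_eq_iff restrict_def extensional_def double_diff)
  qed
  let ?f = "\<lambda>Y. restrict (\<lambda>c. K c - Y c) C"
  show ?thesis
  proof (rule sum.reindex_bij_witness[where i = ?f and j = ?f])
    fix Y assume "Y \<in> splittings C K U"
    then show "?f (?f Y) = Y" "?f Y \<in> splittings C K U'"
      by (fact twice, fact splittings_complement[OF C UU])
  next
    fix Y assume "Y \<in> splittings C K U'"
    then show "?f (?f Y) = Y" "?f Y \<in> splittings C K U"
      by (fact twice, fact splittings_complement[OF C UU'])
  next
    fix Y
    show "(\<Prod>c\<in>C. f c (?f Y c)) = (\<Prod>c\<in>C. f c (K c - Y c))" by simp
  qed
qed

section \<open>Aztec diamonds and urban renewal\<close>

text \<open>
  The Aztec diamond is drawn with doubled coordinates: the face \<open>(p, q)\<close> has centre \<open>(2p, 2q)\<close>, vertices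
  have two odd coordinates, and an edge is represented by its midpoint.
\<close>

definition face_sites :: "int \<times> int \<Rightarrow> (int \<times> int) set" where
  "face_sites = (\<lambda>(p, q). {(2*p+1, 2*q+1), (2*p-1, 2*q+1), (2*p-1, 2*q-1), (2*p+1, 2*q-1)})"

definition face_edges :: "int \<times> int \<Rightarrow> (int \<times> int) set" where
  "face_edges = (\<lambda>(p, q). {(2*p, 2*q+1), (2*p-1, 2*q), (2*p, 2*q-1), (2*p+1, 2*q)})"

definition ends :: "int \<times> int \<Rightarrow> (int \<times> int) set" where
  "ends = (\<lambda>(x, y). if even x then {(x+1, y), (x-1, y)} else {(x, y+1), (x, y-1)})"

definition aztec_sites :: "int \<Rightarrow> nat \<Rightarrow> (int \<times> int) set" where
  "aztec_sites h n = {(x, y). odd x \<and> odd y \<and> \<bar>x - 2*h\<bar> + \<bar>y\<bar> \<le> 2 * int n}"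

text \<open>Only the colour class containing the outermost faces is kept. Each edge then lies on
  exactly one face of the class, which makes the faces cells in the sense of
  \<open>mweight_split\<close>.\<close>

definition aztec_faces :: "int \<Rightarrow> nat \<Rightarrow> (int \<times> int) set" where
  "aztec_faces h n = {(p, q). odd (p + q + h + int n) \<and> \<bar>p - h\<bar> + \<bar>q\<bar> < int n}"

definition aztec_edges :: "int \<Rightarrow> nat \<Rightarrow> (int \<times> int) set" where
  "aztec_edges h n = (\<Union>c\<in>aztec_faces h n. face_edges c)"

definition aztec_weight :: "int \<Rightarrow> nat \<Rightarrow> (int \<times> int \<Rightarrow> real) \<Rightarrow> real" where
  "aztec_weight h n w = mweight ends w (aztec_edges h n) (aztec_sites h n)"

lemma finite_aztec_faces: "finite (aztec_faces h n)"
  by (rule finite_subset[of _ "{h - int n..h + int n} \<times> {- int n..int n}"])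
     (auto simp: aztec_faces_def)

lemma finite_face_edges: "finite (face_edges c)"
  by (auto simp: face_edges_def split: prod.splits)

lemma finite_face_sites: "finite (face_sites c)"
  by (auto simp: face_sites_def split: prod.splits)

lemma ends_face_edge: "e \<in> face_edges c \<Longrightarrow> ends e \<subseteq> face_sites c"
  by (auto simp: face_edges_def face_sites_def ends_def split: prod.splits)

text \<open>Faces that share an edge are neighbours, and neighbours have opposite colours.\<close>

lemma disjoint_face_edges: "disjoint_family_on face_edges (aztec_faces h n)"
proof -
  have "c = c'" if "e \<in> face_edges c" "e \<in> face_edges c'" "c \<in> aztec_faces h n" "c' \<in> aztec_faces h n"
    for e c c'
  proof -
    obtain p q p' q' where c: "c = (p, q)" "c' = (p', q')" by fastforce
    have "even (p + q + p' + q')" using that(3,4) unfolding c aztec_faces_def by auto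
    moreover have "\<bar>p - p'\<bar> + \<bar>q - q'\<bar> \<le> 1"
      using that(1,2) unfolding c face_edges_def by auto
    ultimately show ?thesis unfolding c by simp presburger
  qed
  then show ?thesis by (auto simp: disjoint_family_on_def)
qed

text \<open>The parity condition excludes equality, so the weak inequality obtained from the bounds
  on the sites is enough.\<close>

lemma aztec_facesI:
  assumes odd: "odd (p + q + h + int n)" and le: "\<bar>p - h\<bar> + \<bar>q\<bar> \<le> int n"
  shows "(p, q) \<in> aztec_faces h n"
proof -
  have "\<bar>p - h\<bar> + \<bar>q\<bar> \<noteq> int n"
  proof
    assume "\<bar>p - h\<bar> + \<bar>q\<bar> = int n"
    then have "even (int n) \<longleftrightarrow> even (\<bar>p - h\<bar> + \<bar>q\<bar>)" by simp
    then show False using odd by simp blast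
  qed
  then show ?thesis using assms by (simp add: aztec_faces_def)
qed

text \<open>A description that does not mention colours: all lattice edges with both ends among the
  sites. It is needed when the diamond shrinks, as the faces of the smaller diamond have the other
  colour.\<close>

lemma aztec_edges_eq:
  "aztec_edges h n = {e. odd (fst e + snd e) \<and> ends e \<subseteq> aztec_sites h n}"
proof (intro equalityI subsetI)
  fix e assume "e \<in> aztec_edges h n"
  then obtain p q where pq: "odd (p + q + h + int n)" "\<bar>p - h\<bar> + \<bar>q\<bar> < int n" "e \<in> face_edges (p, q)"
    by (auto simp: aztec_edges_def aztec_faces_def)
  have "face_sites (p, q) \<subseteq> aztec_sites h n"
    using pq(2) by (auto simp: face_sites_def aztec_sites_def)
  moreover have "odd (fst e + snd e)" using pq(3) by (auto simp: face_edges_def)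
  ultimately show "e \<in> {e. odd (fst e + snd e) \<and> ends e \<subseteq> aztec_sites h n}"
    using ends_face_edge[OF pq(3)] by auto
next
  fix e assume e: "e \<in> {e. odd (fst e + snd e) \<and> ends e \<subseteq> aztec_sites h n}"
  obtain x y where xy: "e = (x, y)" by fastforce
  show "e \<in> aztec_edges h n"
  proof (cases "even x")
    case True
    define p q where "p = x div 2" and "q = (y - 1) div 2"
    have x: "x = 2 * p" and y: "y = 2 * q + 1" using True e xy by (auto simp: p_def q_def)
    have b: "\<bar>2 * p + 1 - 2 * h\<bar> + \<bar>2 * q + 1\<bar> \<le> 2 * int n"
      "\<bar>2 * p - 1 - 2 * h\<bar> + \<bar>2 * q + 1\<bar> \<le> 2 * int n"
      using e unfolding xy x y by (auto simp: ends_def aztec_sites_def)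
    show ?thesis
    \<comment> \<open>An edge separates two faces of opposite colours; the one of the right colour
      is taken.\<close>
    proof (cases "odd (p + q + h + int n)")
      case True
      then have "(p, q) \<in> aztec_faces h n" using b by (intro aztec_facesI) auto
      then show ?thesis unfolding aztec_edges_def xy x y by (rule UN_I) (simp add: face_edges_def)
    next
      case False
      then have "(p, q + 1) \<in> aztec_faces h n" using b by (intro aztec_facesI) auto
      then show ?thesis unfolding aztec_edges_def xy x y by (rule UN_I) (simp add: face_edges_def)
    qed
  next
    case False
    define p q where "p = (x - 1) div 2" and "q = y div 2"
    have x: "x = 2 * p + 1" and y: "y = 2 * q" using False e xy by (auto simp: p_def q_def)
    have b: "\<bar>2 * p + 1 - 2 * h\<bar> + \<bar>2 * q + 1\<bar> \<le> 2 * int n"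
      "\<bar>2 * p + 1 - 2 * h\<bar> + \<bar>2 * q - 1\<bar> \<le> 2 * int n"
      using e unfolding xy x y by (auto simp: ends_def aztec_sites_def)
    show ?thesis
    proof (cases "odd (p + q + h + int n)")
      case True
      then have "(p, q) \<in> aztec_faces h n" using b by (intro aztec_facesI) auto
      then show ?thesis unfolding aztec_edges_def xy x y by (rule UN_I) (simp add: face_edges_def)
    next
      case False
      then have "(p + 1, q) \<in> aztec_faces h n" using b by (intro aztec_facesI) auto
      then show ?thesis unfolding aztec_edges_def xy x y by (rule UN_I) (simp add: face_edges_def)
    qed
  qed
qed

lemma card_two_conditions:
  assumes "a \<noteq> b" "{c. P c} = {c\<in>{a, b}. P c}"
  shows "card {c. P c} = of_bool (P a) + of_bool (P b)"
proof -
  have "{c\<in>{a, b}. P c} = (if P a then {a} else {}) \<union> (if P b then {b} else {})" by auto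
  then show ?thesis using assms by auto
qed

text \<open>The two faces of one colour at a site are diagonally opposite. For a site of the smaller
  diamond both are present, on the outer layer only one, and beyond it none. Here \<open>a\<close>
  and \<open>b\<close> are measured from the centre and \<open>m + 1\<close> is the order of the
  larger diamond.\<close>

lemma two_faces_at_site:
  fixes a b m :: int
  assumes "even (a + b + m)"
  shows "of_bool (\<bar>a\<bar> + \<bar>b\<bar> < m + 1) + of_bool (\<bar>a + 1\<bar> + \<bar>b + 1\<bar> < m + 1) =
    of_bool (\<bar>2 * a + 1\<bar> + \<bar>2 * b + 1\<bar> \<le> 2 * m + 2) +
    (of_bool (\<bar>2 * a + 1\<bar> + \<bar>2 * b + 1\<bar> \<le> 2 * m) :: nat)"
proof -
  \<comment> \<open>Expressing \<open>m\<close> through the parity condition leaves linear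
    inequalities over the integers in each of the sign cases.\<close>
  obtain k' where "a + b + m = 2 * k'" using assms by (elim evenE)
  then obtain k where k: "m = 2 * k - a - b" by (metis add_diff_cancel_left' diff_diff_add)
  show ?thesis
    unfolding k by (cases "a \<ge> 0"; cases "b \<ge> 0") (auto simp: of_bool_def, presburger)
qed

text \<open>The incidence hypothesis of \<open>sum_splittings_complement\<close> for the sites of
  orders \<open>n + 1\<close> and \<open>n\<close>: complementing in all faces is what strips the
  outer layer of sites.\<close>

lemma card_faces_at_site:
  "card {c \<in> aztec_faces h (Suc n). v \<in> face_sites c} =
    of_bool (v \<in> aztec_sites h (Suc n)) + of_bool (v \<in> aztec_sites h n)"
proof -
  obtain x y where v: "v = (x, y)" by fastforce
  show ?thesis
  proof (cases "odd x \<and> odd y")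
    case False
    then have empty: "{c \<in> aztec_faces h (Suc n). v \<in> face_sites c} = {}"
      unfolding v face_sites_def by auto
    have "v \<notin> aztec_sites h (Suc n)" "v \<notin> aztec_sites h n"
      using False by (auto simp: v aztec_sites_def)
    then show ?thesis unfolding empty by simp
  next
    case True
    define a b where "a = (x - 1) div 2" and "b = (y - 1) div 2"
    have x: "x = 2 * a + 1" and y: "y = 2 * b + 1" using True by (auto simp: a_def b_def)
    have mem: "v \<in> face_sites (p, q) \<longleftrightarrow> (p = a \<or> p = a + 1) \<and> (q = b \<or> q = b + 1)" for p q
      unfolding v x y face_sites_def by auto
    define m where "m = int n"
    let ?P = "\<lambda>c. c \<in> aztec_faces h (Suc n) \<and> v \<in> face_sites c"
    have S: "v \<in> aztec_sites h (Suc n) \<longleftrightarrow> \<bar>2 * (a - h) + 1\<bar> + \<bar>2 * b + 1\<bar> \<le> 2 * m + 2"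
      "v \<in> aztec_sites h n \<longleftrightarrow> \<bar>2 * (a - h) + 1\<bar> + \<bar>2 * b + 1\<bar> \<le> 2 * m"
      by (auto simp: v x y aztec_sites_def m_def algebra_simps)
    have F: "?P (p, q) \<longleftrightarrow> odd (p + q + h + m + 1) \<and> \<bar>p - h\<bar> + \<bar>q\<bar> < m + 1 \<and>
        (p = a \<or> p = a + 1) \<and> (q = b \<or> q = b + 1)" for p q
      unfolding mem by (auto simp: aztec_faces_def m_def)
    show ?thesis
    proof (cases "even (a + b + h + m)")
      case True
      have "c \<in> {(a, b), (a + 1, b + 1)}" if P: "?P c" for c
      proof (cases c)
        case (Pair p q)
        show ?thesis using P[unfolded Pair F] True unfolding Pair by (elim conjE disjE) auto
      qed
      then have "{c. ?P c} = {c\<in>{(a, b), (a + 1, b + 1)}. ?P c}" by blast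
      then have "card {c. ?P c} = of_bool (?P (a, b)) + of_bool (?P (a + 1, b + 1))"
        by (intro card_two_conditions) auto
      moreover have "of_bool (?P (a, b)) + of_bool (?P (a + 1, b + 1)) =
          of_bool (v \<in> aztec_sites h (Suc n)) + (of_bool (v \<in> aztec_sites h n) :: nat)"
        using two_faces_at_site[of "a - h" b m] True unfolding F S by (simp add: algebra_simps)
      ultimately show ?thesis by simp
    next
      case False
      have "c \<in> {(a + 1, b), (a, b + 1)}" if P: "?P c" for c
      proof (cases c)
        case (Pair p q)
        show ?thesis using P[unfolded Pair F] False unfolding Pair by (elim conjE disjE) auto
      qed
      then have "{c. ?P c} = {c\<in>{(a + 1, b), (a, b + 1)}. ?P c}" by blast
      then have card: "card {c. ?P c} = of_bool (?P (a + 1, b)) + of_bool (?P (a, b + 1))"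
        by (intro card_two_conditions) auto
      \<comment> \<open>The other diagonal is carried to the first one by the reflection that sends
        \<open>b\<close> to \<open>- b - 1\<close>.\<close>
      have neg: "\<bar>2 * (- b - 1) + 1\<bar> = \<bar>2 * b + 1\<bar>" "\<bar>- b - 1\<bar> = \<bar>b + 1\<bar>" "\<bar>- b - 1 + 1\<bar> = \<bar>b\<bar>"
        by auto
      have "of_bool (?P (a + 1, b)) + of_bool (?P (a, b + 1)) =
          of_bool (v \<in> aztec_sites h (Suc n)) + (of_bool (v \<in> aztec_sites h n) :: nat)"
        using two_faces_at_site[of "a - h" "- b - 1" m] False unfolding F S
        unfolding neg by (simp add: algebra_simps)
      then show ?thesis using card by simp
    qed
  qed
qed

section \<open>Urban renewal at one face and on the whole diamond\<close>

lemma mweight_four_cycle: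
  assumes "distinct [a, b, c, d]" "distinct [e1, e2, e3, e4]"
    and f: "f e1 = {a, b}" "f e2 = {b, c}" "f e3 = {c, d}" "f e4 = {d, a}"
    and Y: "Y \<subseteq> {a, b, c, d}"
  shows "mweight f w {e1, e2, e3, e4} Y =
    of_bool (a \<notin> Y \<and> b \<notin> Y \<and> c \<notin> Y \<and> d \<notin> Y) +
    w e1 * of_bool (a \<in> Y \<and> b \<in> Y \<and> c \<notin> Y \<and> d \<notin> Y) +
    w e2 * of_bool (a \<notin> Y \<and> b \<in> Y \<and> c \<in> Y \<and> d \<notin> Y) +
    w e3 * of_bool (a \<notin> Y \<and> b \<notin> Y \<and> c \<in> Y \<and> d \<in> Y) +
    w e4 * of_bool (a \<in> Y \<and> b \<notin> Y \<and> c \<notin> Y \<and> d \<in> Y) +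
    (w e1 * w e3 + w e2 * w e4) * of_bool (a \<in> Y \<and> b \<in> Y \<and> c \<in> Y \<and> d \<in> Y)"
proof -
  have neq: "a \<noteq> b" "a \<noteq> c" "a \<noteq> d" "b \<noteq> c" "b \<noteq> d" "c \<noteq> d" "b \<noteq> a" "c \<noteq> a" "d \<noteq> a" "c \<noteq> b" "d \<noteq> b" "d \<noteq> c"
    "e1 \<noteq> e2" "e1 \<noteq> e3" "e1 \<noteq> e4" "e2 \<noteq> e3" "e2 \<noteq> e4" "e3 \<noteq> e4"
    using assms(1,2) by auto
  have E: "mweight f w {} X = of_bool (a \<notin> X \<and> b \<notin> X \<and> c \<notin> X \<and> d \<notin> X)" if "X \<subseteq> Y" for X
    unfolding mweight_empty using that Y by (intro arg_cong[of _ _ of_bool]) auto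
  have E': "mweight f w {} Y = of_bool (a \<notin> Y \<and> b \<notin> Y \<and> c \<notin> Y \<and> d \<notin> Y)"
    "mweight f w {} (Y - Z) = of_bool (a \<notin> Y - Z \<and> b \<notin> Y - Z \<and> c \<notin> Y - Z \<and> d \<notin> Y - Z)"
    "mweight f w {} (Y - Z - Z') = of_bool (a \<notin> Y - Z - Z' \<and> b \<notin> Y - Z - Z' \<and> c \<notin> Y - Z - Z' \<and> d \<notin> Y - Z - Z')"
    for Z Z'
    by (intro E; blast)+
  show ?thesis
    by (cases "a \<in> Y"; cases "b \<in> Y"; cases "c \<in> Y"; cases "d \<in> Y")
       (simp_all add: mweight_insert f neq E' del: Diff_insert0)
qed

text \<open>In a four-cycle the complement of an edge is the opposite edge, so opposite weights
  change places. Dividing by \<open>D\<close> makes the new two-edge term equal to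
  \<open>1 / D\<close>, which settles the exchange of the empty and the full set.\<close>

lemma face_complement:
  assumes Y: "Y \<subseteq> face_sites (p, q)"
    and D: "D = w (2*p, 2*q+1) * w (2*p, 2*q-1) + w (2*p+1, 2*q) * w (2*p-1, 2*q)" "D \<noteq> 0"
    and w': "w' (2*p, 2*q+1) = w (2*p, 2*q-1) / D" "w' (2*p, 2*q-1) = w (2*p, 2*q+1) / D"
      "w' (2*p+1, 2*q) = w (2*p-1, 2*q) / D" "w' (2*p-1, 2*q) = w (2*p+1, 2*q) / D"
  shows "mweight ends w (face_edges (p, q)) Y =
    D * mweight ends w' (face_edges (p, q)) (face_sites (p, q) - Y)"
proof -
  define a b c d where abcd: "a = (2*p+1, 2*q+1)" "b = (2*p-1, 2*q+1)" "c = (2*p-1, 2*q-1)" "d = (2*p+1, 2*q-1)"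
  have S: "face_sites (p, q) = {a, b, c, d}" by (simp add: face_sites_def abcd)
  have cyc: "mweight ends u (face_edges (p, q)) X =
    of_bool (a \<notin> X \<and> b \<notin> X \<and> c \<notin> X \<and> d \<notin> X) +
    u (2*p, 2*q+1) * of_bool (a \<in> X \<and> b \<in> X \<and> c \<notin> X \<and> d \<notin> X) +
    u (2*p-1, 2*q) * of_bool (a \<notin> X \<and> b \<in> X \<and> c \<in> X \<and> d \<notin> X) +
    u (2*p, 2*q-1) * of_bool (a \<notin> X \<and> b \<notin> X \<and> c \<in> X \<and> d \<in> X) +
    u (2*p+1, 2*q) * of_bool (a \<in> X \<and> b \<notin> X \<and> c \<notin> X \<and> d \<in> X) +
    (u (2*p, 2*q+1) * u (2*p, 2*q-1) + u (2*p-1, 2*q) * u (2*p+1, 2*q)) *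
      of_bool (a \<in> X \<and> b \<in> X \<and> c \<in> X \<and> d \<in> X)"
    if "X \<subseteq> {a, b, c, d}" for u X
    unfolding face_edges_def prod.case
    by (rule mweight_four_cycle) (use that in \<open>auto simp: ends_def abcd\<close>)
  have DD: "w' (2*p, 2*q+1) * w' (2*p, 2*q-1) + w' (2*p-1, 2*q) * w' (2*p+1, 2*q) = 1 / D"
  proof -
    have "w' (2*p, 2*q+1) * w' (2*p, 2*q-1) + w' (2*p-1, 2*q) * w' (2*p+1, 2*q) = D / (D * D)"
      unfolding w' D(1) by (simp add: add_divide_distrib mult.commute)
    then show ?thesis using D(2) by simp
  qed
  have 1: "w (2*p, 2*q+1) * w (2*p, 2*q-1) + w (2*p-1, 2*q) * w (2*p+1, 2*q) = D"
    using D(1) by simp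
  have 2: "{a, b, c, d} - Y \<subseteq> {a, b, c, d}" by blast
  have 3: "x \<in> {a, b, c, d} - Y \<longleftrightarrow> x \<notin> Y" if "x \<in> {a, b, c, d}" for x using that by simp
  show ?thesis
    unfolding S cyc[OF Y[unfolded S]] cyc[OF 2] DD 1
    by (cases "a \<in> Y"; cases "b \<in> Y"; cases "c \<in> Y"; cases "d \<in> Y")
       (simp_all add: w' D(2))
qed

text \<open>The local identity is applied at all faces at once; complementing then turns the sites
  of order \<open>n + 1\<close> into those of order \<open>n\<close>.\<close>

lemma aztec_shuffle:
  assumes D: "\<And>p q. (p, q) \<in> aztec_faces h (Suc n) \<Longrightarrow>
      D (p, q) = w (2*p, 2*q+1) * w (2*p, 2*q-1) + w (2*p+1, 2*q) * w (2*p-1, 2*q) \<and> D (p, q) \<noteq> 0"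
    and w': "\<And>p q. (p, q) \<in> aztec_faces h (Suc n) \<Longrightarrow>
      w' (2*p, 2*q+1) = w (2*p, 2*q-1) / D (p, q) \<and> w' (2*p, 2*q-1) = w (2*p, 2*q+1) / D (p, q) \<and>
      w' (2*p+1, 2*q) = w (2*p-1, 2*q) / D (p, q) \<and> w' (2*p-1, 2*q) = w (2*p+1, 2*q) / D (p, q)"
  shows "aztec_weight h (Suc n) w = (\<Prod>c\<in>aztec_faces h (Suc n). D c) * aztec_weight h n w'"
proof -
  let ?F = "aztec_faces h (Suc n)"
  have split: "mweight ends u (aztec_edges h (Suc n)) V =
      (\<Sum>Y\<in>splittings ?F face_sites V. \<Prod>c\<in>?F. mweight ends u (face_edges c) (Y c))" for u V
    unfolding aztec_edges_def
    by (intro mweight_split finite_aztec_faces disjoint_face_edges finite_face_edges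
        finite_face_sites ends_face_edge)
  have "aztec_weight h (Suc n) w =
      (\<Sum>Y\<in>splittings ?F face_sites (aztec_sites h (Suc n)).
        (\<Prod>c\<in>?F. D c) * (\<Prod>c\<in>?F. mweight ends w' (face_edges c) (face_sites c - Y c)))"
    unfolding aztec_weight_def split
  proof (intro sum.cong refl)
    fix Y assume Y: "Y \<in> splittings ?F face_sites (aztec_sites h (Suc n))"
    have "mweight ends w (face_edges c) (Y c) =
        D c * mweight ends w' (face_edges c) (face_sites c - Y c)" if c: "c \<in> ?F" for c
    proof -
      obtain p q where pq: "c = (p, q)" by fastforce
      have "Y c \<subseteq> face_sites c" using Y c unfolding splittings_def by auto
      then show ?thesis unfolding pq
        by (rule face_complement) (use D[of p q] w'[of p q] c pq in blast)+
    qed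
    then show "(\<Prod>c\<in>?F. mweight ends w (face_edges c) (Y c)) =
        (\<Prod>c\<in>?F. D c) * (\<Prod>c\<in>?F. mweight ends w' (face_edges c) (face_sites c - Y c))"
      by (simp add: prod.distrib)
  qed
  also have "\<dots> = (\<Prod>c\<in>?F. D c) * (\<Sum>Y\<in>splittings ?F face_sites (aztec_sites h n).
      \<Prod>c\<in>?F. mweight ends w' (face_edges c) (Y c))"
    unfolding sum_distrib_left[symmetric]
    by (subst sum_splittings_complement[OF finite_aztec_faces card_faces_at_site]) simp
  also have "\<dots> = (\<Prod>c\<in>?F. D c) * mweight ends w' (aztec_edges h (Suc n)) (aztec_sites h n)"
    by (simp add: split)
  \<comment> \<open>Edges with an end in the removed outer layer cannot be used, and the others are
    the edges of the smaller diamond.\<close>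
  also have "mweight ends w' (aztec_edges h (Suc n)) (aztec_sites h n) = aztec_weight h n w'"
  proof -
    have "aztec_sites h n \<subseteq> aztec_sites h (Suc n)" by (auto simp: aztec_sites_def)
    then have "{e \<in> aztec_edges h (Suc n). ends e \<subseteq> aztec_sites h n} = aztec_edges h n"
      unfolding aztec_edges_eq by auto
    then show ?thesis unfolding aztec_weight_def by (subst mweight_restrict) simp
  qed
  finally show ?thesis .
qed

section \<open>The weights arising from the lattice\<close>

lemma card_even_pairs:
  "2 * card {(u, v) \<in> {..<n} \<times> {..<n}. even (u + v :: nat)} = n\<^sup>2 + of_bool (odd n)"
proof -
  let ?S = "{..<n} \<times> {..<n}"
  have one: "(\<Sum>u<k. (-1) ^ u :: int) = of_bool (odd k)" for k :: nat
    by (induction k) auto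
  \<comment> \<open>The signed count factorises into two alternating sums, each 0 or 1; it is the
    surplus of even over odd pairs.\<close>
  have "(\<Sum>(u, v)\<in>?S. (-1) ^ (u + v) :: int) = of_bool (odd n)"
    by (simp add: sum.cartesian_product[symmetric] power_add sum_distrib_left[symmetric]
        sum_distrib_right[symmetric] one)
  moreover have "(-1) ^ (u + v) = 2 * of_bool (even (u + v)) - (1 :: int)" for u v :: nat
    by (auto simp: uminus_power_if)
  ultimately have "(\<Sum>(u, v)\<in>?S. 2 * of_bool (even (u + v)) - (1 :: int)) = of_bool (odd n)"
    by simp
  then have "2 * (\<Sum>x\<in>?S. of_bool (even (fst x + snd x)) :: int) = int n * int n + of_bool (odd n)"
    by (simp add: case_prod_beta sum_subtractf sum_distrib_left[symmetric])
  moreover have "(\<Sum>x\<in>?S. of_bool (even (fst x + snd x)) :: int) =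
      int (card {(u, v) \<in> ?S. even (u + v)})"
  proof -
    have "{(u, v) \<in> ?S. even (u + v)} = {x \<in> ?S. even (fst x + snd x)}" by auto
    then show ?thesis by (simp add: of_bool_def flip: sum.inter_filter)
  qed
  ultimately have "int (2 * card {(u, v) \<in> ?S. even (u + v)}) = int (n\<^sup>2 + of_bool (odd n))"
    by (simp add: power2_eq_square)
  then show ?thesis by (simp only: of_nat_eq_iff)
qed

text \<open>A rotation by 45 degrees makes the faces of one colour an \<open>n\<close> by
  \<open>n\<close> square. The second coordinate becomes \<open>u - v\<close>, so the faces at even
  height are the pairs with even sum.\<close>

lemma aztec_faces_param:
  "bij_betw (\<lambda>(u, v). (int u + int v + 1 + h - int n, int u - int v)) ({..<n} \<times> {..<n}) (aztec_faces h n)"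
proof (rule bij_betw_byWitness[where f' = "\<lambda>(p, q). (nat ((p - h + int n - 1 + q) div 2), nat ((p - h + int n - 1 - q) div 2))"])
  let ?f = "\<lambda>(u, v). (int u + int v + 1 + h - int n, int u - int v)"
  let ?g = "\<lambda>(p, q). (nat ((p - h + int n - 1 + q) div 2), nat ((p - h + int n - 1 - q) div 2))"
  have *: "\<exists>u v. p = int u + int v + 1 + h - int n \<and> q = int u - int v \<and> u < n \<and> v < n"
    if "(p, q) \<in> aztec_faces h n" for p q
  proof -
    have odd: "odd (p + q + h + int n)" and lt: "\<bar>p - h\<bar> + \<bar>q\<bar> < int n"
      using that by (auto simp: aztec_faces_def)
    obtain k where k: "p + q + h + int n = 2 * k + 1" using odd by (elim oddE)
    have "p = int (nat (k - h)) + int (nat (k - h - q)) + 1 + h - int n \<and>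
        q = int (nat (k - h)) - int (nat (k - h - q)) \<and> nat (k - h) < n \<and> nat (k - h - q) < n"
      using k lt by auto
    then show ?thesis by blast
  qed
  have gf: "?g (?f (u, v)) = (u, v)" for u v by (simp add: algebra_simps)
  show "\<forall>a\<in>{..<n} \<times> {..<n}. ?g (?f a) = a" using gf by auto
  show "\<forall>c\<in>aztec_faces h n. ?f (?g c) = c"
  proof
    fix c assume c: "c \<in> aztec_faces h n"
    obtain p q where pq: "c = (p, q)" by fastforce
    obtain u v where "c = ?f (u, v)" using *[of p q] c unfolding pq by auto
    then show "?f (?g c) = c" by (simp only: gf)
  qed
  show "?f ` ({..<n} \<times> {..<n}) \<subseteq> aztec_faces h n" by (auto simp: aztec_faces_def)
  show "?g ` aztec_faces h n \<subseteq> {..<n} \<times> {..<n}"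
  proof
    fix x assume "x \<in> ?g ` aztec_faces h n"
    then obtain p q where pq: "x = ?g (p, q)" "(p, q) \<in> aztec_faces h n" by auto
    obtain u v where uv: "(p, q) = ?f (u, v)" "u < n" "v < n" using *[OF pq(2)] by auto
    have "x = (u, v)" unfolding pq(1) uv(1) by (rule gf)
    then show "x \<in> {..<n} \<times> {..<n}" using uv by simp
  qed
qed

lemma card_aztec_faces: "card (aztec_faces h n) = n\<^sup>2"
  using bij_betw_same_card[OF aztec_faces_param] by (simp add: power2_eq_square)

lemma card_even_aztec_faces:
  "2 * card {c \<in> aztec_faces h n. even (snd c)} = n\<^sup>2 + of_bool (odd n)"
proof -
  let ?f = "\<lambda>(u, v). (int u + int v + 1 + h - int n, int u - int v)"
  have "{c \<in> aztec_faces h n. even (snd c)} = {c \<in> ?f ` ({..<n} \<times> {..<n}). even (snd c)}"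
    using aztec_faces_param[of h n] by (simp add: bij_betw_def)
  also have "\<dots> = ?f ` {(u, v) \<in> {..<n} \<times> {..<n}. even (u + v)}" by auto
  finally have "card {c \<in> aztec_faces h n. even (snd c)} =
      card (?f ` {(u, v) \<in> {..<n} \<times> {..<n}. even (u + v)})" by simp
  also have "\<dots> = card {(u, v) \<in> {..<n} \<times> {..<n}. even (u + v)}"
    using aztec_faces_param[of h n] by (intro card_image) (auto simp: bij_betw_def inj_on_def)
  finally show ?thesis using card_even_pairs[of n] by simp
qed

text \<open>The same rotation puts the sites into a square of side \<open>2 * n + 1\<close>, where
  having odd coordinates becomes \<open>u + v\<close> odd.\<close>

lemma card_aztec_sites: "card (aztec_sites h n) = 2 * n * (n + 1)"
proof -
  let ?N = "2 * n + 1"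
  let ?f = "\<lambda>(u :: nat, v :: nat). (2 * h + int u + int v - 2 * int n, int u - int v)"
  let ?S = "{..<?N} \<times> {..<?N}"
  have "aztec_sites h n = ?f ` {(u, v) \<in> ?S. odd (u + v)}"
  proof (intro equalityI subsetI)
    fix z assume z: "z \<in> aztec_sites h n"
    obtain x y where xy: "z = (x, y)" by fastforce
    have odd: "odd x" "odd y" and le: "\<bar>x - 2*h\<bar> + \<bar>y\<bar> \<le> 2 * int n"
      using z by (auto simp: aztec_sites_def xy)
    have "even (x + y)" using odd by simp
    then obtain k where k: "x + y = 2 * k" by (elim evenE)
    define u v where "u = nat (k - h + int n)" and "v = nat (k - y - h + int n)"
    have uv: "int u = k - h + int n" "int v = k - y - h + int n"
      using le k by (auto simp: u_def v_def)
    have "z = ?f (u, v)" unfolding xy using uv k by simp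
    moreover have "int u < int ?N" "int v < int ?N" using uv le k by auto
    moreover have "odd (int u + int v)" using odd(2) by (simp add: uv)
    then have "odd (u + v)" by (simp flip: of_nat_add)
    ultimately show "z \<in> ?f ` {(u, v) \<in> ?S. odd (u + v)}" by (intro image_eqI[of _ _ "(u, v)"]) auto
  qed (auto simp: aztec_sites_def)
  then have "card (aztec_sites h n) = card (?f ` {(u, v) \<in> ?S. odd (u + v)})" by simp
  also have "\<dots> = card {(u, v) \<in> ?S. odd (u + v)}"
  proof (intro card_image inj_onI)
    fix x y assume eq: "?f x = ?f y"
    obtain u v u' v' where xy: "x = (u, v)" "y = (u', v')" by fastforce
    have "int u + int v = int u' + int v'" "int u - int v = int u' - int v'"
      using eq unfolding xy by simp_all
    then have "u = u'" "v = v'" by linarith+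
    then show "x = y" by (simp add: xy)
  qed
  also have "\<dots> = card ?S - card {(u, v) \<in> ?S. even (u + v)}"
  proof -
    have eq: "{(u, v) \<in> ?S. odd (u + v)} = ?S - {(u, v) \<in> ?S. even (u + v)}" by auto
    have sub: "{(u, v) \<in> ?S. even (u + v)} \<subseteq> ?S" by auto
    show ?thesis
      by (subst eq) (rule card_Diff_subset[OF finite_subset[OF sub] sub], simp)
  qed
  finally show ?thesis using card_even_pairs[of ?N] by (simp add: power2_eq_square algebra_simps)
qed

lemma card_ends: "card (ends e) = 2"
  by (auto simp: ends_def split: prod.splits)

text \<open>Every perfect matching has half as many edges as there are sites, that is
  \<open>n * (n + 1)\<close>, so a common factor of the weights comes out with a fixed
  power.\<close>

lemma aztec_weight_scale:
  "aztec_weight h n (\<lambda>e. k * w e) = k ^ (n * (n + 1)) * aztec_weight h n w"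
proof -
  have "(\<Prod>e\<in>M. k * w e) = k ^ (n * (n + 1)) * (\<Prod>e\<in>M. w e)"
    if M: "M \<in> matchings ends (aztec_edges h n) (aztec_sites h n)" for M
  proof -
    have fin: "finite M"
      using M finite_subset[of M "aztec_edges h n"]
      by (auto simp: matchings_def aztec_edges_def finite_aztec_faces finite_face_edges)
    have "card (aztec_sites h n) = card (\<Union>e\<in>M. ends e)" using M by (simp add: matchings_def)
    also have "\<dots> = (\<Sum>e\<in>M. card (ends e))"
      using M fin by (intro card_UN_disjoint) (auto simp: matchings_def disjoint_family_on_def ends_def)
    finally have "card M = n * (n + 1)" by (simp add: card_ends card_aztec_sites)
    then show ?thesis by (simp add: prod.distrib)
  qed
  then show ?thesis
    unfolding aztec_weight_def mweight_def by (simp add: sum_distrib_left)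
qed

lemma aztec_weight_translate:
  assumes "\<And>x y. w' (x + 2 * k, y) = w (x, y)"
  shows "aztec_weight (h + k) n w' = aztec_weight h n w"
proof -
  let ?t = "\<lambda>(x, y). (x + 2 * k, y :: int)"
  have inj: "inj_on ?t A" for A by (auto simp: inj_on_def)
  have ends: "ends (?t e) = ?t ` ends e" for e by (auto simp: ends_def split: prod.splits)
  have sites: "aztec_sites (h + k) n = ?t ` aztec_sites h n"
  proof (intro equalityI subsetI)
    fix z assume "z \<in> aztec_sites (h + k) n"
    then show "z \<in> ?t ` aztec_sites h n"
      by (intro image_eqI[of _ _ "(fst z - 2 * k, snd z)"]) (auto simp: aztec_sites_def algebra_simps)
  qed (auto simp: aztec_sites_def algebra_simps)
  have "?t (fst e - 2 * k, snd e) = e" for e by (cases e) simp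
  then have edges: "aztec_edges (h + k) n = ?t ` aztec_edges h n"
  proof (intro equalityI subsetI)
    fix e assume e: "e \<in> aztec_edges (h + k) n"
    let ?e = "(fst e - 2 * k, snd e)"
    have te: "?t ?e = e" by (cases e) simp
    have "?t ` ends ?e \<subseteq> ?t ` aztec_sites h n"
      using e unfolding ends[symmetric] te sites[symmetric] by (simp add: aztec_edges_eq)
    then have "ends ?e \<subseteq> aztec_sites h n" using inj_on_image_subset_iff[OF inj[of UNIV]] by simp
    then have "?e \<in> aztec_edges h n" using e by (auto simp: aztec_edges_eq)
    then show "e \<in> ?t ` aztec_edges h n" using te by (metis image_eqI)
  next
    fix e assume "e \<in> ?t ` aztec_edges h n"
    then obtain f where f: "f \<in> aztec_edges h n" "e = ?t f" by auto
    then have "ends e \<subseteq> aztec_sites (h + k) n" unfolding f(2) ends sites by (auto simp: aztec_edges_eq)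
    moreover have "odd (fst e + snd e)" using f by (cases f) (simp add: aztec_edges_eq)
    ultimately show "e \<in> aztec_edges (h + k) n" by (simp add: aztec_edges_eq)
  qed
  show ?thesis
    unfolding aztec_weight_def sites edges
    by (rule mweight_reindex) (auto simp: inj ends assms)
qed

text \<open>
  \<open>a\<close> is the weight at plain cities. At a replaced city, \<open>b\<close> belongs to the two edges at the corners on
  the line of the two added vertices, and \<open>c\<close> to the other two edges.
\<close>

definition city_weight :: "real \<Rightarrow> real \<Rightarrow> real \<Rightarrow> int \<times> int \<Rightarrow> real" where
  "city_weight a b c = (\<lambda>(x, y).
     if (if odd x then y mod 4 = 2 else x mod 4 = 0) then a
     else if ((x + y) mod 8 \<ge> 4) = odd x then b else c)"

section \<open>Values of the city weights around a face\<close>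

lemma mod_8_add_4: "(t + 4) mod 8 \<ge> 4 \<longleftrightarrow> \<not> t mod 8 \<ge> (4 :: int)"
proof -
  define r j where "r = t mod 8" and "j = t div 8"
  have t: "t = r + 8 * j" and r: "0 \<le> r" "r < 8" by (simp_all add: r_def j_def)
  have "t + 4 = (if r < 4 then (r + 4) + 8 * j else (r - 4) + 8 * (j + 1))" using t by simp
  then have "(t + 4) mod 8 = (if r < 4 then r + 4 else r - 4)"
    using r by (simp only: mod_mult_self2 mod_pos_pos_trivial split: if_splits) auto
  then show ?thesis using r by (simp add: r_def[symmetric])
qed

lemma mod_8_odd:
  assumes "odd (s :: int)"
  shows "(2 * s + 1) mod 8 \<ge> 4 \<longleftrightarrow> s mod 4 = 3" "(2 * s - 1) mod 8 \<ge> 4 \<longleftrightarrow> s mod 4 = 3"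
proof -
  define j where "j = s div 4"
  have s: "s = s mod 4 + 4 * j" by (simp add: j_def)
  have "s mod 4 = 1 \<or> s mod 4 = 3" using assms by presburger
  then have "(s mod 4 = 1 \<and> 2 * s + 1 = 3 + 8 * j \<and> 2 * s - 1 = 1 + 8 * j) \<or>
      (s mod 4 = 3 \<and> 2 * s + 1 = 7 + 8 * j \<and> 2 * s - 1 = 5 + 8 * j)"
    using s by linarith
  then show "(2 * s + 1) mod 8 \<ge> 4 \<longleftrightarrow> s mod 4 = 3" "(2 * s - 1) mod 8 \<ge> 4 \<longleftrightarrow> s mod 4 = 3"
    by (elim disjE conjE; simp only: mod_mult_self2; simp)+
qed

lemma mod_8_even:
  assumes "even (s :: int)"
  shows "(2 * s + 1) mod 8 \<ge> 4 \<longleftrightarrow> s mod 4 \<noteq> 0" "(2 * s - 1) mod 8 \<ge> 4 \<longleftrightarrow> s mod 4 = 0"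
proof -
  define j where "j = s div 4"
  have s: "s = s mod 4 + 4 * j" by (simp add: j_def)
  have "s mod 4 = 0 \<or> s mod 4 = 2" using assms by presburger
  then have "(s mod 4 = 0 \<and> 2 * s + 1 = 1 + 8 * j \<and> 2 * s - 1 = -1 + 8 * j) \<or>
      (s mod 4 = 2 \<and> 2 * s + 1 = 5 + 8 * j \<and> 2 * s - 1 = 3 + 8 * j)"
    using s by linarith
  then show "(2 * s + 1) mod 8 \<ge> 4 \<longleftrightarrow> s mod 4 \<noteq> 0" "(2 * s - 1) mod 8 \<ge> 4 \<longleftrightarrow> s mod 4 = 0"
    by (elim disjE conjE; simp only: mod_mult_self2; simp)+
qed

lemma city_weight_plain_face:
  assumes "even p" "odd q"
  shows "city_weight a b c (2*p, 2*q+1) = a" (is ?n) "city_weight a b c (2*p, 2*q-1) = a" (is ?s)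
    "city_weight a b c (2*p+1, 2*q) = a" (is ?e) "city_weight a b c (2*p-1, 2*q) = a" (is ?w)
proof -
  have "(2 * p) mod 4 = 0" "(2 * q) mod 4 = 2" using assms by presburger+
  then show ?n ?s ?e ?w
    by (simp_all add: city_weight_def)
qed

lemma city_weight_replaced_face:
  assumes "odd p" "even q"
  shows "city_weight a b c (2*p, 2*q+1) = (if (p + q) mod 4 = 3 then c else b)" (is ?n)
    "city_weight a b c (2*p, 2*q-1) = (if (p + q) mod 4 = 3 then c else b)" (is ?s)
    "city_weight a b c (2*p+1, 2*q) = (if (p + q) mod 4 = 3 then b else c)" (is ?e)
    "city_weight a b c (2*p-1, 2*q) = (if (p + q) mod 4 = 3 then b else c)" (is ?w)
proof -
  have 1: "(2 * p) mod 4 = 2" "(2 * q) mod 4 = 0" using assms by presburger+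
  have 2: "(2 * p + (2 * q + 1)) mod 8 \<ge> 4 \<longleftrightarrow> (p + q) mod 4 = 3"
    "(2 * p + (2 * q - 1)) mod 8 \<ge> 4 \<longleftrightarrow> (p + q) mod 4 = 3"
    "(2 * p + 1 + 2 * q) mod 8 \<ge> 4 \<longleftrightarrow> (p + q) mod 4 = 3"
    "(2 * p - 1 + 2 * q) mod 8 \<ge> 4 \<longleftrightarrow> (p + q) mod 4 = 3"
    using mod_8_odd[of "p + q"] assms by (simp_all add: algebra_simps)
  show ?n ?s ?e ?w
    unfolding city_weight_def prod.case 2 1 by simp_all
qed

text \<open>A face between cities: its two edges of weight \<open>a\<close> come from plain cities,
  the other two from replaced cities whose centres are two apart, hence of different kinds, so one
  carries \<open>b\<close> and the other \<open>c\<close>.\<close>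

lemma city_weight_even_even_face:
  assumes "even p" "even q"
  shows "city_weight a b c (2*p, 2*q+1) = a" (is ?n) "city_weight a b c (2*p, 2*q-1) = a" (is ?s)
    "city_weight a b c (2*p+1, 2*q) = (if (p + q) mod 4 = 0 then c else b)" (is ?e)
    "city_weight a b c (2*p-1, 2*q) = (if (p + q) mod 4 = 0 then b else c)" (is ?w)
proof -
  have 1: "(2 * p) mod 4 = 0" "(2 * q) mod 4 = 0" using assms by presburger+
  have 2: "(2 * p + 1 + 2 * q) mod 8 \<ge> 4 \<longleftrightarrow> (p + q) mod 4 \<noteq> 0"
    "(2 * p - 1 + 2 * q) mod 8 \<ge> 4 \<longleftrightarrow> (p + q) mod 4 = 0"
    using mod_8_even[of "p + q"] assms by (simp_all add: algebra_simps)
  show ?n ?s ?e ?w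
    unfolding city_weight_def prod.case 2 1 by simp_all
qed

lemma city_weight_odd_odd_face:
  assumes "odd p" "odd q"
  shows "city_weight a b c (2*p, 2*q+1) = (if (p + q) mod 4 = 0 then b else c)" (is ?n)
    "city_weight a b c (2*p, 2*q-1) = (if (p + q) mod 4 = 0 then c else b)" (is ?s)
    "city_weight a b c (2*p+1, 2*q) = a" (is ?e) "city_weight a b c (2*p-1, 2*q) = a" (is ?w)
proof -
  have 1: "(2 * p) mod 4 = 2" "(2 * q) mod 4 = 2" using assms by presburger+
  have 2: "(2 * p + (2 * q + 1)) mod 8 \<ge> 4 \<longleftrightarrow> (p + q) mod 4 \<noteq> 0"
    "(2 * p + (2 * q - 1)) mod 8 \<ge> 4 \<longleftrightarrow> (p + q) mod 4 = 0"
    using mod_8_even[of "p + q"] assms by (simp_all add: algebra_simps)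
  show ?n ?s ?e ?w
    unfolding city_weight_def prod.case 2 1 by simp_all
qed

text \<open>Two faces to the right, which is four in doubled coordinates, the two kinds of node
  replacement change places.\<close>

lemma city_weight_shift: "city_weight a b c (x + 4, y) = city_weight a c b (x, y)"
proof -
  have "(x + 4) mod 4 = x mod 4" "(x + 4 + y) mod 8 \<ge> 4 \<longleftrightarrow> \<not> (x + y) mod 8 \<ge> 4"
    "odd (x + 4) \<longleftrightarrow> odd x"
    using mod_8_add_4[of "x + y"] by (simp_all add: algebra_simps)
  then show ?thesis unfolding city_weight_def prod.case by auto
qed

lemma prod_aztec_faces_snd:
  "(\<Prod>c\<in>aztec_faces h n. if even (snd c) then s else t :: real) =
    s ^ card {c \<in> aztec_faces h n. even (snd c)} * t ^ card {c \<in> aztec_faces h n. odd (snd c)}"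
proof -
  have "aztec_faces h n = {c \<in> aztec_faces h n. even (snd c)} \<union> {c \<in> aztec_faces h n. odd (snd c)}"
    by auto
  then have "(\<Prod>c\<in>aztec_faces h n. if even (snd c) then s else t) =
     (\<Prod>c\<in>{c \<in> aztec_faces h n. even (snd c)} \<union> {c \<in> aztec_faces h n. odd (snd c)}. if even (snd c) then s else t)"
    by simp
  also have "\<dots> = (\<Prod>c\<in>{c \<in> aztec_faces h n. even (snd c)}. if even (snd c) then s else t) *
     (\<Prod>c\<in>{c \<in> aztec_faces h n. odd (snd c)}. if even (snd c) then s else t)"
    by (intro prod.union_disjoint finite_Collect_conjI) (auto simp: finite_aztec_faces)
  finally show ?thesis by simp
qed

text \<open>The parity condition makes the faces of the shuffle the cities. There opposite edges
  have equal weights, so their exchange is invisible and only the division by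
  \<open>b^2 + c^2\<close> or \<open>2 * a^2\<close> remains.\<close>

lemma shuffle_cities:
  assumes h: "even (h + int (Suc n))" and nz: "a \<noteq> 0" "b \<noteq> 0"
  shows "aztec_weight h (Suc n) (city_weight a b c) =
    (\<Prod>f\<in>aztec_faces h (Suc n). if even (snd f) then b\<^sup>2 + c\<^sup>2 else 2 * a\<^sup>2) *
    aztec_weight h n (city_weight (1 / (2 * a)) (b / (b\<^sup>2 + c\<^sup>2)) (c / (b\<^sup>2 + c\<^sup>2)))"
proof (rule aztec_shuffle)
  fix p q assume "(p, q) \<in> aztec_faces h (Suc n)"
  then have "odd (p + q)" using h by (auto simp: aztec_faces_def)
  then have cases: "(even p \<and> odd q) \<or> (odd p \<and> even q)" by auto
  have bc: "b\<^sup>2 + c\<^sup>2 \<noteq> 0" using nz by (simp add: sum_power2_eq_zero_iff)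
  show "(if even (snd (p, q)) then b\<^sup>2 + c\<^sup>2 else 2 * a\<^sup>2) =
      city_weight a b c (2*p, 2*q+1) * city_weight a b c (2*p, 2*q-1) +
      city_weight a b c (2*p+1, 2*q) * city_weight a b c (2*p-1, 2*q) \<and>
      (if even (snd (p, q)) then b\<^sup>2 + c\<^sup>2 else 2 * a\<^sup>2) \<noteq> 0"
    using cases bc nz
    by (elim disjE conjE)
       (simp_all add: city_weight_plain_face city_weight_replaced_face power2_eq_square)
  let ?w = "city_weight (1 / (2 * a)) (b / (b\<^sup>2 + c\<^sup>2)) (c / (b\<^sup>2 + c\<^sup>2))"
  show "?w (2*p, 2*q+1) = city_weight a b c (2*p, 2*q-1) / (if even (snd (p, q)) then b\<^sup>2 + c\<^sup>2 else 2 * a\<^sup>2) \<and>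
      ?w (2*p, 2*q-1) = city_weight a b c (2*p, 2*q+1) / (if even (snd (p, q)) then b\<^sup>2 + c\<^sup>2 else 2 * a\<^sup>2) \<and>
      ?w (2*p+1, 2*q) = city_weight a b c (2*p-1, 2*q) / (if even (snd (p, q)) then b\<^sup>2 + c\<^sup>2 else 2 * a\<^sup>2) \<and>
      ?w (2*p-1, 2*q) = city_weight a b c (2*p+1, 2*q) / (if even (snd (p, q)) then b\<^sup>2 + c\<^sup>2 else 2 * a\<^sup>2)"
    using cases nz
    by (elim disjE conjE)
       (simp_all add: city_weight_plain_face city_weight_replaced_face power2_eq_square)
qed

text \<open>Here the faces lie between cities. All of them have the same value
  \<open>a^2 + b * c\<close>, whence a pure power, and swapping opposite edges exchanges
  \<open>b\<close> and \<open>c\<close>.\<close>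

lemma shuffle_nodes:
  assumes h: "odd (h + int (Suc n))" and nz: "a\<^sup>2 + b * c \<noteq> 0"
  shows "aztec_weight h (Suc n) (city_weight a b c) = (a\<^sup>2 + b * c) ^ (Suc n)\<^sup>2 *
    aztec_weight h n (city_weight (a / (a\<^sup>2 + b * c)) (c / (a\<^sup>2 + b * c)) (b / (a\<^sup>2 + b * c)))"
proof -
  let ?w = "city_weight (a / (a\<^sup>2 + b * c)) (c / (a\<^sup>2 + b * c)) (b / (a\<^sup>2 + b * c))"
  have "aztec_weight h (Suc n) (city_weight a b c) =
    (\<Prod>f\<in>aztec_faces h (Suc n). a\<^sup>2 + b * c) * aztec_weight h n ?w"
  proof (rule aztec_shuffle)
    fix p q assume "(p, q) \<in> aztec_faces h (Suc n)"
    then have "even (p + q)" using h by (auto simp: aztec_faces_def)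
    then have cases: "(even p \<and> even q) \<or> (odd p \<and> odd q)" by auto
    show "a\<^sup>2 + b * c = city_weight a b c (2*p, 2*q+1) * city_weight a b c (2*p, 2*q-1) +
        city_weight a b c (2*p+1, 2*q) * city_weight a b c (2*p-1, 2*q) \<and> a\<^sup>2 + b * c \<noteq> 0"
      using cases nz
      by (elim disjE conjE)
         (simp_all add: city_weight_even_even_face city_weight_odd_odd_face power2_eq_square)
    show "?w (2*p, 2*q+1) = city_weight a b c (2*p, 2*q-1) / (a\<^sup>2 + b * c) \<and>
        ?w (2*p, 2*q-1) = city_weight a b c (2*p, 2*q+1) / (a\<^sup>2 + b * c) \<and>
        ?w (2*p+1, 2*q) = city_weight a b c (2*p-1, 2*q) / (a\<^sup>2 + b * c) \<and>
        ?w (2*p-1, 2*q) = city_weight a b c (2*p+1, 2*q) / (a\<^sup>2 + b * c)"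
      using cases
      by (elim disjE conjE)
         (simp_all add: city_weight_even_even_face city_weight_odd_odd_face)
  qed
  then show ?thesis by (simp add: card_aztec_faces)
qed

text \<open>
  The first factor collects the weights, in the individual cities, of the configurations that are
  normalised to weight 1 in the Aztec diamond.
\<close>

definition weight2 :: "nat \<Rightarrow> real" where
  "weight2 n = (\<Prod>c\<in>aztec_faces (int n) n. 2) *
    aztec_weight (int n) n (city_weight (1/2) (3/2) (1/2))"

definition weight3 :: "nat \<Rightarrow> real" where
  "weight3 n = (\<Prod>c\<in>aztec_faces (int n) n. if even (snd c) then 5 else 1) *
    aztec_weight (int n) n (city_weight 1 (3/5) (1/5))"

section \<open>Recursions and closed forms of the weights\<close>

lemma aztec_faces_0: "aztec_faces h 0 = {}"
  by (auto simp: aztec_faces_def)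

lemma aztec_weight_0: "aztec_weight h 0 w = 1"
proof -
  have "z \<notin> aztec_sites h 0" for z
  proof
    assume z: "z \<in> aztec_sites h 0"
    then have "snd z = 0" by (auto simp: aztec_sites_def)
    then show False using z by (auto simp: aztec_sites_def)
  qed
  then have "aztec_sites h 0 = {}" by blast
  then show ?thesis by (simp add: aztec_weight_def aztec_edges_def aztec_faces_0 mweight_empty)
qed

text \<open>Two shuffles reduce the order by two but keep the centre. Moving the centre back by two
  exchanges \<open>b\<close> and \<open>c\<close>, which cancels the exchange made by
  \<open>shuffle_nodes\<close>.\<close>

lemma aztec_weight_recenter:
  "aztec_weight (int (Suc (Suc n))) n (city_weight a b c) = aztec_weight (int n) n (city_weight a c b)"
proof -
  have "aztec_weight (int n + 2) n (city_weight a b c) = aztec_weight (int n) n (city_weight a c b)"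
    by (rule aztec_weight_translate) (simp add: city_weight_shift)
  then show ?thesis by (simp add: add.commute)
qed

text \<open>With \<open>b = 3/5\<close> and \<open>c = 1/5\<close> one has
  \<open>b^2 + c^2 = 2/5\<close>, so the city step yields the triple 1/2, 3/2, 1/2; for it the node
  factor is 1/4 + 3/4 = 1. Only powers of 2 are left.\<close>

lemma weight3_step: "weight3 (Suc (Suc n)) = 2 ^ (4 * n + 4) * weight2 n"
proof -
  let ?F = "aztec_faces (int (Suc (Suc n))) (Suc (Suc n))"
  have a1: "aztec_weight (int (Suc (Suc n))) (Suc (Suc n)) (city_weight 1 (3/5) (1/5)) =
      (\<Prod>f\<in>?F. if even (snd f) then 2/5 else 2) *
      aztec_weight (int (Suc (Suc n))) (Suc n) (city_weight (1/2) (3/2) (1/2))"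
    by (subst shuffle_cities) (simp_all add: power2_eq_square cong: if_cong)
  have a2: "aztec_weight (int (Suc (Suc n))) (Suc n) (city_weight (1/2) (3/2) (1/2)) =
      aztec_weight (int n) n (city_weight (1/2) (3/2) (1/2))"
    by (subst shuffle_nodes) (simp_all add: power2_eq_square aztec_weight_recenter del: of_nat_Suc)
  \<comment> \<open>The factors 5 of replaced cities cancel against 2/5, so every city contributes
    2.\<close>
  have a3: "(\<Prod>f\<in>?F. if even (snd f) then 5 else 1) * (\<Prod>f\<in>?F. if even (snd f) then 2/5 else 2) =
      (2 ^ (Suc (Suc n))\<^sup>2 :: real)"
  proof -
    have "(\<Prod>f\<in>?F. if even (snd f) then 5 else 1) * (\<Prod>f\<in>?F. if even (snd f) then 2/5 else 2) =
        (\<Prod>f\<in>?F. 2 :: real)"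
      by (subst prod.distrib[symmetric]) (rule prod.cong; simp)
    then show ?thesis by (simp add: card_aztec_faces)
  qed
  have "weight3 (Suc (Suc n)) = 2 ^ (Suc (Suc n))\<^sup>2 *
      aztec_weight (int n) n (city_weight (1/2) (3/2) (1/2))"
    unfolding weight3_def a1 a2 a3[symmetric] by (simp only: mult.assoc)
  \<comment> \<open>The part \<open>2 ^ (n^2)\<close> is the city factor contained in
    \<open>weight2 n\<close>.\<close>
  also have "(Suc (Suc n))\<^sup>2 = (4 * n + 4) + n\<^sup>2" by (simp add: power2_eq_square)
  finally show ?thesis by (simp add: weight2_def card_aztec_faces power_add)
qed

text \<open>The city step gives the triple 1, 3/5, 1/5, and the node factor is 28/25. The new
  weights are 25/28 times this triple with \<open>b\<close> and \<open>c\<close> exchanged. As there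
  are \<open>(n + 1)^2\<close> node faces but \<open>n * (n + 1)\<close> edges in a matching,
  \<open>n + 1\<close> factors 28/25 survive; the additional rows of replaced cities supply the
  missing \<open>25 ^ (n + 1)\<close>.\<close>

lemma weight2_step: "weight2 (Suc (Suc n)) = 28 ^ (n + 1) * weight3 n"
proof -
  let ?h = "int (Suc (Suc n))"
  let ?F = "aztec_faces ?h (Suc (Suc n))"
  let ?r = "\<lambda>n. card {c \<in> aztec_faces (int n) n. even (snd c)}"
  \<comment> \<open>There are \<open>2 * n + 2\<close> more replaced cities than in the smaller
    diamond, each worth a factor 5.\<close>
  have r: "?r (Suc (Suc n)) = ?r n + (2 * n + 2)"
  proof -
    have "2 * ?r (Suc (Suc n)) = 2 * (?r n + (2 * n + 2))"
      unfolding distrib_left card_even_aztec_faces by (simp add: power2_eq_square)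
    then show ?thesis by simp
  qed
  have a1: "aztec_weight ?h (Suc (Suc n)) (city_weight (1/2) (3/2) (1/2)) =
      (\<Prod>f\<in>?F. if even (snd f) then 5/2 else 1/2) *
      aztec_weight ?h (Suc n) (city_weight 1 (3/5) (1/5))"
    by (subst shuffle_cities) (simp_all add: power2_eq_square cong: if_cong)
  have a2: "aztec_weight ?h (Suc n) (city_weight 1 (3/5) (1/5)) =
      (28/25) ^ (Suc n)\<^sup>2 * aztec_weight ?h n (city_weight (25/28) (5/28) (15/28))"
    by (subst shuffle_nodes) (simp_all add: power2_eq_square)
  have "city_weight (25/28) (5/28) (15/28) = (\<lambda>e. 25/28 * city_weight 1 (1/5) (3/5) e)"
    by (auto simp: city_weight_def fun_eq_iff)
  then have a3: "aztec_weight ?h n (city_weight (25/28) (5/28) (15/28)) =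
      (25/28) ^ (n * (n + 1)) * aztec_weight (int n) n (city_weight 1 (3/5) (1/5))"
    by (simp only: aztec_weight_scale aztec_weight_recenter)
  have a4: "(\<Prod>f\<in>?F. 2) * (\<Prod>f\<in>?F. if even (snd f) then 5/2 else 1/2) = (5 ^ ?r (Suc (Suc n)) :: real)"
  proof -
    have "(\<Prod>f\<in>?F. 2) * (\<Prod>f\<in>?F. if even (snd f) then 5/2 else 1/2) =
        (\<Prod>f\<in>?F. if even (snd f) then 5 else 1 :: real)"
      by (subst prod.distrib[symmetric]) (rule prod.cong; simp)
    then show ?thesis by (simp add: prod_aztec_faces_snd)
  qed
  have "weight2 (Suc (Suc n)) = 5 ^ ?r (Suc (Suc n)) * (28/25) ^ (Suc n)\<^sup>2 *
      (25/28) ^ (n * (n + 1)) * aztec_weight (int n) n (city_weight 1 (3/5) (1/5))"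
    unfolding weight2_def a1 a2 a3 a4[symmetric] by (simp only: mult.assoc)
  also have "\<dots> = 5 ^ (2 * n + 2) * (28/25) ^ (Suc n)\<^sup>2 * (25/28) ^ (n * (n + 1)) * weight3 n"
    unfolding r power_add weight3_def by (simp add: prod_aztec_faces_snd)
  also have "(28/25 :: real) ^ (Suc n)\<^sup>2 = (28/25) ^ (n + 1) * (28/25) ^ (n * (n + 1))"
  proof -
    have "(Suc n)\<^sup>2 = (n + 1) + n * (n + 1)" by (simp add: power2_eq_square)
    then show ?thesis by (simp only: power_add)
  qed
  also have "5 ^ (2 * n + 2) * ((28/25) ^ (n + 1) * (28/25) ^ (n * (n + 1))) * (25/28) ^ (n * (n + 1)) =
      (5 ^ (2 * n + 2) * (28/25) ^ (n + 1)) * ((28/25) ^ (n * (n + 1)) * (25/28 :: real) ^ (n * (n + 1)))"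
    by (simp only: mult_ac)
  also have "(28/25) ^ (n * (n + 1)) * (25/28 :: real) ^ (n * (n + 1)) = 1"
    by (simp flip: power_mult_distrib)
  also have "5 ^ (2 * n + 2) * (28/25) ^ (n + 1) = (28 :: real) ^ (n + 1)"
  proof -
    have "(5 :: real) ^ (2 * n + 2) = 25 ^ (n + 1)" by (simp add: power_add power_mult)
    then show ?thesis by (simp flip: power_mult_distrib)
  qed
  finally show ?thesis by simp
qed

lemma weight_0: "weight2 0 = 1" "weight3 0 = 1"
  by (simp_all add: weight2_def weight3_def aztec_weight_0 aztec_faces_0)

lemma weight_1: "weight2 1 = 5" "weight3 1 = 2"
proof -
  have F: "aztec_faces 1 (Suc 0) = {(1, 0)}" by (auto simp: aztec_faces_def)
  have "aztec_weight 1 (Suc 0) (city_weight (1/2) (3/2) (1/2)) = 5/2"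
    by (subst shuffle_cities) (simp_all add: F aztec_weight_0 power2_eq_square)
  then show "weight2 1 = 5" by (simp add: weight2_def F)
  have "aztec_weight 1 (Suc 0) (city_weight 1 (3/5) (1/5)) = 2/5"
    by (subst shuffle_cities) (simp_all add: F aztec_weight_0 power2_eq_square)
  then show "weight3 1 = 2" by (simp add: weight3_def F)
qed

text \<open>Both steps combined lead from each family back to itself with period four, the reason
  for the case distinction modulo 4 in the final formulas.\<close>

lemma weight_add4:
  "weight2 (4 + n) = 7 ^ (n + 3) * 2 ^ (6 * n + 10) * weight2 n"
  "weight3 (4 + n) = 7 ^ (n + 1) * 2 ^ (6 * n + 14) * weight3 n"
proof -
  have 4: "4 + n = Suc (Suc (Suc (Suc n)))" by simp
  have p28: "(28 :: real) ^ k = 7 ^ k * 2 ^ (2 * k)" for k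
    by (simp add: power_mult flip: power_mult_distrib)
  have "2 * (n + 3) + (4 * n + 4) = 6 * n + 10" "(4 * (n + 2) + 4) + 2 * (n + 1) = 6 * n + 14" by simp_all
  then have p2: "2 ^ (2 * (n + 3)) * 2 ^ (4 * n + 4) = (2 :: real) ^ (6 * n + 10)"
    "2 ^ (4 * (n + 2) + 4) * 2 ^ (2 * (n + 1)) = (2 :: real) ^ (6 * n + 14)"
    by (simp_all only: flip: power_add)
  have "weight2 (4 + n) = 28 ^ (n + 3) * (2 ^ (4 * n + 4) * weight2 n)"
    unfolding 4 weight2_step weight3_step by (simp add: numeral_3_eq_3)
  then show "weight2 (4 + n) = 7 ^ (n + 3) * 2 ^ (6 * n + 10) * weight2 n"
    unfolding p28 p2(1)[symmetric] by (simp only: mult_ac)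
  have "weight3 (4 + n) = 2 ^ (4 * (n + 2) + 4) * (28 ^ (n + 1) * weight3 n)"
    unfolding 4 weight2_step weight3_step by (simp add: numeral_3_eq_3)
  then show "weight3 (4 + n) = 7 ^ (n + 1) * 2 ^ (6 * n + 14) * weight3 n"
    unfolding p28 p2(2)[symmetric] by (simp only: mult_ac)
qed

lemma weight_closed:
  "weight2 (4*n) = 7 ^ (n*(2*n+1)) * 2 ^ (12*n\<^sup>2 - 2*n)"
  "weight2 (4*n+1) = 5 * 7 ^ (n*(2*n+2)) * 2 ^ (12*n\<^sup>2 + 4*n)"
  "weight2 (4*n+2) = 7 ^ (n*(2*n+3) + 1) * 2 ^ (12*n\<^sup>2 + 10*n + 2)"
  "weight2 (4*n+3) = 7 ^ (n*(2*n+4) + 2) * 2 ^ (12*n\<^sup>2 + 16*n + 5)"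
  "weight3 (4*n) = 7 ^ (n*(2*n-1)) * 2 ^ (n*(12*n+2))"
  "weight3 (4*n+1) = 7 ^ (2*n\<^sup>2) * 2 ^ (n*(12*n+8) + 1)"
  "weight3 (4*n+2) = 7 ^ (n*(2*n+1)) * 2 ^ (n*(12*n+14) + 4)"
  "weight3 (4*n+3) = 5 * 7 ^ (2*n*(n+1)) * 2 ^ (n*(12*n+20) + 8)"
proof -
  have base: "weight2 2 = 28" "weight2 3 = 28 ^ 2 * 2" "weight3 2 = 2 ^ 4" "weight3 3 = 2 ^ 8 * 5"
    using weight2_step[of 0] weight2_step[of 1] weight3_step[of 0] weight3_step[of 1] weight_0 weight_1
    by (simp_all add: numeral_2_eq_2 numeral_3_eq_3)
  have suc: "4 * Suc n = 4 + 4 * n" "4 * Suc n + k = 4 + (4 * n + k)" for n k by simp_all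
  \<comment> \<open>Ensures that the truncated subtraction in the exponent
    \<open>12*n^2 - 2*n\<close> is a true one.\<close>
  have square: "2 * n \<le> 12 * n\<^sup>2" for n :: nat by (cases n) (simp_all add: power2_eq_square)
  show "weight2 (4*n) = 7 ^ (n*(2*n+1)) * 2 ^ (12*n\<^sup>2 - 2*n)"
  proof (induction n)
    case (Suc n)
    have e: "12 * (Suc n)\<^sup>2 - 2 * Suc n = (12 * n\<^sup>2 - 2 * n) + (6 * (4 * n) + 10)"
      using square[of n] by (simp add: power2_eq_square algebra_simps)
    have e': "Suc n * (2 * Suc n + 1) = n * (2 * n + 1) + (4 * n + 3)"
      by (cases n) (simp_all add: power2_eq_square algebra_simps)
    have "weight2 (4 * Suc n) = 7 ^ (4 * n + 3) * 2 ^ (6 * (4 * n) + 10) * weight2 (4 * n)"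
      using weight_add4(1)[of "4 * n"] by (simp only: suc(1))
    then show ?case unfolding Suc e e' power_add by (simp only: mult_ac)
  qed (simp add: weight_0)
  show "weight2 (4*n+1) = 5 * 7 ^ (n*(2*n+2)) * 2 ^ (12*n\<^sup>2 + 4*n)"
  proof (induction n)
    case (Suc n)
    have e: "12 * (Suc n)\<^sup>2 + 4 * Suc n = (12 * n\<^sup>2 + 4 * n) + (6 * (4 * n + 1) + 10)"
      by (simp add: power2_eq_square algebra_simps)
    have e': "Suc n * (2 * Suc n + 2) = n * (2 * n + 2) + (4 * n + 1 + 3)"
      by (cases n) (simp_all add: power2_eq_square algebra_simps)
    have "weight2 (4 * Suc n + 1) = 7 ^ (4 * n + 1 + 3) * 2 ^ (6 * (4 * n + 1) + 10) * weight2 (4 * n + 1)"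
      using weight_add4(1)[of "4 * n + 1"] by (simp only: suc(2))
    then show ?case unfolding Suc e e' power_add by (simp only: mult_ac)
  qed (use weight_1 in simp)
  show "weight2 (4*n+2) = 7 ^ (n*(2*n+3) + 1) * 2 ^ (12*n\<^sup>2 + 10*n + 2)"
  proof (induction n)
    case (Suc n)
    have e: "12 * (Suc n)\<^sup>2 + 10 * Suc n + 2 = (12 * n\<^sup>2 + 10 * n + 2) + (6 * (4 * n + 2) + 10)"
      by (simp add: power2_eq_square algebra_simps)
    have e': "Suc n * (2 * Suc n + 3) + 1 = (n * (2 * n + 3) + 1) + (4 * n + 2 + 3)"
      by (cases n) (simp_all add: power2_eq_square algebra_simps)
    have "weight2 (4 * Suc n + 2) = 7 ^ (4 * n + 2 + 3) * 2 ^ (6 * (4 * n + 2) + 10) * weight2 (4 * n + 2)"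
      using weight_add4(1)[of "4 * n + 2"] by (simp only: suc(2))
    then show ?case unfolding Suc e e' power_add by (simp only: mult_ac)
  qed (use base in \<open>simp add: numeral_2_eq_2 numeral_3_eq_3\<close>)
  show "weight2 (4*n+3) = 7 ^ (n*(2*n+4) + 2) * 2 ^ (12*n\<^sup>2 + 16*n + 5)"
  proof (induction n)
    case (Suc n)
    have e: "12 * (Suc n)\<^sup>2 + 16 * Suc n + 5 = (12 * n\<^sup>2 + 16 * n + 5) + (6 * (4 * n + 3) + 10)"
      by (simp add: power2_eq_square algebra_simps)
    have e': "Suc n * (2 * Suc n + 4) + 2 = (n * (2 * n + 4) + 2) + (4 * n + 3 + 3)"
      by (cases n) (simp_all add: power2_eq_square algebra_simps)
    have "weight2 (4 * Suc n + 3) = 7 ^ (4 * n + 3 + 3) * 2 ^ (6 * (4 * n + 3) + 10) * weight2 (4 * n + 3)"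
      using weight_add4(1)[of "4 * n + 3"] by (simp only: suc(2))
    then show ?case unfolding Suc e e' power_add by (simp only: mult_ac)
  qed (use base in \<open>simp add: numeral_2_eq_2 numeral_3_eq_3\<close>)
  show "weight3 (4*n) = 7 ^ (n*(2*n-1)) * 2 ^ (n*(12*n+2))"
  proof (induction n)
    case (Suc n)
    have e: "Suc n * (12 * Suc n + 2) = n * (12 * n + 2) + (6 * (4 * n) + 14)"
      by (simp add: power2_eq_square algebra_simps)
    \<comment> \<open>For \<open>n = 0\<close> the truncated \<open>2 * n - 1\<close> is multiplied
      by 0, so the recursion of the exponents holds there too.\<close>
    have e': "Suc n * (2 * Suc n - 1) = n * (2 * n - 1) + (4 * n + 1)"
      by (cases n) (simp_all add: power2_eq_square algebra_simps)
    have "weight3 (4 * Suc n) = 7 ^ (4 * n + 1) * 2 ^ (6 * (4 * n) + 14) * weight3 (4 * n)"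
      using weight_add4(2)[of "4 * n"] by (simp only: suc(1))
    then show ?case unfolding Suc e e' power_add by (simp only: mult_ac)
  qed (simp add: weight_0)
  show "weight3 (4*n+1) = 7 ^ (2*n\<^sup>2) * 2 ^ (n*(12*n+8) + 1)"
  proof (induction n)
    case (Suc n)
    have e: "Suc n * (12 * Suc n + 8) + 1 = (n * (12 * n + 8) + 1) + (6 * (4 * n + 1) + 14)"
      by (simp add: power2_eq_square algebra_simps)
    have e': "2 * (Suc n)\<^sup>2 = 2 * n\<^sup>2 + (4 * n + 1 + 1)"
      by (cases n) (simp_all add: power2_eq_square algebra_simps)
    have "weight3 (4 * Suc n + 1) = 7 ^ (4 * n + 1 + 1) * 2 ^ (6 * (4 * n + 1) + 14) * weight3 (4 * n + 1)"
      using weight_add4(2)[of "4 * n + 1"] by (simp only: suc(2))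
    then show ?case unfolding Suc e e' power_add by (simp only: mult_ac)
  qed (use weight_1 in simp)
  show "weight3 (4*n+2) = 7 ^ (n*(2*n+1)) * 2 ^ (n*(12*n+14) + 4)"
  proof (induction n)
    case (Suc n)
    have e: "Suc n * (12 * Suc n + 14) + 4 = (n * (12 * n + 14) + 4) + (6 * (4 * n + 2) + 14)"
      by (simp add: power2_eq_square algebra_simps)
    have e': "Suc n * (2 * Suc n + 1) = n * (2 * n + 1) + (4 * n + 2 + 1)"
      by (cases n) (simp_all add: power2_eq_square algebra_simps)
    have "weight3 (4 * Suc n + 2) = 7 ^ (4 * n + 2 + 1) * 2 ^ (6 * (4 * n + 2) + 14) * weight3 (4 * n + 2)"
      using weight_add4(2)[of "4 * n + 2"] by (simp only: suc(2))
    then show ?case unfolding Suc e e' power_add by (simp only: mult_ac)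
  qed (use base in \<open>simp add: numeral_2_eq_2 numeral_3_eq_3\<close>)
  show "weight3 (4*n+3) = 5 * 7 ^ (2*n*(n+1)) * 2 ^ (n*(12*n+20) + 8)"
  proof (induction n)
    case (Suc n)
    have e: "Suc n * (12 * Suc n + 20) + 8 = (n * (12 * n + 20) + 8) + (6 * (4 * n + 3) + 14)"
      by (simp add: power2_eq_square algebra_simps)
    have e': "2 * Suc n * (Suc n + 1) = 2 * n * (n + 1) + (4 * n + 3 + 1)"
      by (cases n) (simp_all add: power2_eq_square algebra_simps)
    have "weight3 (4 * Suc n + 3) = 7 ^ (4 * n + 3 + 1) * 2 ^ (6 * (4 * n + 3) + 14) * weight3 (4 * n + 3)"
      using weight_add4(2)[of "4 * n + 3"] by (simp only: suc(2))
    then show ?case unfolding Suc e e' power_add by (simp only: mult_ac)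
  qed (use base in \<open>simp add: numeral_2_eq_2 numeral_3_eq_3\<close>)
qed

section \<open>The elementary regions\<close>

lemma not_collinear_det:
  fixes a b c :: point
  assumes "(fst b - fst a) * (snd c - snd a) \<noteq> (snd b - snd a) * (fst c - fst a)"
  shows "\<not> collinear {a, b, c}"
proof
  assume "collinear {a, b, c}"
  then obtain u where u: "\<And>x y. x \<in> {a, b, c} \<Longrightarrow> y \<in> {a, b, c} \<Longrightarrow> \<exists>k. x - y = k *\<^sub>R u"
    unfolding collinear_def by blast
  obtain k l where "b - a = k *\<^sub>R u" "c - a = l *\<^sub>R u" using u[of b a] u[of c a] by auto
  then have "fst b - fst a = k * fst u" "snd b - snd a = k * snd u"
    "fst c - fst a = l * fst u" "snd c - snd a = l * snd u"
    by (auto simp: prod_eq_iff)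
  then show False using assms by simp
qed

lemma barycentric_unique:
  fixes a b c :: point
  assumes det: "(fst b - fst a) * (snd c - snd a) \<noteq> (snd b - snd a) * (fst c - fst a)"
    and sum: "u + v + w = 1" "u' + v' + w' = 1"
    and eq: "u *\<^sub>R a + v *\<^sub>R b + w *\<^sub>R c = u' *\<^sub>R a + v' *\<^sub>R b + w' *\<^sub>R c"
  shows "u = u'" "v = v'" "w = w'"
proof -
  define s t where "s = v - v'" and "t = w - w'"
  have u: "u = 1 - v - w" "u' = 1 - v' - w'" using sum by auto
  have "s * (fst b - fst a) + t * (fst c - fst a) = 0" "s * (snd b - snd a) + t * (snd c - snd a) = 0"
    using eq unfolding u by (auto simp: prod_eq_iff s_def t_def algebra_simps)
  then have "s * ((fst b - fst a) * (snd c - snd a) - (snd b - snd a) * (fst c - fst a)) = 0"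
    "t * ((fst b - fst a) * (snd c - snd a) - (snd b - snd a) * (fst c - fst a)) = 0"
    by algebra+
  then have "s = 0" "t = 0" using det by auto
  then show "u = u'" "v = v'" "w = w'" using u by (auto simp: s_def t_def)
qed

lemma mem_triangle:
  fixes a b c :: point
  assumes det: "(fst b - fst a) * (snd c - snd a) \<noteq> (snd b - snd a) * (fst c - fst a)"
    and sum: "u + v + w = 1"
  shows "u *\<^sub>R a + v *\<^sub>R b + w *\<^sub>R c \<in> convex hull {a, b, c} \<longleftrightarrow> 0 \<le> u \<and> 0 \<le> v \<and> 0 \<le> w"
    and "u *\<^sub>R a + v *\<^sub>R b + w *\<^sub>R c \<in> interior (convex hull {a, b, c}) \<longleftrightarrow> 0 < u \<and> 0 < v \<and> 0 < w"
proof -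
  have "0 \<le> u \<and> 0 \<le> v \<and> 0 \<le> w" if H: "u *\<^sub>R a + v *\<^sub>R b + w *\<^sub>R c \<in> convex hull {a, b, c}"
  proof -
    obtain u' v' w' where "u *\<^sub>R a + v *\<^sub>R b + w *\<^sub>R c = u' *\<^sub>R a + v' *\<^sub>R b + w' *\<^sub>R c"
      "0 \<le> u'" "0 \<le> v'" "0 \<le> w'" "u' + v' + w' = 1"
      using H unfolding convex_hull_3 by blast
    then show ?thesis using barycentric_unique[OF det sum, of u' v' w'] by simp
  qed
  then show "u *\<^sub>R a + v *\<^sub>R b + w *\<^sub>R c \<in> convex hull {a, b, c} \<longleftrightarrow> 0 \<le> u \<and> 0 \<le> v \<and> 0 \<le> w"
    using sum unfolding convex_hull_3 by blast
  have int: "interior (convex hull {a, b, c}) =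
      {z. \<exists>u v w. 0 < u \<and> 0 < v \<and> 0 < w \<and> u + v + w = 1 \<and> u *\<^sub>R a + v *\<^sub>R b + w *\<^sub>R c = z}"
    by (intro interior_convex_hull_3_minimal not_collinear_det det) simp
  have "0 < u \<and> 0 < v \<and> 0 < w" if H: "u *\<^sub>R a + v *\<^sub>R b + w *\<^sub>R c \<in> interior (convex hull {a, b, c})"
  proof -
    obtain u' v' w' where "u' *\<^sub>R a + v' *\<^sub>R b + w' *\<^sub>R c = u *\<^sub>R a + v *\<^sub>R b + w *\<^sub>R c"
      "0 < u'" "0 < v'" "0 < w'" "u' + v' + w' = 1"
      using H unfolding int by blast
    then show ?thesis using barycentric_unique[OF det sum, of u' v' w'] by simp
  qed
  then show "u *\<^sub>R a + v *\<^sub>R b + w *\<^sub>R c \<in> interior (convex hull {a, b, c}) \<longleftrightarrow> 0 < u \<and> 0 < v \<and> 0 < w"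
    using sum unfolding int by blast
qed

text \<open>The faces of a simplex are the hulls of subsets of its vertices, and dimension one
  leaves the pairs.\<close>

lemma edge_of_triangle:
  fixes a b c :: point
  assumes det: "(fst b - fst a) * (snd c - snd a) \<noteq> (snd b - snd a) * (fst c - fst a)"
  shows "g edge_of (convex hull {a, b, c}) \<longleftrightarrow>
    g = closed_segment a b \<or> g = closed_segment b c \<or> g = closed_segment a c"
proof -
  have "\<not> collinear {a, b, c}" using not_collinear_det[OF det] .
  then have ne: "a \<noteq> b" "a \<noteq> c" "b \<noteq> c" and ind: "\<not> affine_dependent {a, b, c}"
    by (auto simp: collinear_3_eq_affine_dependent)
  have dim3: "aff_dim {a, b, c} = 2" using aff_dim_affine_independent[OF ind] ne by simp
  have "g edge_of (convex hull {a, b, c}) \<longleftrightarrow> (\<exists>S. S \<subseteq> {a, b, c} \<and> g = convex hull S \<and> aff_dim S = 1)"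
    unfolding edge_of_def face_of_convex_hull_affine_independent[OF ind]
    using aff_dim_convex_hull by metis
  also have "\<dots> \<longleftrightarrow> (\<exists>S\<in>{{a, b}, {b, c}, {a, c}}. g = convex hull S)"
  proof
    assume "\<exists>S. S \<subseteq> {a, b, c} \<and> g = convex hull S \<and> aff_dim S = 1"
    then obtain S where S: "S \<subseteq> {a, b, c}" "g = convex hull S" "aff_dim S = 1" by blast
    have "S \<in> Pow {a, b, c}" using S(1) by simp
    then have "S \<in> {{}, {a}, {b}, {c}, {a, b}, {a, c}, {b, c}, {a, b, c}}"
      by (simp add: Pow_insert insert_commute)
    then have "S \<in> {{a, b}, {b, c}, {a, c}}"
      using S(3) dim3 by (elim insertE emptyE) auto
    then show "\<exists>S\<in>{{a, b}, {b, c}, {a, c}}. g = convex hull S" using S(2) by blast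
  next
    assume "\<exists>S\<in>{{a, b}, {b, c}, {a, c}}. g = convex hull S"
    then obtain S where S: "S \<in> {{a, b}, {b, c}, {a, c}}" "g = convex hull S" by blast
    then have "S \<subseteq> {a, b, c}" "aff_dim S = 1" using ne by auto
    then show "\<exists>S. S \<subseteq> {a, b, c} \<and> g = convex hull S \<and> aff_dim S = 1" using S by blast
  qed
  finally show ?thesis by (simp add: segment_convex_hull)
qed

text \<open>
  A triangle is \<open>(c, s, b)\<close> where \<open>c\<close> is the centre of its city and the signs \<open>s\<close> give its quadrant; in
  a replaced city \<open>b\<close> tells the triangle at the outer side (true) from the one at the centre (false),
  while the only triangle in a quadrant of a plain city has \<open>b\<close> true.
\<close>

type_synonym tri = "(int \<times> int) \<times> (int \<times> int) \<times> bool"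

definition signs :: "(int \<times> int) set" where
  "signs = {(1, 1), (1, -1), (-1, 1), (-1, -1)}"

definition city :: "int \<times> int \<Rightarrow> bool" where
  "city c \<longleftrightarrow> odd (fst c + snd c)"

definition replaced :: "int \<times> int \<Rightarrow> bool" where
  "replaced c \<longleftrightarrow> odd (fst c) \<and> even (snd c)"

definition second_kind :: "int \<times> int \<Rightarrow> bool" where
  "second_kind c \<longleftrightarrow> replaced c \<and> (fst c + snd c) mod 4 = 1"

text \<open>
  Coordinates in the quadrant \<open>s\<close> of the city \<open>c\<close>, ordered such that an added vertex of the city always
  has the coordinates \<open>(1/2, 0)\<close>.
\<close>

definition loc :: "int \<times> int \<Rightarrow> int \<times> int \<Rightarrow> real \<Rightarrow> real \<Rightarrow> point" where
  "loc c s \<alpha> \<beta> = (if second_kind c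
     then (of_int (fst c) + of_int (fst s) * \<beta>, of_int (snd c) + of_int (snd s) * \<alpha>)
     else (of_int (fst c) + of_int (fst s) * \<alpha>, of_int (snd c) + of_int (snd s) * \<beta>))"

definition apex :: "int \<times> int \<Rightarrow> real" where
  "apex c = (if replaced c then 1/2 else 0)"

definition region :: "tri \<Rightarrow> point set" where
  "region = (\<lambda>(c, s, b). convex hull (if b then {loc c s 1 0, loc c s (apex c) 0, loc c s 0 1}
     else {loc c s 0 0, loc c s (1/2) 0, loc c s 0 1}))"

definition triangles :: "tri set" where
  "triangles = {(c, s, b). city c \<and> s \<in> signs \<and> (b \<or> replaced c)}"

text \<open>Distance from the centre of the city in the l1 norm; the closed city is the unit
  ball.\<close>

definition l1 :: "int \<times> int \<Rightarrow> point \<Rightarrow> real" where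
  "l1 c z = \<bar>fst z - of_int (fst c)\<bar> + \<bar>snd z - of_int (snd c)\<bar>"

section \<open>Points of the triangles in city coordinates\<close>

lemma l1_loc: "s \<in> signs \<Longrightarrow> l1 c (loc c s \<alpha> \<beta>) = \<bar>\<alpha>\<bar> + \<bar>\<beta>\<bar>"
  by (auto simp: signs_def l1_def loc_def)

lemma loc_combination:
  "u + v + w = 1 \<Longrightarrow> u *\<^sub>R loc c s a1 b1 + v *\<^sub>R loc c s a2 b2 + w *\<^sub>R loc c s a3 b3 =
    loc c s (u * a1 + v * a2 + w * a3) (u * b1 + v * b2 + w * b3)"
proof -
  assume "u + v + w = 1"
  then have u: "u = 1 - v - w" by simp
  show ?thesis unfolding u by (simp add: loc_def algebra_simps)
qed

lemma det_loc:
  assumes "s \<in> signs" "(a2 - a1) * (b3 - b1) \<noteq> (b2 - b1) * (a3 - a1)"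
  shows "(fst (loc c s a2 b2) - fst (loc c s a1 b1)) * (snd (loc c s a3 b3) - snd (loc c s a1 b1)) \<noteq>
    (snd (loc c s a2 b2) - snd (loc c s a1 b1)) * (fst (loc c s a3 b3) - fst (loc c s a1 b1))"
  using assms by (auto simp: signs_def loc_def algebra_simps)

lemma det_region:
  assumes "s \<in> signs"
  shows "(fst (loc c s (apex c) 0) - fst (loc c s 1 0)) * (snd (loc c s 0 1) - snd (loc c s 1 0)) \<noteq>
      (snd (loc c s (apex c) 0) - snd (loc c s 1 0)) * (fst (loc c s 0 1) - fst (loc c s 1 0))"
    and "(fst (loc c s (1/2) 0) - fst (loc c s 0 0)) * (snd (loc c s 0 1) - snd (loc c s 0 0)) \<noteq>
      (snd (loc c s (1/2) 0) - snd (loc c s 0 0)) * (fst (loc c s 0 1) - fst (loc c s 0 0))"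
  by (rule det_loc[OF assms]; simp add: apex_def)+

lemma loc_mem_port:
  assumes "s \<in> signs"
  shows "loc c s \<alpha> \<beta> \<in> region (c, s, True) \<longleftrightarrow>
      0 \<le> \<beta> \<and> \<alpha> + \<beta> \<le> 1 \<and> 0 \<le> (if replaced c then 2 * \<alpha> + \<beta> - 1 else \<alpha>)"
    and "loc c s \<alpha> \<beta> \<in> interior (region (c, s, True)) \<longleftrightarrow>
      0 < \<beta> \<and> \<alpha> + \<beta> < 1 \<and> 0 < (if replaced c then 2 * \<alpha> + \<beta> - 1 else \<alpha>)"
proof -
  \<comment> \<open>Barycentric coordinates for the corners \<open>(1, 0)\<close>,
    \<open>(apex c, 0)\<close>, \<open>(0, 1)\<close>: the last weight must be
    \<open>\<beta>\<close>, and the other two solve a linear system whose solution depends on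
    whether the apex is at 1/2 or 0.\<close>
  define u where "u = (if replaced c then 2 * \<alpha> + \<beta> - 1 else \<alpha>)"
  define v where "v = (if replaced c then 2 * (1 - \<alpha> - \<beta>) else 1 - \<alpha> - \<beta>)"
  have sum: "u + v + \<beta> = 1" by (simp add: u_def v_def)
  have eq: "u *\<^sub>R loc c s 1 0 + v *\<^sub>R loc c s (apex c) 0 + \<beta> *\<^sub>R loc c s 0 1 = loc c s \<alpha> \<beta>"
  proof -
    have "u * 1 + v * apex c + \<beta> * 0 = \<alpha>" by (auto simp: u_def v_def apex_def field_simps)
    then show ?thesis unfolding loc_combination[OF sum] by simp
  qed
  have v: "0 \<le> v \<longleftrightarrow> \<alpha> + \<beta> \<le> 1" "0 < v \<longleftrightarrow> \<alpha> + \<beta> < 1" by (auto simp: v_def)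
  show "loc c s \<alpha> \<beta> \<in> region (c, s, True) \<longleftrightarrow>
      0 \<le> \<beta> \<and> \<alpha> + \<beta> \<le> 1 \<and> 0 \<le> (if replaced c then 2 * \<alpha> + \<beta> - 1 else \<alpha>)"
    using mem_triangle(1)[OF det_region(1)[OF assms] sum, of c] unfolding eq v u_def[symmetric]
    by (auto simp: region_def)
  show "loc c s \<alpha> \<beta> \<in> interior (region (c, s, True)) \<longleftrightarrow>
      0 < \<beta> \<and> \<alpha> + \<beta> < 1 \<and> 0 < (if replaced c then 2 * \<alpha> + \<beta> - 1 else \<alpha>)"
    using mem_triangle(2)[OF det_region(1)[OF assms] sum, of c] unfolding eq v u_def[symmetric]
    by (auto simp: region_def)
qed

lemma loc_mem_inner:
  assumes "s \<in> signs"
  shows "loc c s \<alpha> \<beta> \<in> region (c, s, False) \<longleftrightarrow> 0 \<le> \<alpha> \<and> 0 \<le> \<beta> \<and> 2 * \<alpha> + \<beta> \<le> 1"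
    and "loc c s \<alpha> \<beta> \<in> interior (region (c, s, False)) \<longleftrightarrow> 0 < \<alpha> \<and> 0 < \<beta> \<and> 2 * \<alpha> + \<beta> < 1"
proof -
  define u where "u = 1 - 2 * \<alpha> - \<beta>"
  have sum: "u + 2 * \<alpha> + \<beta> = 1" by (simp add: u_def)
  have eq: "u *\<^sub>R loc c s 0 0 + (2 * \<alpha>) *\<^sub>R loc c s (1/2) 0 + \<beta> *\<^sub>R loc c s 0 1 = loc c s \<alpha> \<beta>"
    unfolding loc_combination[OF sum] by simp
  show "loc c s \<alpha> \<beta> \<in> region (c, s, False) \<longleftrightarrow> 0 \<le> \<alpha> \<and> 0 \<le> \<beta> \<and> 2 * \<alpha> + \<beta> \<le> 1"
    using mem_triangle(1)[OF det_region(2)[OF assms] sum, of c] unfolding eq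
    by (auto simp: region_def u_def)
  show "loc c s \<alpha> \<beta> \<in> interior (region (c, s, False)) \<longleftrightarrow> 0 < \<alpha> \<and> 0 < \<beta> \<and> 2 * \<alpha> + \<beta> < 1"
    using mem_triangle(2)[OF det_region(2)[OF assms] sum, of c] unfolding eq
    by (auto simp: region_def u_def)
qed

lemma loc_surj:
  assumes "s \<in> signs"
  obtains \<alpha> \<beta> where "z = loc c s \<alpha> \<beta>"
proof
  let ?x = "of_int (fst s) * (fst z - of_int (fst c))" and ?y = "of_int (snd s) * (snd z - of_int (snd c))"
  show "z = loc c s (if second_kind c then ?y else ?x) (if second_kind c then ?x else ?y)"
    using assms by (auto simp: loc_def signs_def prod_eq_iff)
qed

lemma loc_surj_nonneg:
  obtains s \<alpha> \<beta> where "s \<in> signs" "z = loc c s \<alpha> \<beta>" "0 \<le> \<alpha>" "0 \<le> \<beta>"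
proof -
  let ?s = "(if fst z \<ge> of_int (fst c) then 1 else -1, if snd z \<ge> of_int (snd c) then 1 else -1)"
  let ?x = "\<bar>fst z - of_int (fst c)\<bar>" and ?y = "\<bar>snd z - of_int (snd c)\<bar>"
  show ?thesis
  proof (rule that)
    show "?s \<in> signs" by (simp add: signs_def)
    show "z = loc c ?s (if second_kind c then ?y else ?x) (if second_kind c then ?x else ?y)"
      by (auto simp: loc_def prod_eq_iff)
  qed auto
qed

lemma interior_regionE:
  assumes "(c, s, b) \<in> triangles" "z \<in> interior (region (c, s, b))"
  obtains \<alpha> \<beta> where "z = loc c s \<alpha> \<beta>" "0 < \<alpha>" "0 < \<beta>" "\<alpha> + \<beta> < 1"
    "replaced c \<Longrightarrow> (b \<longleftrightarrow> 2 * \<alpha> + \<beta> > 1)" "replaced c \<Longrightarrow> 2 * \<alpha> + \<beta> \<noteq> 1"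
proof -
  have s: "s \<in> signs" using assms(1) by (simp add: triangles_def)
  obtain \<alpha> \<beta> where z: "z = loc c s \<alpha> \<beta>" by (rule loc_surj[OF s])
  have "0 < \<alpha> \<and> 0 < \<beta> \<and> \<alpha> + \<beta> < 1 \<and> (replaced c \<longrightarrow> (b \<longleftrightarrow> 2 * \<alpha> + \<beta> > 1) \<and> 2 * \<alpha> + \<beta> \<noteq> 1)"
  proof (cases b)
    case True
    then show ?thesis using assms(2) loc_mem_port(2)[OF s, of c \<alpha> \<beta>] by (auto simp: z split: if_splits)
  next
    case False
    then show ?thesis using assms loc_mem_inner(2)[OF s, of c \<alpha> \<beta>] by (auto simp: z triangles_def)
  qed
  then show ?thesis using that[OF z] by blast
qed

lemma interior_region_nonempty: "t \<in> triangles \<Longrightarrow> interior (region t) \<noteq> {}"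
proof -
  assume "t \<in> triangles"
  then obtain c s b where t: "t = (c, s, b)" and s: "s \<in> signs" by (auto simp: triangles_def)
  show ?thesis
  proof (cases b)
    case True
    then have "loc c s (1/2) (1/4) \<in> interior (region t)" by (simp add: t loc_mem_port[OF s])
    then show ?thesis by blast
  next
    case False
    then have "loc c s (1/8) (1/8) \<in> interior (region t)" by (simp add: t loc_mem_inner[OF s])
    then show ?thesis by blast
  qed
qed

lemma compact_region: "compact (region t)"
  by (cases t) (simp add: region_def finite_imp_compact_convex_hull)

lemma convex_region: "convex (region t)"
  by (cases t) (simp add: region_def)

lemma closure_interior_region: "t \<in> triangles \<Longrightarrow> closure (interior (region t)) = region t"
  using convex_closure_interior[OF convex_region interior_region_nonempty]
  by (simp add: compact_imp_closed compact_region)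

text \<open>All centres have odd coordinate sum, so distinct ones are at l1-distance at least 2, and
  the triangle inequality excludes a point close to both.\<close>

lemma cities_apart:
  assumes "city c" "city c'" "l1 c z + l1 c' z < 2"
  shows "c = c'"
proof -
  have "real_of_int (\<bar>fst c - fst c'\<bar> + \<bar>snd c - snd c'\<bar>) \<le> l1 c z + l1 c' z"
    unfolding l1_def by simp
  then have "\<bar>fst c - fst c'\<bar> + \<bar>snd c - snd c'\<bar> < 2" using assms(3) by linarith
  moreover have "even (\<bar>fst c - fst c'\<bar> + \<bar>snd c - snd c'\<bar>)" using assms(1,2) by (auto simp: city_def)
  ultimately have "\<bar>fst c - fst c'\<bar> + \<bar>snd c - snd c'\<bar> = 0" by presburger
  then have "fst c = fst c'" "snd c = snd c'" by linarith+
  then show ?thesis by (simp add: prod_eq_iff)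
qed

lemma loc_pos_inj:
  assumes "loc c s \<alpha> \<beta> = loc c s' \<alpha>' \<beta>'" "s \<in> signs" "s' \<in> signs" "0 < \<alpha>" "0 < \<beta>" "0 < \<alpha>'" "0 < \<beta>'"
  shows "s = s' \<and> \<alpha> = \<alpha>' \<and> \<beta> = \<beta>'"
  using assms by (auto simp: loc_def signs_def split: if_splits)

lemma interior_regions_disjoint:
  assumes t: "t \<in> triangles" "t' \<in> triangles" and z: "z \<in> interior (region t)" "z \<in> interior (region t')"
  shows "t = t'"
proof -
  obtain c s b c' s' b' where tt: "t = (c, s, b)" "t' = (c', s', b')" by (metis prod_cases3)
  have T: "city c" "s \<in> signs" "b \<or> replaced c" "city c'" "s' \<in> signs" "b' \<or> replaced c'"
    using t by (auto simp: tt triangles_def)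
  obtain \<alpha> \<beta> where 1: "z = loc c s \<alpha> \<beta>" "0 < \<alpha>" "0 < \<beta>" "\<alpha> + \<beta> < 1"
    "replaced c \<Longrightarrow> (b \<longleftrightarrow> 2 * \<alpha> + \<beta> > 1)"
    using interior_regionE[of c s b z] t z unfolding tt by metis
  obtain \<alpha>' \<beta>' where 2: "z = loc c' s' \<alpha>' \<beta>'" "0 < \<alpha>'" "0 < \<beta>'" "\<alpha>' + \<beta>' < 1"
    "replaced c' \<Longrightarrow> (b' \<longleftrightarrow> 2 * \<alpha>' + \<beta>' > 1)"
    using interior_regionE[of c' s' b' z] t z unfolding tt by metis
  have "l1 c z < 1" using 1 by (simp add: l1_loc T)
  moreover have "l1 c' z < 1" unfolding 2(1) using 2 by (simp add: l1_loc T)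
  ultimately have c: "c = c'" using cities_apart[OF T(1,4), of z] by simp
  then have "s = s' \<and> \<alpha> = \<alpha>' \<and> \<beta> = \<beta>'" using 1 2 T loc_pos_inj[of c s \<alpha> \<beta> s' \<alpha>' \<beta>'] by metis
  then show ?thesis using c 1(5) 2(5) T by (auto simp: tt)
qed

section \<open>The drawn lines in city coordinates\<close>

lemma first_node_replacement_eq:
  "first_node_replacement p = {z. 2 * \<bar>fst z - fst p\<bar> + \<bar>snd z - snd p\<bar> = 1}"
proof (intro equalityI subsetI)
  fix z assume z: "z \<in> {z. 2 * \<bar>fst z - fst p\<bar> + \<bar>snd z - snd p\<bar> = 1}"
  define u where "u = \<bar>snd z - snd p\<bar>"
  have zu: "2 * \<bar>fst z - fst p\<bar> + u = 1" using z by (simp add: u_def)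
  have "0 \<le> u" by (simp add: u_def)
  moreover obtain v where v: "\<bar>fst z - fst p\<bar> = v" "0 \<le> v" by simp
  ultimately have u: "0 \<le> u" "u \<le> 1" "\<bar>fst z - fst p\<bar> = (1 - u) / 2"
    using zu unfolding v(1) by simp_all
  \<comment> \<open>The four segments form a rhombus, the unit sphere of a weighted l1 norm. The
    added vertex \<open>m\<close> and the tip \<open>q\<close> are those in the quadrant of
    \<open>z\<close>, and the height \<open>u\<close> is the position on the segment.\<close>
  define m where "m = (if fst z \<ge> fst p then p + (1/2, 0) else p - (1/2, 0))"
  define q where "q = (if snd z \<ge> snd p then p + (0, 1) else p - (0, 1))"
  have "z = (1 - u) *\<^sub>R m + u *\<^sub>R q"
    using u by (auto simp: prod_eq_iff m_def q_def u_def algebra_simps abs_if split: if_splits)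
  then have "z \<in> closed_segment m q" using u by (auto simp: closed_segment_def)
  then show "z \<in> first_node_replacement p"
    unfolding first_node_replacement_def m_def q_def by (auto split: if_splits)
next
  fix z assume "z \<in> first_node_replacement p"
  then obtain m q u where mq: "m \<in> {p + (1/2, 0), p - (1/2, 0)}" "q \<in> {p + (0, 1), p - (0, 1)}"
    and u: "0 \<le> u" "u \<le> 1" "z = (1 - u) *\<^sub>R m + u *\<^sub>R q"
    unfolding first_node_replacement_def closed_segment_def by blast
  obtain \<sigma> :: real where \<sigma>: "\<bar>\<sigma>\<bar> = 1" "m = p + (\<sigma> / 2, 0)"
    using mq(1) that[of 1] that[of "-1"] by (auto simp: prod_eq_iff)
  obtain \<tau> :: real where \<tau>: "\<bar>\<tau>\<bar> = 1" "q = p + (0, \<tau>)"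
    using mq(2) that[of 1] that[of "-1"] by (auto simp: prod_eq_iff)
  have "fst z - fst p = \<sigma> * ((1 - u) / 2)" "snd z - snd p = \<tau> * u"
    unfolding u(3) \<sigma> \<tau> by (simp_all add: algebra_simps)
  then have "\<bar>fst z - fst p\<bar> = \<bar>\<sigma>\<bar> * \<bar>(1 - u) / 2\<bar>" "\<bar>snd z - snd p\<bar> = \<bar>\<tau>\<bar> * \<bar>u\<bar>"
    by (simp_all only: abs_mult)
  then have "\<bar>fst z - fst p\<bar> = (1 - u) / 2" "\<bar>snd z - snd p\<bar> = u"
    using u(1,2) \<sigma>(1) \<tau>(1) by simp_all
  then show "z \<in> {z. 2 * \<bar>fst z - fst p\<bar> + \<bar>snd z - snd p\<bar> = 1}" by simp
qed

lemma second_node_replacement_eq: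
  "second_node_replacement p = {z. \<bar>fst z - fst p\<bar> + 2 * \<bar>snd z - snd p\<bar> = 1}"
proof -
  have "second_node_replacement p = prod.swap ` first_node_replacement (prod.swap p)"
  proof -
    have "prod.swap ` closed_segment a b = closed_segment (prod.swap a) (prod.swap b)" for a b :: point
      by (rule closed_segment_linear_image[symmetric]) (auto intro!: linearI)
    then show ?thesis
      by (cases p) (simp add: first_node_replacement_def second_node_replacement_def image_UN image_Un)
  qed
  also have "\<dots> = {z. \<bar>fst z - fst p\<bar> + 2 * \<bar>snd z - snd p\<bar> = 1}"
    unfolding first_node_replacement_eq by force
  finally show ?thesis .
qed

text \<open>Together with \<open>second_kind_nodes\<close> this shows that the four families of
  nodes exhaust the points with odd first and even second coordinate, and that the kind depends only
  on the coordinate sum modulo 4.\<close>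

lemma first_kind_nodes:
  "(\<exists>k l. c = (4 * k + 3, 4 * l) \<or> c = (4 * k + 1, 4 * l + 2)) \<longleftrightarrow> replaced c \<and> \<not> second_kind c"
proof
  assume "replaced c \<and> \<not> second_kind c"
  then have c: "odd (fst c)" "even (snd c)" "(fst c + snd c) mod 4 \<noteq> 1"
    by (auto simp: replaced_def second_kind_def)
  show "\<exists>k l. c = (4 * k + 3, 4 * l) \<or> c = (4 * k + 1, 4 * l + 2)"
  proof (cases "snd c mod 4 = 0")
    case True
    then have "fst c mod 4 = 3" using c by presburger
    then have "c = (4 * (fst c div 4) + 3, 4 * (snd c div 4))"
      using True by (simp add: prod_eq_iff) presburger
    then show ?thesis by blast
  next
    case False
    then have "fst c mod 4 = 1 \<and> snd c mod 4 = 2" using c by presburger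
    then have "c = (4 * (fst c div 4) + 1, 4 * (snd c div 4) + 2)"
      by (simp add: prod_eq_iff) presburger
    then show ?thesis by blast
  qed
next
  assume "\<exists>k l. c = (4 * k + 3, 4 * l) \<or> c = (4 * k + 1, 4 * l + 2)"
  then obtain k l where "c = (4 * k + 3, 4 * l) \<or> c = (4 * k + 1, 4 * l + 2)" by blast
  then show "replaced c \<and> \<not> second_kind c"
    by (elim disjE) (simp_all add: replaced_def second_kind_def, presburger+)
qed

lemma second_kind_nodes:
  "(\<exists>k l. c = (4 * k + 1, 4 * l) \<or> c = (4 * k + 3, 4 * l + 2)) \<longleftrightarrow> second_kind c"
proof
  assume "second_kind c"
  then have c: "odd (fst c)" "even (snd c)" "(fst c + snd c) mod 4 = 1"
    by (auto simp: replaced_def second_kind_def)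
  show "\<exists>k l. c = (4 * k + 1, 4 * l) \<or> c = (4 * k + 3, 4 * l + 2)"
  proof (cases "snd c mod 4 = 0")
    case True
    then have "fst c mod 4 = 1" using c by presburger
    then have "c = (4 * (fst c div 4) + 1, 4 * (snd c div 4))"
      using True by (simp add: prod_eq_iff) presburger
    then show ?thesis by blast
  next
    case False
    then have "fst c mod 4 = 3 \<and> snd c mod 4 = 2" using c by presburger
    then have "c = (4 * (fst c div 4) + 3, 4 * (snd c div 4) + 2)"
      by (simp add: prod_eq_iff) presburger
    then show ?thesis by blast
  qed
next
  assume "\<exists>k l. c = (4 * k + 1, 4 * l) \<or> c = (4 * k + 3, 4 * l + 2)"
  then obtain k l where "c = (4 * k + 1, 4 * l) \<or> c = (4 * k + 3, 4 * l + 2)" by blast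
  then show "second_kind c"
    by (elim disjE) (simp_all add: replaced_def second_kind_def, presburger+)
qed

lemma mem_replaced_lattice:
  "z \<in> replaced_lattice \<longleftrightarrow> z \<in> diagonal_square_lattice \<or>
    (\<exists>c. replaced c \<and> \<not> second_kind c \<and>
      2 * \<bar>fst z - of_int (fst c)\<bar> + \<bar>snd z - of_int (snd c)\<bar> = 1) \<or>
    (\<exists>c. second_kind c \<and> \<bar>fst z - of_int (fst c)\<bar> + 2 * \<bar>snd z - of_int (snd c)\<bar> = 1)"
proof -
  let ?f = "\<lambda>c. z \<in> first_node_replacement (of_int (fst c), of_int (snd c))"
  let ?g = "\<lambda>c. z \<in> second_node_replacement (of_int (fst c), of_int (snd c))"
  have "z \<in> replaced_lattice \<longleftrightarrow> z \<in> diagonal_square_lattice \<or>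
      (\<exists>k l. ?f (4 * k + 3, 4 * l) \<or> ?f (4 * k + 1, 4 * l + 2) \<or> ?g (4 * k + 1, 4 * l) \<or> ?g (4 * k + 3, 4 * l + 2))"
    unfolding replaced_lattice_def by simp
  also have "(\<exists>k l. ?f (4 * k + 3, 4 * l) \<or> ?f (4 * k + 1, 4 * l + 2) \<or> ?g (4 * k + 1, 4 * l) \<or> ?g (4 * k + 3, 4 * l + 2)) \<longleftrightarrow>
      (\<exists>c. (\<exists>k l. c = (4 * k + 3, 4 * l) \<or> c = (4 * k + 1, 4 * l + 2)) \<and> ?f c) \<or>
      (\<exists>c. (\<exists>k l. c = (4 * k + 1, 4 * l) \<or> c = (4 * k + 3, 4 * l + 2)) \<and> ?g c)"
    by blast
  finally show ?thesis
    unfolding first_kind_nodes second_kind_nodes first_node_replacement_eq second_node_replacement_eq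
    by simp
qed

lemma boundary_in_lattice:
  assumes s: "s \<in> signs" and c: "city c" and nonneg: "0 \<le> \<alpha>" "0 \<le> \<beta>"
    and b: "\<alpha> = 0 \<or> \<beta> = 0 \<or> \<alpha> + \<beta> = 1 \<or> (replaced c \<and> 2 * \<alpha> + \<beta> = 1)"
  shows "loc c s \<alpha> \<beta> \<in> replaced_lattice"
proof -
  let ?z = "loc c s \<alpha> \<beta>"
  consider "\<alpha> = 0 \<or> \<beta> = 0" | "\<alpha> + \<beta> = 1" | "replaced c" "2 * \<alpha> + \<beta> = 1" using b by blast
  then show ?thesis
  proof cases
    case 1
    then have "fst ?z \<in> \<int> \<or> snd ?z \<in> \<int>" by (auto simp: loc_def)
    then have "?z \<in> diagonal_square_lattice"
      unfolding diagonal_square_lattice_def by (auto simp: case_prod_beta)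
    then show ?thesis by (simp add: mem_replaced_lattice)
  next
    case 2
    have odd: "odd (fst c + snd c)" "odd (snd c - fst c)" using c by (auto simp: city_def)
    obtain k where k: "fst c + snd c = 2 * k + 1" using odd(1) by (elim oddE)
    obtain l where l: "snd c - fst c = 2 * l + 1" using odd(2) by (elim oddE)
    have kr: "of_int (fst c) + of_int (snd c) = 2 * real_of_int k + 1"
      "of_int (snd c) - of_int (fst c) = 2 * real_of_int l + 1"
      using arg_cong[OF k, of real_of_int] arg_cong[OF l, of real_of_int] by simp_all
    \<comment> \<open>The outer side in each of the four quadrants lies on one of the four diagonals
      bounding the city.\<close>
    have "snd ?z - fst ?z \<in> {2 * of_int l, 2 * of_int (l + 1)} \<or>
        fst ?z + snd ?z \<in> {2 * of_int k, 2 * of_int (k + 1)}"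
      using s 2 kr unfolding loc_def signs_def by auto
    then have "(\<exists>m::int. snd ?z - fst ?z = 2 * of_int m) \<or> (\<exists>m::int. fst ?z + snd ?z = 2 * of_int m)"
      by blast
    then have "?z \<in> diagonal_square_lattice"
      unfolding diagonal_square_lattice_def by (auto simp: case_prod_beta)
    then show ?thesis by (simp add: mem_replaced_lattice)
  next
    case 3
    show ?thesis
    proof (cases "second_kind c")
      case True
      then have "\<bar>fst ?z - of_int (fst c)\<bar> + 2 * \<bar>snd ?z - of_int (snd c)\<bar> = 1"
        using 3 nonneg s by (auto simp: loc_def signs_def)
      then show ?thesis using True unfolding mem_replaced_lattice by blast
    next
      case False
      then have "2 * \<bar>fst ?z - of_int (fst c)\<bar> + \<bar>snd ?z - of_int (snd c)\<bar> = 1"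
        using 3 nonneg s by (auto simp: loc_def signs_def)
      then show ?thesis using False 3 unfolding mem_replaced_lattice by blast
    qed
  qed
qed

lemma of_int_abs_less_one:
  assumes "\<bar>real_of_int k\<bar> < 1" shows "k = 0"
  using assms by linarith

text \<open>Such a point is closer than 1 to the centre in the l1 norm. An integer coordinate would
  have to equal that of the centre, and a drawn diagonal would force an even integer to equal the
  odd sum or difference of the centre's coordinates. Added segments stay within their own
  city.\<close>

lemma interior_not_in_lattice:
  assumes s: "s \<in> signs" and c: "city c" and pos: "0 < \<alpha>" "0 < \<beta>" "\<alpha> + \<beta> < 1"
    and b: "replaced c \<Longrightarrow> 2 * \<alpha> + \<beta> \<noteq> 1"
  shows "loc c s \<alpha> \<beta> \<notin> replaced_lattice"
proof
  let ?z = "loc c s \<alpha> \<beta>"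
  assume z: "?z \<in> replaced_lattice"
  have l1: "l1 c ?z < 1" using pos by (simp add: l1_loc s)
  have ne: "fst ?z \<noteq> of_int (fst c)" "snd ?z \<noteq> of_int (snd c)"
    using pos s by (auto simp: loc_def signs_def)
  have "?z \<notin> diagonal_square_lattice"
  proof
    assume d: "?z \<in> diagonal_square_lattice"
    obtain x y where xy: "?z = (x, y)" by fastforce
    have sm: "\<bar>x - of_int (fst c)\<bar> + \<bar>y - of_int (snd c)\<bar> < 1" using l1 by (simp add: l1_def xy)
    consider "x \<in> \<int>" | "y \<in> \<int>" | k :: int where "y - x = 2 * of_int k" | k :: int where "x + y = 2 * of_int k"
      using d unfolding xy diagonal_square_lattice_def by auto
    then show False
    proof cases
      case 1
      then obtain k where "x = of_int k" by (auto elim: Ints_cases)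
      then have "k - fst c = 0" using sm by (intro of_int_abs_less_one) auto
      then show False using ne(1) \<open>x = of_int k\<close> by (simp add: xy)
    next
      case 2
      then obtain k where "y = of_int k" by (auto elim: Ints_cases)
      then have "k - snd c = 0" using sm by (intro of_int_abs_less_one) auto
      then show False using ne(2) \<open>y = of_int k\<close> by (simp add: xy)
    next
      case 3
      then have "\<bar>2 * real_of_int k - of_int (snd c) + of_int (fst c)\<bar> < 1" using sm by linarith
      then have "2 * k - snd c + fst c = 0" by (intro of_int_abs_less_one) simp
      then show False using c unfolding city_def by presburger
    next
      case 4
      then have "\<bar>2 * real_of_int k - of_int (snd c) - of_int (fst c)\<bar> < 1" using sm by linarith
      then have "2 * k - snd c - fst c = 0" by (intro of_int_abs_less_one) simp
      then show False using c unfolding city_def by presburger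
    qed
  qed
  moreover have same: "c' = c" if "replaced c'" "l1 c' ?z \<le> 1" for c'
    using that l1 c by (intro cities_apart[of c' c ?z]) (auto simp: replaced_def city_def)
  moreover have "2 * \<bar>fst ?z - of_int (fst c)\<bar> + \<bar>snd ?z - of_int (snd c)\<bar> \<noteq> 1"
    if "replaced c" "\<not> second_kind c"
    using that b pos s by (auto simp: loc_def signs_def)
  moreover have "\<bar>fst ?z - of_int (fst c)\<bar> + 2 * \<bar>snd ?z - of_int (snd c)\<bar> \<noteq> 1"
    if "second_kind c"
    using that b pos s by (auto simp: loc_def signs_def second_kind_def)
  ultimately show False
  proof -
    obtain c' where N: "(replaced c' \<and> \<not> second_kind c' \<and>
        2 * \<bar>fst ?z - of_int (fst c')\<bar> + \<bar>snd ?z - of_int (snd c')\<bar> = 1) \<or>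
      (second_kind c' \<and> \<bar>fst ?z - of_int (fst c')\<bar> + 2 * \<bar>snd ?z - of_int (snd c')\<bar> = 1)"
      using z \<open>?z \<notin> diagonal_square_lattice\<close> unfolding mem_replaced_lattice by blast
    then have "replaced c'" by (auto simp: second_kind_def)
    moreover have "l1 c' ?z \<le> 1" using N unfolding l1_def by (smt (verit))
    ultimately have "c' = c" by (rule same)
    then show False
      using N \<open>\<lbrakk>replaced c; \<not> second_kind c\<rbrakk> \<Longrightarrow> 2 * \<bar>fst ?z - of_int (fst c)\<bar> + \<bar>snd ?z - of_int (snd c)\<bar> \<noteq> 1\<close>
        \<open>second_kind c \<Longrightarrow> \<bar>fst ?z - of_int (fst c)\<bar> + 2 * \<bar>snd ?z - of_int (snd c)\<bar> \<noteq> 1\<close> by blast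
  qed
qed

lemma regions_cover: "\<exists>t\<in>triangles. z \<in> region t"
proof -
  obtain x y where xy: "z = (x, y)" by fastforce
  \<comment> \<open>The drawn diagonals cut the plane into strips of two directions;
    \<open>i\<close> and \<open>j\<close> are the strips containing \<open>z\<close>, and
    \<open>c\<close> is the centre of the square where they cross.\<close>
  define i j where "i = \<lfloor>(x + y) / 2\<rfloor>" and "j = \<lfloor>(x - y) / 2\<rfloor>"
  define c where "c = (i + j + 1, i - j)"
  have c: "city c" by (simp add: c_def city_def)
  have b: "of_int i \<le> (x + y) / 2" "(x + y) / 2 < of_int i + 1"
    "of_int j \<le> (x - y) / 2" "(x - y) / 2 < of_int j + 1"
    unfolding i_def j_def by linarith+
  have l1: "l1 c z \<le> 1" using b unfolding l1_def xy c_def by (simp add: abs_if field_simps)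
  obtain s \<alpha> \<beta> where s: "s \<in> signs" and z: "z = loc c s \<alpha> \<beta>" and nonneg: "0 \<le> \<alpha>" "0 \<le> \<beta>"
    by (rule loc_surj_nonneg)
  have le: "\<alpha> + \<beta> \<le> 1" using l1 nonneg unfolding z l1_loc[OF s] by simp
  show ?thesis
  proof (cases "replaced c \<and> 2 * \<alpha> + \<beta> < 1")
    case True
    then have "z \<in> region (c, s, False)" "(c, s, False) \<in> triangles"
      unfolding z loc_mem_inner(1)[OF s] using nonneg c s by (auto simp: triangles_def)
    then show ?thesis by blast
  next
    case False
    then have "z \<in> region (c, s, True)" "(c, s, True) \<in> triangles"
      unfolding z loc_mem_port(1)[OF s] using nonneg c s le by (auto simp: triangles_def)
    then show ?thesis by blast
  qed
qed

lemma interior_region_avoids_lattice: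
  assumes t: "t \<in> triangles" shows "interior (region t) \<inter> replaced_lattice = {}"
proof -
  obtain c s b where tt: "t = (c, s, b)" by (metis prod_cases3)
  have T: "city c" "s \<in> signs" using t by (auto simp: tt triangles_def)
  have "z \<notin> replaced_lattice" if z: "z \<in> interior (region t)" for z
    by (rule interior_regionE[OF t[unfolded tt] z[unfolded tt]])
       (use interior_not_in_lattice[OF T(2,1)] in blast)
  then show ?thesis by blast
qed

lemma boundary_region_in_lattice:
  assumes t: "t \<in> triangles" shows "region t - interior (region t) \<subseteq> replaced_lattice"
proof
  fix z assume z: "z \<in> region t - interior (region t)"
  obtain c s b where tt: "t = (c, s, b)" by (metis prod_cases3)
  have T: "city c" "s \<in> signs" "b \<or> replaced c" using t by (auto simp: tt triangles_def)
  obtain \<alpha> \<beta> where loc: "z = loc c s \<alpha> \<beta>" by (rule loc_surj[OF T(2)])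
  have "0 \<le> \<alpha> \<and> 0 \<le> \<beta> \<and> (\<alpha> = 0 \<or> \<beta> = 0 \<or> \<alpha> + \<beta> = 1 \<or> (replaced c \<and> 2 * \<alpha> + \<beta> = 1))"
  proof (cases b)
    case True
    then show ?thesis
      using z loc_mem_port[OF T(2), of c \<alpha> \<beta>] unfolding tt loc by (auto split: if_splits)
  next
    case False
    then show ?thesis
      using z T(3) loc_mem_inner[OF T(2), of c \<alpha> \<beta>] unfolding tt loc by auto
  qed
  then show "z \<in> replaced_lattice" unfolding loc by (intro boundary_in_lattice T) auto
qed

text \<open>The open triangles are connected, avoid the drawn set and have their frontier in it; a
  component meeting one of them can therefore be neither larger nor smaller.\<close>

lemma components_lattice: "components (- replaced_lattice) = (\<lambda>t. interior (region t)) ` triangles"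
proof -
  have eq: "C = interior (region t)"
    if C: "C \<in> components (- replaced_lattice)" and z: "z \<in> C" "z \<in> region t" and t: "t \<in> triangles" for C z t
  proof -
    have Csub: "C \<subseteq> - replaced_lattice" using in_components_subset[OF C] .
    have zi: "z \<in> interior (region t)"
      using z Csub boundary_region_in_lattice[OF t] by blast
    have "interior (region t) \<subseteq> C"
    proof (rule components_maximal[OF C])
      show "connected (interior (region t))"
        by (intro convex_connected convex_interior convex_region)
      show "interior (region t) \<subseteq> - replaced_lattice" using interior_region_avoids_lattice[OF t] by blast
    qed (use z zi in blast)
    moreover have "C \<subseteq> interior (region t)"
    proof (rule ccontr)
      assume "\<not> C \<subseteq> interior (region t)"
      then have "C \<inter> frontier (interior (region t)) \<noteq> {}"
        using zi z by (intro connected_Int_frontier in_components_connected[OF C]) auto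
      moreover have "frontier (interior (region t)) \<subseteq> region t - interior (region t)"
        unfolding frontier_def closure_interior_region[OF t] by simp
      ultimately show False using boundary_region_in_lattice[OF t] Csub by blast
    qed
    ultimately show ?thesis by blast
  qed
  show ?thesis
  proof (intro equalityI subsetI)
    fix C assume C: "C \<in> components (- replaced_lattice)"
    then obtain z where "z \<in> C" using in_components_nonempty by blast
    moreover obtain t where "t \<in> triangles" "z \<in> region t" using regions_cover by blast
    ultimately show "C \<in> (\<lambda>t. interior (region t)) ` triangles" using eq[OF C] by blast
  next
    fix U assume "U \<in> (\<lambda>t. interior (region t)) ` triangles"
    then obtain t where t: "t \<in> triangles" "U = interior (region t)" by blast
    obtain z where z: "z \<in> U" using interior_region_nonempty[OF t(1)] t(2) by blast
    then have "z \<in> \<Union> (components (- replaced_lattice))"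
      using interior_region_avoids_lattice[OF t(1)] t(2) unfolding Union_components by blast
    then obtain C where C: "C \<in> components (- replaced_lattice)" "z \<in> C" by blast
    have "z \<in> region t" using z interior_subset t(2) by blast
    then show "U \<in> components (- replaced_lattice)" using eq[OF C _ t(1)] C t(2) by simp
  qed
qed

lemma elementary_regions_eq: "elementary_regions replaced_lattice = region ` triangles"
  unfolding elementary_regions_def components_lattice image_image
  by (intro image_cong refl closure_interior_region)

text \<open>Three kinds of neighbours: across an outer side, inner and outer triangle of one
  quadrant, and reflection in an axis. The exclusions concern outer triangles of a replaced city:
  they share an edge on the axis through the added vertices, but only a corner on the other
  axis.\<close>

definition tri_adj :: "tri \<Rightarrow> tri \<Rightarrow> bool" where
  "tri_adj = (\<lambda>(c, s, b) (c', s', b').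
     (b \<and> b' \<and> c' = (fst c + fst s, snd c + snd s) \<and> s' = (- fst s, - snd s)) \<or>
     (c' = c \<and>
       (if b \<noteq> b' then s' = s
        else (s' = (fst s, - snd s) \<and> \<not> (b \<and> second_kind c)) \<or>
             (s' = (- fst s, snd s) \<and> \<not> (b \<and> replaced c \<and> \<not> second_kind c)))))"

definition corners :: "tri \<Rightarrow> point \<times> point \<times> point" where
  "corners = (\<lambda>(c, s, b). if b then (loc c s 1 0, loc c s (apex c) 0, loc c s 0 1)
     else (loc c s 0 0, loc c s (1/2) 0, loc c s 0 1))"

definition edge_ends :: "tri \<Rightarrow> (point \<times> point) set" where
  "edge_ends t = (case corners t of (u, v, w) \<Rightarrow> {(u, v), (v, w), (u, w)})"

section \<open>Edges shared by two triangles\<close>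

lemma edge_of_region:
  assumes "t \<in> triangles"
  shows "g edge_of region t \<longleftrightarrow> (\<exists>(u, v)\<in>edge_ends t. g = closed_segment u v)"
proof -
  obtain c s b where t: "t = (c, s, b)" by (metis prod_cases3)
  have s: "s \<in> signs" using assms by (auto simp: t triangles_def)
  show ?thesis
    unfolding t region_def edge_ends_def corners_def prod.case
    using edge_of_triangle[OF det_region(1)[OF s], of g c] edge_of_triangle[OF det_region(2)[OF s], of g c]
    by auto
qed

lemma closed_segment_inj:
  fixes a b c d :: "'a :: euclidean_space"
  assumes "closed_segment a b = closed_segment c d"
  shows "{a, b} = {c, d}"
proof -
  have "x \<in> {a, b} \<longleftrightarrow> x \<in> {c, d}" for x
    using extreme_point_of_segment[of x a b] extreme_point_of_segment[of x c d] assms by simp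
  then show ?thesis by blast
qed

text \<open>Among the edges of a triangle only the outer side of the city has its midpoint at
  distance 1 from the centre. This recognises an edge lying in two cities.\<close>

lemma l1_edge_midpoint:
  assumes t: "(c, s, b) \<in> triangles" and e: "(u, v) \<in> edge_ends (c, s, b)"
    and m: "l1 c (midpoint u v) = 1"
  shows "b" "u = loc c s 1 0" "v = loc c s 0 1"
proof -
  have s: "s \<in> signs" using t by (auto simp: triangles_def)
  have mid: "midpoint (loc c s a1 b1) (loc c s a2 b2) = loc c s ((a1 + a2) / 2) ((b1 + b2) / 2)"
    for a1 b1 a2 b2
    by (simp add: midpoint_def loc_def field_simps)
  have "b \<and> u = loc c s 1 0 \<and> v = loc c s 0 1"
    using e m by (auto simp: edge_ends_def corners_def mid l1_loc[OF s] apex_def split: if_splits)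
  then show "b" "u = loc c s 1 0" "v = loc c s 0 1" by blast+
qed

lemma l1_edge_le:
  assumes t: "(c, s, b) \<in> triangles" and e: "(u, v) \<in> edge_ends (c, s, b)"
  shows "l1 c (midpoint u v) \<le> 1"
proof -
  have s: "s \<in> signs" using t by (auto simp: triangles_def)
  have mid: "midpoint (loc c s a1 b1) (loc c s a2 b2) = loc c s ((a1 + a2) / 2) ((b1 + b2) / 2)"
    for a1 b1 a2 b2
    by (simp add: midpoint_def loc_def field_simps)
  show ?thesis
    using e by (auto simp: edge_ends_def corners_def mid l1_loc[OF s] apex_def split: if_splits)
qed

lemma hypotenuse_midpoint:
  assumes "s \<in> signs"
  shows "midpoint (loc c s 1 0) (loc c s 0 1) = (of_int (fst c) + of_int (fst s) / 2, of_int (snd c) + of_int (snd s) / 2)"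
  using assms by (auto simp: midpoint_def loc_def signs_def field_simps)

text \<open>The signs of a quadrant in the order of the local coordinates, which is reversed for
  replacements of the second kind.\<close>

definition turn :: "int \<times> int \<Rightarrow> int \<times> int \<Rightarrow> real \<times> real" where
  "turn c s = (if second_kind c then (of_int (snd s), of_int (fst s)) else (of_int (fst s), of_int (snd s)))"

lemma loc_eq_iff:
  "loc c s x y = loc c s' x' y' \<longleftrightarrow>
    fst (turn c s) * x = fst (turn c s') * x' \<and> snd (turn c s) * y = snd (turn c s') * y'"
  by (auto simp: loc_def turn_def)

context
  fixes L :: "int \<times> int \<Rightarrow> real \<Rightarrow> real \<Rightarrow> point" and a b a' b' :: real and s s' :: "int \<times> int"
  assumes eq: "\<And>x y x' y'. L s x y = L s x' y' \<longleftrightarrow> a * x = a * x' \<and> b * y = b * y'"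
      "\<And>x y x' y'. L s' x y = L s' x' y' \<longleftrightarrow> a' * x = a' * x' \<and> b' * y = b' * y'"
      "\<And>x y x' y'. L s x y = L s' x' y' \<longleftrightarrow> a * x = a' * x' \<and> b * y = b' * y'"
    and signs: "a = 1 \<or> a = -1" "b = 1 \<or> b = -1" "a' = 1 \<or> a' = -1" "b' = 1 \<or> b' = -1"
begin

text \<open>The points \<open>loc c s x y\<close> enter only through their coincidences, expressed
  by the signs \<open>a\<close> and \<open>b\<close>. Comparing two lists of three edges is then a
  finite check over signs, valid for both orientations of the local coordinates at once.\<close>

lemma port_port_share:
    assumes ne: "\<not> (a' = a \<and> b' = b)"
    shows "(\<exists>(u, v)\<in>{(L s 1 0, L s 0 0), (L s 0 0, L s 0 1), (L s 1 0, L s 0 1)}.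
      \<exists>(u', v')\<in>{(L s' 1 0, L s' 0 0), (L s' 0 0, L s' 0 1), (L s' 1 0, L s' 0 1)}. (u = u' \<and> v = v') \<or> (u = v' \<and> v = u')) \<longleftrightarrow> (a' = a \<and> b' = - b) \<or> (a' = - a \<and> b' = b)"
  using signs ne by (elim disjE; simp only: bex_simps prod.case simp_thms eq; simp)

lemma half_port_share:
    assumes ne: "\<not> (a' = a \<and> b' = b)"
    shows "(\<exists>(u, v)\<in>{(L s 1 0, L s (1/2) 0), (L s (1/2) 0, L s 0 1), (L s 1 0, L s 0 1)}.
      \<exists>(u', v')\<in>{(L s' 1 0, L s' (1/2) 0), (L s' (1/2) 0, L s' 0 1), (L s' 1 0, L s' 0 1)}. (u = u' \<and> v = v') \<or> (u = v' \<and> v = u')) \<longleftrightarrow> (a' = a \<and> b' = - b)"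
  using signs ne by (elim disjE; simp only: bex_simps prod.case simp_thms eq; simp)

lemma inner_inner_share:
    assumes ne: "\<not> (a' = a \<and> b' = b)"
    shows "(\<exists>(u, v)\<in>{(L s 0 0, L s (1/2) 0), (L s (1/2) 0, L s 0 1), (L s 0 0, L s 0 1)}.
      \<exists>(u', v')\<in>{(L s' 0 0, L s' (1/2) 0), (L s' (1/2) 0, L s' 0 1), (L s' 0 0, L s' 0 1)}. (u = u' \<and> v = v') \<or> (u = v' \<and> v = u')) \<longleftrightarrow> (a' = a \<and> b' = - b) \<or> (a' = - a \<and> b' = b)"
  using signs ne by (elim disjE; simp only: bex_simps prod.case simp_thms eq; simp)

lemma port_inner_share:
      shows "(\<exists>(u, v)\<in>{(L s 1 0, L s (1/2) 0), (L s (1/2) 0, L s 0 1), (L s 1 0, L s 0 1)}.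
      \<exists>(u', v')\<in>{(L s' 0 0, L s' (1/2) 0), (L s' (1/2) 0, L s' 0 1), (L s' 0 0, L s' 0 1)}. (u = u' \<and> v = v') \<or> (u = v' \<and> v = u')) \<longleftrightarrow> a' = a \<and> b' = b"
  using signs by (elim disjE; simp only: bex_simps prod.case simp_thms eq; simp)

lemma inner_port_share:
      shows "(\<exists>(u, v)\<in>{(L s 0 0, L s (1/2) 0), (L s (1/2) 0, L s 0 1), (L s 0 0, L s 0 1)}.
      \<exists>(u', v')\<in>{(L s' 1 0, L s' (1/2) 0), (L s' (1/2) 0, L s' 0 1), (L s' 1 0, L s' 0 1)}. (u = u' \<and> v = v') \<or> (u = v' \<and> v = u')) \<longleftrightarrow> a' = a \<and> b' = b"
  using signs by (elim disjE; simp only: bex_simps prod.case simp_thms eq; simp)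

end

text \<open>Within one city the corners are compared directly. For different cities a common edge
  must be the outer side of both, because its midpoint has distance at most 1 from both centres and
  these are at least 2 apart.\<close>

lemma shared_edge_iff:
  assumes t: "t \<in> triangles" "t' \<in> triangles" and ne: "t \<noteq> t'"
  shows "(\<exists>g. g edge_of region t \<and> g edge_of region t') \<longleftrightarrow> tri_adj t t'"
proof -
  obtain c s p c' s' p' where tt: "t = (c, s, p)" "t' = (c', s', p')" by (metis prod_cases3)
  have T: "city c" "s \<in> signs" "p \<or> replaced c" "city c'" "s' \<in> signs" "p' \<or> replaced c'"
    using t by (auto simp: tt triangles_def)
  have share: "(\<exists>g. g edge_of region t \<and> g edge_of region t') \<longleftrightarrow>
    (\<exists>(u, v)\<in>edge_ends t. \<exists>(u', v')\<in>edge_ends t'. closed_segment u v = closed_segment u' v')"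
    unfolding edge_of_region[OF t(1)] edge_of_region[OF t(2)] by blast
  show ?thesis
  proof (cases "c = c'")
    case True
    have seg: "closed_segment u v = closed_segment u' v' \<longleftrightarrow> (u = u' \<and> v = v') \<or> (u = v' \<and> v = u')"
      for u v u' v' :: point
      using closed_segment_inj[of u v u' v'] by (auto simp: doubleton_eq_iff closed_segment_commute)
    have st: "(t1 = 1 \<or> t1 = -1) \<and> (t2 = 1 \<or> t2 = -1)" if "turn c r = (t1, t2)" "r \<in> signs" for r t1 t2
      using that by (auto simp: signs_def turn_def split: if_splits)
    obtain a b where ab: "turn c s = (a, b)" by fastforce
    obtain a' b' where ab': "turn c s' = (a', b')" by fastforce
    have adj: "tri_adj t t' \<longleftrightarrow> (if p \<noteq> p' then a' = a \<and> b' = b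
        else (a' = a \<and> b' = - b) \<or> (a' = - a \<and> b' = b \<and> \<not> (p \<and> replaced c)))"
    proof -
      have neg: "real_of_int x = - real_of_int y \<longleftrightarrow> x = - y" for x y
        by (metis of_int_eq_iff of_int_minus)
      have kind: "second_kind c \<Longrightarrow> replaced c" by (simp add: second_kind_def)
      have "fst s \<noteq> 0" using T(2) by (auto simp: signs_def)
      then have "c' \<noteq> (fst c + fst s, snd c + snd s)" by (simp add: prod_eq_iff flip: True)
      then have "tri_adj t t' \<longleftrightarrow> (if p \<noteq> p' then s' = s
        else (s' = (fst s, - snd s) \<and> \<not> (p \<and> second_kind c)) \<or>
             (s' = (- fst s, snd s) \<and> \<not> (p \<and> replaced c \<and> \<not> second_kind c)))"
        unfolding tri_adj_def tt prod.case using True by blast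
      also have "\<dots> \<longleftrightarrow> (if p \<noteq> p' then a' = a \<and> b' = b
        else (a' = a \<and> b' = - b) \<or> (a' = - a \<and> b' = b \<and> \<not> (p \<and> replaced c)))"
      proof (cases "second_kind c")
        case True
        then have "a = of_int (snd s)" "b = of_int (fst s)" "a' = of_int (snd s')" "b' = of_int (fst s')"
          using ab ab' by (simp_all add: turn_def)
        then show ?thesis using True kind[OF True] by (auto simp: prod_eq_iff neg)
      next
        case False
        then have "a = of_int (fst s)" "b = of_int (snd s)" "a' = of_int (fst s')" "b' = of_int (snd s')"
          using ab ab' by (simp_all add: turn_def)
        then show ?thesis using False by (auto simp: prod_eq_iff neg)
      qed
      finally show ?thesis .
    qed
    have ne': "p = p' \<Longrightarrow> \<not> (a' = a \<and> b' = b)"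
      using ne ab ab' by (auto simp: tt True turn_def prod_eq_iff split: if_splits)
    have eq: "loc c' s x y = loc c' s x' y' \<longleftrightarrow> a * x = a * x' \<and> b * y = b * y'"
      "loc c' s' x y = loc c' s' x' y' \<longleftrightarrow> a' * x = a' * x' \<and> b' * y = b' * y'"
      "loc c' s x y = loc c' s' x' y' \<longleftrightarrow> a * x = a' * x' \<and> b * y = b' * y'" for x y x' y'
      using ab ab' by (simp_all add: loc_eq_iff True)
    have "(\<exists>(u, v)\<in>edge_ends t. \<exists>(u', v')\<in>edge_ends t'. (u = u' \<and> v = v') \<or> (u = v' \<and> v = u')) \<longleftrightarrow>
      (if p \<noteq> p' then a' = a \<and> b' = b
        else (a' = a \<and> b' = - b) \<or> (a' = - a \<and> b' = b \<and> \<not> (p \<and> replaced c)))"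
    proof -
      have signs: "a = 1 \<or> a = -1" "b = 1 \<or> b = -1" "a' = 1 \<or> a' = -1" "b' = 1 \<or> b' = -1"
        using st[OF ab T(2)] st[OF ab' T(5)] by blast+
      note shares = port_port_share[OF eq signs] half_port_share[OF eq signs]
        inner_inner_share[OF eq signs] port_inner_share[OF eq signs] inner_port_share[OF eq signs]
      consider "p" "p'" "\<not> replaced c'" | "p" "p'" "replaced c'" | "\<not> p" "\<not> p'"
        | "p" "\<not> p'" "replaced c'" | "\<not> p" "p'" "replaced c'"
        using T(3,6) True by blast
      then show ?thesis
        by cases (use ne' shares in
            \<open>simp_all only: tt True edge_ends_def corners_def apex_def prod.case simp_thms if_True if_False\<close>)
    qed
    then show ?thesis unfolding share seg adj .
  next
    case False
    have "tri_adj t t'" if H: "\<exists>g. g edge_of region t \<and> g edge_of region t'"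
    proof -
      obtain u v u' v' where e: "(u, v) \<in> edge_ends t" "(u', v') \<in> edge_ends t'"
        and seg: "closed_segment u v = closed_segment u' v'"
        using H unfolding share by blast
      have m: "midpoint u v = midpoint u' v'"
        using closed_segment_inj[OF seg] by (auto simp: doubleton_eq_iff midpoint_sym)
      have le: "l1 c (midpoint u v) \<le> 1" "l1 c' (midpoint u v) \<le> 1"
        using l1_edge_le t e unfolding tt m[symmetric] by (blast, metis m)
      have "\<not> l1 c (midpoint u v) + l1 c' (midpoint u v) < 2"
        using cities_apart[OF T(1,4)] False by blast
      then have one: "l1 c (midpoint u v) = 1" "l1 c' (midpoint u' v') = 1" using le m by auto
      have uv: "p" "u = loc c s 1 0" "v = loc c s 0 1" "p'" "u' = loc c' s' 1 0" "v' = loc c' s' 0 1"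
        using l1_edge_midpoint[OF t(1)[unfolded tt] e(1)[unfolded tt] one(1)]
          l1_edge_midpoint[OF t(2)[unfolded tt] e(2)[unfolded tt] one(2)] by blast+
      \<comment> \<open>Twice the midpoint of the side fixes the city up to a step in either
        coordinate; the parity of cities excludes a step in a single one.\<close>
      have "2 * fst c + fst s = 2 * fst c' + fst s'" "2 * snd c + snd s = 2 * snd c' + snd s'"
      proof -
        have "2 * real_of_int (fst c) + of_int (fst s) = 2 * of_int (fst c') + of_int (fst s')"
          "2 * real_of_int (snd c) + of_int (snd s) = 2 * of_int (snd c') + of_int (snd s')"
          using m unfolding uv hypotenuse_midpoint[OF T(2)] hypotenuse_midpoint[OF T(5)] by auto
        then show "2 * fst c + fst s = 2 * fst c' + fst s'" "2 * snd c + snd s = 2 * snd c' + snd s'"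
          by linarith+
      qed
      moreover have pm: "(fst r = 1 \<or> fst r = -1) \<and> (snd r = 1 \<or> snd r = -1)" if "r \<in> signs" for r
        using that by (auto simp: signs_def)
      ultimately have "(fst c' = fst c \<and> fst s' = fst s) \<or> (fst c' = fst c + fst s \<and> fst s' = - fst s)"
        "(snd c' = snd c \<and> snd s' = snd s) \<or> (snd c' = snd c + snd s \<and> snd s' = - snd s)"
        using pm[OF T(2)] pm[OF T(5)] by linarith+
      moreover have "odd (fst s)" "odd (snd s)" using T(2) by (auto simp: signs_def)
      moreover have "odd (fst c + snd c)" "odd (fst c' + snd c')" using T(1,4) by (simp_all add: city_def)
      moreover have "\<not> (fst c' = fst c \<and> snd c' = snd c)" using False by (metis prod_eqI)
      ultimately have "fst c' = fst c + fst s \<and> fst s' = - fst s \<and> snd c' = snd c + snd s \<and> snd s' = - snd s"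
        by (elim disjE conjE) simp_all
      then have "c' = (fst c + fst s, snd c + snd s) \<and> s' = (- fst s, - snd s)"
        by (simp add: prod_eq_iff)
      then show ?thesis using uv by (simp add: tt tri_adj_def)
    qed
    moreover have "\<exists>g. g edge_of region t \<and> g edge_of region t'" if "tri_adj t t'"
    proof -
      have b: "p" "p'" and c': "c' = (fst c + fst s, snd c + snd s)" "s' = (- fst s, - snd s)"
        using that False by (auto simp: tt tri_adj_def)
      have "closed_segment (loc c s 1 0) (loc c s 0 1) = closed_segment (loc c' s' 1 0) (loc c' s' 0 1)"
      proof -
        have "{loc c s 1 0, loc c s 0 1} = {loc c' s' 1 0, loc c' s' 0 1}"
          using T(2) unfolding c' signs_def loc_def by auto
        then show ?thesis by (auto simp: doubleton_eq_iff closed_segment_commute)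
      qed
      moreover have "(loc c s 1 0, loc c s 0 1) \<in> edge_ends t" "(loc c' s' 1 0, loc c' s' 0 1) \<in> edge_ends t'"
        using b by (auto simp: tt edge_ends_def corners_def)
      ultimately show ?thesis unfolding share by blast
    qed
    ultimately show ?thesis by blast
  qed
qed

section \<open>Tilings as matchings of triangles\<close>

definition tri_edges :: "tri set set" where
  "tri_edges = {{t, t'} | t t'. t \<in> triangles \<and> t' \<in> triangles \<and> t \<noteq> t' \<and> tri_adj t t'}"

lemma interior_meets_region:
  assumes t: "t \<in> triangles" "t' \<in> triangles" and z: "z \<in> interior (region t)" "z \<in> region t'"
  shows "t = t'"
proof -
  have "z \<in> closure (interior (region t'))" using z(2) closure_interior_region[OF t(2)] by simp
  then have "interior (region t) \<inter> interior (region t') \<noteq> {}"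
    using z(1) open_Int_closure_eq_empty[OF open_interior, of "region t" "interior (region t')"] by blast
  then show ?thesis using interior_regions_disjoint[OF t] by blast
qed

text \<open>An interior point of a triangle lies in no other triangle, so a union of triangles
  remembers which ones it contains.\<close>

lemma Union_regions_subset:
  assumes "A \<subseteq> triangles" "B \<subseteq> triangles" "\<Union> (region ` A) \<subseteq> \<Union> (region ` B)"
  shows "A \<subseteq> B"
proof
  fix t assume t: "t \<in> A"
  then obtain z where z: "z \<in> interior (region t)" using interior_region_nonempty assms(1) by blast
  then have "z \<in> \<Union> (region ` A)" using interior_subset t by blast
  then obtain t' where "t' \<in> B" "z \<in> region t'" using assms(3) by blast
  then show "t \<in> B" using interior_meets_region[of t t' z] z t assms(1,2) by blast
qed

lemma Union_regions_inj:
  assumes "A \<subseteq> triangles" "B \<subseteq> triangles" "\<Union> (region ` A) = \<Union> (region ` B)"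
  shows "A = B"
  using Union_regions_subset[of A B] Union_regions_subset[of B A] assms by auto

lemma tri_edges_subset: "e \<in> tri_edges \<Longrightarrow> e \<subseteq> triangles"
  by (auto simp: tri_edges_def)

lemma region_inj: "t \<in> triangles \<Longrightarrow> t' \<in> triangles \<Longrightarrow> region t = region t' \<longleftrightarrow> t = t'"
  using Union_regions_inj[of "{t}" "{t'}"] by auto

lemma tiles_eq: "tiles replaced_lattice = (\<lambda>e. \<Union> (region ` e)) ` tri_edges"
proof (intro equalityI subsetI)
  fix x assume "x \<in> tiles replaced_lattice"
  then obtain t t' where t: "t \<in> triangles" "t' \<in> triangles" "region t \<noteq> region t'"
    "x = region t \<union> region t'" "\<exists>g. g edge_of region t \<and> g edge_of region t'"
    unfolding tiles_def elementary_regions_eq by blast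
  have ne: "t \<noteq> t'" using t(3) by blast
  then have "tri_adj t t'" using shared_edge_iff[OF t(1,2)] t(5) by blast
  then have "{t, t'} \<in> tri_edges" unfolding tri_edges_def using t(1,2) ne by blast
  moreover have "x = \<Union> (region ` {t, t'})" using t(4) by simp
  ultimately show "x \<in> (\<lambda>e. \<Union> (region ` e)) ` tri_edges" by blast
next
  fix x assume "x \<in> (\<lambda>e. \<Union> (region ` e)) ` tri_edges"
  then obtain t t' where t: "t \<in> triangles" "t' \<in> triangles" "t \<noteq> t'" "tri_adj t t'"
    "x = \<Union> (region ` {t, t'})"
    unfolding tri_edges_def by blast
  then have "region t \<noteq> region t'" "\<exists>g. g edge_of region t \<and> g edge_of region t'"
    using shared_edge_iff[of t t'] region_inj[of t t'] by auto
  moreover have "x = region t \<union> region t'" using t by auto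
  ultimately show "x \<in> tiles replaced_lattice"
    unfolding tiles_def elementary_regions_eq using t(1,2) by blast
qed

text \<open>The interior of a union may exceed the union of the interiors by points of common edges.
  A common interior point is therefore moved slightly into the interior of a triangle, where
  membership determines the triangle.\<close>

lemma interiors_disjoint_iff:
  assumes e: "e \<subseteq> triangles" "e' \<subseteq> triangles"
  shows "interior (\<Union> (region ` e)) \<inter> interior (\<Union> (region ` e')) = {} \<longleftrightarrow> e \<inter> e' = {}"
proof
  assume dis: "interior (\<Union> (region ` e)) \<inter> interior (\<Union> (region ` e')) = {}"
  have False if t: "t \<in> e" "t \<in> e'" for t
  proof -
    have "interior (region t) \<subseteq> interior (\<Union> (region ` e)) \<inter> interior (\<Union> (region ` e'))"
      using t by (intro Int_greatest interior_mono) auto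
    then show False using dis interior_region_nonempty[of t] t e by blast
  qed
  then show "e \<inter> e' = {}" by blast
next
  assume dis: "e \<inter> e' = {}"
  let ?W = "interior (\<Union> (region ` e)) \<inter> interior (\<Union> (region ` e'))"
  show "?W = {}"
  proof (rule ccontr)
    assume "?W \<noteq> {}"
    then obtain z where z: "z \<in> ?W" by blast
    then obtain t where t: "t \<in> e" "z \<in> region t" using interior_subset by blast
    then have tt: "t \<in> triangles" using e by blast
    have "z \<in> closure (interior (region t))" using t closure_interior_region[OF tt] by simp
    moreover have "open ?W" by blast
    ultimately have "?W \<inter> interior (region t) \<noteq> {}"
      using z open_Int_closure_eq_empty[of ?W "interior (region t)"] by blast
    then obtain z' where z': "z' \<in> ?W" "z' \<in> interior (region t)" by blast
    then obtain t' where t': "t' \<in> e'" "z' \<in> region t'" using interior_subset by blast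
    then have "t = t'" using interior_meets_region[OF tt _ z'(2) t'(2)] e by blast
    then show False using t t' dis by blast
  qed
qed

text \<open>A tile determines its two triangles, and a set of tiles the corresponding set of pairs;
  covering and absence of overlaps become covering and disjointness of sets of triangles.\<close>

lemma num_tilings_eq:
  assumes V: "V \<subseteq> triangles"
  shows "num_tilings replaced_lattice (\<Union> (region ` V)) = card (matchings id tri_edges V)"
proof -
  let ?U = "\<lambda>e. \<Union> (region ` e)"
  have inj: "inj_on ?U tri_edges"
  proof (rule inj_onI)
    fix e e' assume "e \<in> tri_edges" "e' \<in> tri_edges" "?U e = ?U e'"
    then show "e = e'" by (intro Union_regions_inj tri_edges_subset)
  qed
  have cover: "\<Union> (?U ` M) = ?U V \<longleftrightarrow> \<Union> M = V" if "M \<subseteq> tri_edges" for M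
  proof -
    have "\<Union> M \<subseteq> triangles" using that tri_edges_subset by blast
    moreover have "\<Union> (?U ` M) = ?U (\<Union> M)" by blast
    ultimately show ?thesis using Union_regions_inj[OF _ V, of "\<Union> M"] by auto
  qed
  have dis: "pairwise (\<lambda>s t. interior s \<inter> interior t = {}) (?U ` M) \<longleftrightarrow> disjoint_family_on id M"
    if M: "M \<subseteq> tri_edges" for M
  proof -
    have "?U e = ?U e' \<longleftrightarrow> e = e'" if "e \<in> M" "e' \<in> M" for e e'
      by (rule inj_on_eq_iff[OF inj]) (use that M in blast)+
    moreover have "interior (?U e) \<inter> interior (?U e') = {} \<longleftrightarrow> e \<inter> e' = {}" if "e \<in> M" "e' \<in> M" for e e'
      by (rule interiors_disjoint_iff) (use that M tri_edges_subset in blast)+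
    ultimately show ?thesis unfolding pairwise_def disjoint_family_on_def by simp
  qed
  have "tilings replaced_lattice (?U V) = (\<lambda>M. ?U ` M) ` matchings id tri_edges V"
  proof (intro equalityI subsetI)
    fix T assume T: "T \<in> tilings replaced_lattice (?U V)"
    then have "T \<subseteq> ?U ` tri_edges" by (auto simp: tilings_def tiles_eq)
    then obtain M where M: "M \<subseteq> tri_edges" "T = ?U ` M" by (auto simp: subset_image_iff)
    then have "M \<in> matchings id tri_edges V"
      using T cover[OF M(1)] dis[OF M(1)] by (simp add: tilings_def matchings_def)
    then show "T \<in> (\<lambda>M. ?U ` M) ` matchings id tri_edges V" using M(2) by blast
  next
    fix T assume "T \<in> (\<lambda>M. ?U ` M) ` matchings id tri_edges V"
    then obtain M where M: "M \<in> matchings id tri_edges V" "T = ?U ` M" by blast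
    then have "M \<subseteq> tri_edges" by (simp add: matchings_def)
    then show "T \<in> tilings replaced_lattice (?U V)"
      using M cover[of M] dis[of M] by (auto simp: tilings_def matchings_def tiles_eq)
  qed
  moreover have "inj_on (\<lambda>M. ?U ` M) (matchings id tri_edges V)"
    using inj_on_image_eq_iff[OF inj] by (intro inj_onI) (auto simp: matchings_def)
  ultimately show ?thesis unfolding num_tilings_def by (simp add: card_image)
qed

section \<open>The two regions as sets of triangles\<close>

definition across :: "int \<times> int \<Rightarrow> int \<times> int \<Rightarrow> int \<times> int" where
  "across c s = (fst c + fst s, snd c + snd s)"

text \<open>With the centre at \<open>n\<close> the colour class consists of points with odd
  coordinate sum, so these are the cities inside the diamond.\<close>

definition cells :: "nat \<Rightarrow> (int \<times> int) set" where
  "cells n = aztec_faces (int n) n"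

text \<open>
  \<open>z\<close> false gives \<open>S2\<close>, \<open>z\<close> true gives \<open>S3\<close>.
\<close>

definition cluster :: "bool \<Rightarrow> nat \<Rightarrow> tri set" where
  "cluster z n = {(c, s, b) \<in> triangles. c \<in> cells n \<or> (replaced c \<noteq> z \<and> b \<and> across c s \<in> cells n)}"

lemma cells_iff: "city c \<Longrightarrow> c \<in> cells n \<longleftrightarrow> \<bar>fst c - int n\<bar> + \<bar>snd c\<bar> < int n"
  by (cases c) (auto simp: cells_def aztec_faces_def city_def)

text \<open>Parity leaves a gap: no city has its centre at distance exactly \<open>n\<close> from
  the centre of the diamond.\<close>

lemma not_cells: "city c \<Longrightarrow> c \<notin> cells n \<Longrightarrow> \<bar>fst c - int n\<bar> + \<bar>snd c\<bar> \<ge> int n + 1"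
proof -
  assume c: "city c" "c \<notin> cells n"
  have "even (\<bar>fst c - int n\<bar> + \<bar>snd c\<bar>) \<longleftrightarrow> odd (int n)"
    using c(1) by (auto simp: city_def)
  then have "\<bar>fst c - int n\<bar> + \<bar>snd c\<bar> \<noteq> int n" by metis
  then show ?thesis using c cells_iff[of c n] by simp
qed

definition dnorm :: "nat \<Rightarrow> point \<Rightarrow> real" where
  "dnorm n z = \<bar>fst z - real n\<bar> + \<bar>snd z\<bar>"

lemma diamond_eq: "diamond n = {z. dnorm n z \<le> real n}"
  by (auto simp: diamond_def dnorm_def)

lemma dnorm_bounds:
  "dnorm n z \<le> real_of_int (\<bar>fst c - int n\<bar> + \<bar>snd c\<bar>) + l1 c z"
  "real_of_int (\<bar>fst c - int n\<bar> + \<bar>snd c\<bar>) \<le> dnorm n z + l1 c z"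
  by (simp_all add: dnorm_def l1_def)

lemma l1_region_le:
  assumes "(c, s, b) \<in> triangles" "z \<in> region (c, s, b)"
  shows "l1 c z \<le> 1"
proof -
  have s: "s \<in> signs" "b \<or> replaced c" using assms(1) by (auto simp: triangles_def)
  obtain \<alpha> \<beta> where z: "z = loc c s \<alpha> \<beta>" by (rule loc_surj[OF s(1)])
  show ?thesis
    using assms(2) s(2) loc_mem_port(1)[OF s(1), of c \<alpha> \<beta>] loc_mem_inner(1)[OF s(1), of c \<alpha> \<beta>]
    unfolding z l1_loc[OF s(1)] by (cases b) (auto split: if_splits)
qed

lemma interior_region_outside:
  assumes t: "(c, s, b) \<in> triangles" and c: "c \<notin> cells n" and z: "z \<in> interior (region (c, s, b))"
  shows "z \<notin> diamond n"
proof -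
  have T: "city c" "s \<in> signs" using t by (auto simp: triangles_def)
  obtain \<alpha> \<beta> where "z = loc c s \<alpha> \<beta>" "0 < \<alpha>" "0 < \<beta>" "\<alpha> + \<beta> < 1"
    by (rule interior_regionE[OF t z])
  then have "l1 c z < 1" by (simp add: l1_loc[OF T(2)])
  moreover have "real_of_int (\<bar>fst c - int n\<bar> + \<bar>snd c\<bar>) \<ge> real_of_int (int n + 1)"
    using not_cells[OF T(1) c] by (simp only: of_int_le_iff)
  ultimately show ?thesis using dnorm_bounds(2)[of c n z] by (simp add: diamond_eq)
qed

lemma region_subset_diamond:
  assumes t: "(c, s, b) \<in> triangles"
  shows "region (c, s, b) \<subseteq> diamond n \<longleftrightarrow> c \<in> cells n"
proof
  assume sub: "region (c, s, b) \<subseteq> diamond n"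
  show "c \<in> cells n"
  proof (rule ccontr)
    assume "c \<notin> cells n"
    then show False
      using interior_region_outside[OF t] interior_region_nonempty[OF t] sub interior_subset by blast
  qed
next
  assume c: "c \<in> cells n"
  have "city c" using t by (simp add: triangles_def)
  then have "real_of_int (\<bar>fst c - int n\<bar> + \<bar>snd c\<bar>) \<le> real_of_int (int n - 1)"
    using c cells_iff[of c n] by (simp only: of_int_le_iff)
  then have "dnorm n z \<le> real n" if "z \<in> region (c, s, b)" for z
    using l1_region_le[OF t that] dnorm_bounds(1)[of n z c] by simp
  then show "region (c, s, b) \<subseteq> diamond n" unfolding diamond_eq by blast
qed

lemma frontier_diamond: "frontier (diamond n) \<subseteq> {z. dnorm n z = real n}"
proof
  fix z assume z: "z \<in> frontier (diamond n)"
  have cont: "continuous_on UNIV (dnorm n)" unfolding dnorm_def by (intro continuous_intros)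
  have "closed (diamond n)" unfolding diamond_eq by (intro closed_Collect_le cont continuous_intros)
  then have "z \<in> diamond n" "z \<notin> interior (diamond n)" using z by (auto simp: frontier_def)
  moreover have "{z. dnorm n z < real n} \<subseteq> interior (diamond n)"
    unfolding diamond_eq by (intro interior_maximal open_Collect_less cont continuous_intros) auto
  ultimately show "z \<in> {z. dnorm n z = real n}" by (force simp: diamond_eq)
qed

text \<open>The midpoint of the edge has distance \<open>n\<close> from the centre of the diamond,
  and the centre of the city at least \<open>n + 1\<close>. The edge is therefore an outer side, and
  the city beyond it is inside.\<close>

lemma frontier_edge_outside:
  assumes t: "(c, s, b) \<in> triangles" and c: "c \<notin> cells n" and uv: "(u, v) \<in> edge_ends (c, s, b)"
    and g: "closed_segment u v \<subseteq> frontier (diamond n)"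
  shows "b" "u = loc c s 1 0" "v = loc c s 0 1" "across c s \<in> cells n"
proof -
  have T: "city c" "s \<in> signs" using t by (auto simp: triangles_def)
  let ?m = "midpoint u v"
  have "?m \<in> frontier (diamond n)" using g midpoint_in_closed_segment by blast
  then have D: "dnorm n ?m = real n" using frontier_diamond by blast
  have ge: "real_of_int (\<bar>fst c - int n\<bar> + \<bar>snd c\<bar>) \<ge> real_of_int (int n + 1)"
    using not_cells[OF T(1) c] by (simp only: of_int_le_iff)
  then have "l1 c ?m = 1" using dnorm_bounds(2)[of c n ?m] D l1_edge_le[OF t uv] by simp
  from l1_edge_midpoint[OF t uv this] show b: "b" "u = loc c s 1 0" "v = loc c s 0 1" by blast+
  have m: "?m = (of_int (fst c) + of_int (fst s) / 2, of_int (snd c) + of_int (snd s) / 2)"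
    unfolding b hypotenuse_midpoint[OF T(2)] ..
  have "\<bar>real_of_int (2 * (fst c - int n) + fst s)\<bar> + \<bar>real_of_int (2 * snd c + snd s)\<bar> = 2 * dnorm n ?m"
    unfolding m dnorm_def by (simp add: abs_if)
  then have "real_of_int (\<bar>2 * (fst c - int n) + fst s\<bar> + \<bar>2 * snd c + snd s\<bar>) = real_of_int (2 * int n)"
    using D by simp
  then have "\<bar>2 * (fst c - int n) + fst s\<bar> + \<bar>2 * snd c + snd s\<bar> = 2 * int n"
    by (simp only: of_int_eq_iff)
  moreover have "city (across c s)" using T by (auto simp: city_def across_def signs_def)
  moreover have "fst s = 1 \<or> fst s = -1" "snd s = 1 \<or> snd s = -1" using T(2) by (auto simp: signs_def)
  ultimately show "across c s \<in> cells n"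
    using not_cells[OF T(1) c] by (auto simp: cells_iff across_def)
qed

text \<open>The side belongs to a city inside the diamond, and its points are also limits of
  interior points of an outside triangle.\<close>

lemma hypotenuse_in_frontier:
  assumes t: "(c, s, True) \<in> triangles" and c: "c \<notin> cells n" "across c s \<in> cells n"
  shows "closed_segment (loc c s 1 0) (loc c s 0 1) \<subseteq> frontier (diamond n)"
proof
  fix z assume z: "z \<in> closed_segment (loc c s 1 0) (loc c s 0 1)"
  have T: "city c" "s \<in> signs" using t by (auto simp: triangles_def)
  have "loc c s 1 0 \<in> region (c, s, True)" "loc c s 0 1 \<in> region (c, s, True)"
    by (simp_all add: loc_mem_port[OF T(2)])
  then have zr: "z \<in> region (c, s, True)"
    using z closed_segment_subset[OF _ _ convex_region] by blast
  have "z \<in> diamond n"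
  proof -
    let ?c = "across c s"
    obtain u where u: "0 \<le> u" "u \<le> 1" "z = (1 - u) *\<^sub>R loc c s 1 0 + u *\<^sub>R loc c s 0 1"
      using z by (auto simp: closed_segment_def)
    have "z = loc c s (1 - u) u" unfolding u(3) by (simp add: loc_def algebra_simps)
    then have "l1 ?c z \<le> 1"
      using T(2) u(1,2) by (auto simp: signs_def l1_def across_def loc_def)
    moreover have "city ?c" using T by (auto simp: city_def across_def signs_def)
    then have "real_of_int (\<bar>fst ?c - int n\<bar> + \<bar>snd ?c\<bar>) \<le> real_of_int (int n - 1)"
      using c(2) cells_iff[of ?c n] by (simp only: of_int_le_iff)
    ultimately show ?thesis using dnorm_bounds(1)[of n z ?c] by (simp add: diamond_eq)
  qed
  moreover have "z \<in> closure (- diamond n)"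
  proof -
    have "interior (region (c, s, True)) \<subseteq> - diamond n" using interior_region_outside[OF t c(1)] by blast
    then have "closure (interior (region (c, s, True))) \<subseteq> closure (- diamond n)" by (rule closure_mono)
    then show ?thesis using zr closure_interior_region[OF t] by blast
  qed
  ultimately show "z \<in> frontier (diamond n)"
    using closure_subset unfolding frontier_closures by blast
qed

text \<open>The corners are the extreme points of the hull. The shape predicates quantify over
  possible corners, so refuting them needs this uniqueness.\<close>

lemma corners_unique:
  fixes a b c u v w :: "'a :: euclidean_space"
  assumes "\<not> collinear {a, b, c}" "\<not> collinear {u, v, w}" "convex hull {a, b, c} = convex hull {u, v, w}"
  shows "{a, b, c} = {u, v, w}"
proof -
  have "\<not> affine_dependent {a, b, c}" "\<not> affine_dependent {u, v, w}"
    using assms(1,2) by (auto simp: collinear_3_eq_affine_dependent)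
  then have "x \<in> {a, b, c} \<longleftrightarrow> x \<in> {u, v, w}" for x
    using extreme_point_of_convex_hull_affine_independent[of "{a, b, c}" x]
      extreme_point_of_convex_hull_affine_independent[of "{u, v, w}" x] assms(3) by simp
  then show ?thesis by blast
qed

lemma inner_loc:
  assumes "s \<in> signs"
  shows "(loc c s a1 a2 - loc c s b1 b2) \<bullet> (loc c s c1 c2 - loc c s b1 b2) =
    (a1 - b1) * (c1 - b1) + (a2 - b2) * (c2 - b2)"
  using assms by (auto simp: signs_def loc_def algebra_simps)

lemma port_corners:
  assumes "s \<in> signs" "\<not> collinear {x, y, z}" "region (c, s, True) = convex hull {x, y, z}"
  shows "{x, y, z} = {loc c s 1 0, loc c s (apex c) 0, loc c s 0 1}"
    and "x \<noteq> y" "x \<noteq> z" "y \<noteq> z"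
proof -
  show "{x, y, z} = {loc c s 1 0, loc c s (apex c) 0, loc c s 0 1}"
    using assms(2,3) not_collinear_det[OF det_region(1)[OF assms(1)]]
    by (intro corners_unique) (auto simp: region_def)
  show "x \<noteq> y" "x \<noteq> z" "y \<noteq> z" using assms(2) by (auto simp: collinear_3_eq_affine_dependent)
qed

text \<open>In a replaced city the inner product at the added vertex is -1/4; in a plain city the
  triangle is right-angled at the centre and acute elsewhere.\<close>

lemma obtuse_port_iff:
  assumes s: "s \<in> signs"
  shows "obtuse_triangle (region (c, s, True)) \<longleftrightarrow> replaced c"
proof
  assume "obtuse_triangle (region (c, s, True))"
  then obtain x y z where xyz: "\<not> collinear {x, y, z}" "region (c, s, True) = convex hull {x, y, z}"
    and neg: "(x - y) \<bullet> (z - y) < 0"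
    unfolding obtuse_triangle_def by blast
  note P = port_corners[OF s xyz]
  show "replaced c"
  proof (rule ccontr)
    assume "\<not> replaced c"
    then have E: "{x, y, z} = {loc c s 1 0, loc c s 0 0, loc c s 0 1}" using P(1) by (simp add: apex_def)
    have "x \<in> {loc c s 1 0, loc c s 0 0, loc c s 0 1}" "y \<in> {loc c s 1 0, loc c s 0 0, loc c s 0 1}"
      "z \<in> {loc c s 1 0, loc c s 0 0, loc c s 0 1}"
      unfolding E[symmetric] by auto
    then show False using neg by (elim insertE emptyE) (simp_all add: inner_loc[OF s])
  qed
next
  assume r: "replaced c"
  have "(loc c s 1 0 - loc c s (apex c) 0) \<bullet> (loc c s 0 1 - loc c s (apex c) 0) < 0"
    unfolding inner_loc[OF s] using r by (simp add: apex_def)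
  moreover have "region (c, s, True) = convex hull {loc c s 1 0, loc c s (apex c) 0, loc c s 0 1}"
    by (simp add: region_def)
  ultimately show "obtuse_triangle (region (c, s, True))"
    unfolding obtuse_triangle_def
    by (intro exI[of _ "loc c s 1 0"] exI[of _ "loc c s (apex c) 0"] exI[of _ "loc c s 0 1"] conjI
        not_collinear_det[OF det_region(1)[OF s, of c]])
qed

text \<open>With the apex at the added vertex no angle is right.\<close>

lemma right_isosceles_port:
  assumes s: "s \<in> signs"
  shows "right_isosceles_triangle (region (c, s, True)) h \<Longrightarrow> \<not> replaced c"
    and "\<not> replaced c \<Longrightarrow> right_isosceles_triangle (region (c, s, True)) (closed_segment (loc c s 1 0) (loc c s 0 1))"
proof -
  assume "right_isosceles_triangle (region (c, s, True)) h"
  then obtain x y z where xyz: "\<not> collinear {x, y, z}" "region (c, s, True) = convex hull {x, y, z}"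
    and orth: "(x - y) \<bullet> (z - y) = 0"
    unfolding right_isosceles_triangle_def by blast
  note P = port_corners[OF s xyz]
  show "\<not> replaced c"
  proof
    assume "replaced c"
    then have E: "{x, y, z} = {loc c s 1 0, loc c s (1/2) 0, loc c s 0 1}" using P(1) by (simp add: apex_def)
    have "x \<in> {loc c s 1 0, loc c s (1/2) 0, loc c s 0 1}" "y \<in> {loc c s 1 0, loc c s (1/2) 0, loc c s 0 1}"
      "z \<in> {loc c s 1 0, loc c s (1/2) 0, loc c s 0 1}"
      unfolding E[symmetric] by auto
    then show False using orth P(2-4) by (elim insertE emptyE) (simp_all add: inner_loc[OF s])
  qed
next
  assume r: "\<not> replaced c"
  have nc: "\<not> collinear {loc c s 1 0, loc c s 0 0, loc c s 0 1}"
    using not_collinear_det[OF det_region(1)[OF s, of c]] r by (simp add: apex_def)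
  have orth: "(loc c s 1 0 - loc c s 0 0) \<bullet> (loc c s 0 1 - loc c s 0 0) = 0"
    by (simp add: inner_loc[OF s])
  have dist: "dist (loc c s 1 0) (loc c s 0 0) = dist (loc c s 0 1) (loc c s 0 0)"
    using inner_loc[OF s, of c 1 0 0 0 1 0] inner_loc[OF s, of c 0 1 0 0 0 1]
    by (simp add: dist_norm norm_eq_sqrt_inner)
  have reg: "region (c, s, True) = convex hull {loc c s 1 0, loc c s 0 0, loc c s 0 1}"
    using r by (simp add: region_def apex_def)
  show "right_isosceles_triangle (region (c, s, True)) (closed_segment (loc c s 1 0) (loc c s 0 1))"
    unfolding right_isosceles_triangle_def reg
    by (intro exI[of _ "loc c s 1 0"] exI[of _ "loc c s 0 0"] exI[of _ "loc c s 0 1"] conjI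
        nc orth dist refl)
qed

lemma right_isosceles_edge:
  assumes "right_isosceles_triangle e h"
  shows "h edge_of e"
proof -
  obtain a b c where abc: "\<not> collinear {a, b, c}" "e = convex hull {a, b, c}" "h = closed_segment a c"
    using assms unfolding right_isosceles_triangle_def by blast
  then have ne: "a \<noteq> c" and ind: "\<not> affine_dependent {a, b, c}"
    by (auto simp: collinear_3_eq_affine_dependent)
  have "convex hull {a, c} face_of e"
    unfolding abc(2) face_of_convex_hull_affine_independent[OF ind]
    by (intro exI[of _ "{a, c}"]) simp
  moreover have "aff_dim (convex hull {a, c}) = 1" using ne by (simp add: aff_dim_convex_hull)
  ultimately show ?thesis unfolding edge_of_def abc(3) segment_convex_hull by blast
qed

text \<open>Both regions consist of the triangles inside the diamond and a set \<open>E\<close> that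
  may overlap with these; hence only an upper bound for \<open>E\<close> and the presence of the
  outer triangles are required.\<close>

lemma Union_cluster:
  assumes sub: "E \<subseteq> region ` cluster z n"
    and E: "\<And>c s. (c, s, True) \<in> triangles \<Longrightarrow> c \<notin> cells n \<Longrightarrow> replaced c \<noteq> z \<Longrightarrow>
      across c s \<in> cells n \<Longrightarrow> region (c, s, True) \<in> E"
  shows "\<Union> ({e \<in> elementary_regions replaced_lattice. e \<subseteq> diamond n} \<union> E) = \<Union> (region ` cluster z n)"
proof -
  let ?I = "{t \<in> triangles. fst t \<in> cells n}"
  have "region t \<subseteq> diamond n \<longleftrightarrow> fst t \<in> cells n" if "t \<in> triangles" for t
    using region_subset_diamond[of "fst t" "fst (snd t)" "snd (snd t)" n] that by simp
  then have I: "{e \<in> elementary_regions replaced_lattice. e \<subseteq> diamond n} = region ` ?I"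
    unfolding elementary_regions_eq by blast
  show ?thesis
    unfolding I
  proof (intro equalityI Union_mono)
    have "?I \<subseteq> cluster z n" by (auto simp: cluster_def)
    then show "region ` ?I \<union> E \<subseteq> region ` cluster z n" using sub by (intro Un_least image_mono)
    have "region t \<in> region ` ?I \<union> E" if t: "t \<in> cluster z n" for t
    proof (cases "fst t \<in> cells n")
      case True
      then show ?thesis using t by (intro UnI1 imageI) (auto simp: cluster_def)
    next
      case False
      obtain c s b where tt: "t = (c, s, b)" by (metis prod_cases3)
      show ?thesis using t False unfolding tt by (intro UnI2) (auto simp: cluster_def intro: E)
    qed
    then show "region ` cluster z n \<subseteq> region ` ?I \<union> E" by (rule image_subsetI)
  qed
qed

lemma frontier_edge_cluster:
  assumes t: "(c, s, b) \<in> triangles" and g: "g edge_of region (c, s, b)" "g \<subseteq> frontier (diamond n)"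
    and kind: "b \<Longrightarrow> replaced c \<noteq> z"
  shows "(c, s, b) \<in> cluster z n"
proof (cases "c \<in> cells n")
  case True
  then show ?thesis using t by (simp add: cluster_def)
next
  case False
  obtain u v where "(u, v) \<in> edge_ends (c, s, b)" "g = closed_segment u v"
    using g(1) unfolding edge_of_region[OF t] by blast
  then have uv: "(u, v) \<in> edge_ends (c, s, b)" "closed_segment u v \<subseteq> frontier (diamond n)"
    using g(2) by simp_all
  show ?thesis using t frontier_edge_outside[OF t False uv] kind by (simp add: cluster_def)
qed

lemma S2_eq: "S2 n = \<Union> (region ` cluster False n)"
  unfolding S2_def
proof (intro Union_cluster subsetI)
  fix e assume E: "e \<in> {e \<in> elementary_regions replaced_lattice. obtuse_triangle e \<and>
    (\<exists>g. g edge_of e \<and> g \<subseteq> frontier (diamond n))}"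
  then obtain t where "t \<in> triangles" "e = region t" unfolding elementary_regions_eq by blast
  then obtain c s b where t: "(c, s, b) \<in> triangles" "e = region (c, s, b)" by (metis prod_cases3)
  obtain g where g: "g edge_of region (c, s, b)" "g \<subseteq> frontier (diamond n)" using E t(2) by blast
  have "s \<in> signs" using t by (simp add: triangles_def)
  then have "b \<Longrightarrow> replaced c \<noteq> False" using obtuse_port_iff[of s c] E t(2) by simp
  then show "e \<in> region ` cluster False n" using frontier_edge_cluster[OF t(1) g] t(2) by blast
next
  fix c s assume c: "(c, s, True) \<in> triangles" "c \<notin> cells n" "replaced c \<noteq> False" "across c s \<in> cells n"
  then have s: "s \<in> signs" by (simp add: triangles_def)
  have "(loc c s 1 0, loc c s 0 1) \<in> edge_ends (c, s, True)" by (simp add: edge_ends_def corners_def)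
  then have "closed_segment (loc c s 1 0) (loc c s 0 1) edge_of region (c, s, True)"
    unfolding edge_of_region[OF c(1)] by blast
  then show "region (c, s, True) \<in> {e \<in> elementary_regions replaced_lattice. obtuse_triangle e \<and>
      (\<exists>g. g edge_of e \<and> g \<subseteq> frontier (diamond n))}"
    using hypotenuse_in_frontier[OF c(1,2,4)] obtuse_port_iff[OF s, of c] c
    by (auto simp: elementary_regions_eq)
qed

lemma S3_eq: "S3 n = \<Union> (region ` cluster True n)"
  unfolding S3_def
proof (intro Union_cluster subsetI)
  fix e assume E: "e \<in> {e \<in> elementary_regions replaced_lattice.
    \<exists>h. right_isosceles_triangle e h \<and> h \<subseteq> frontier (diamond n)}"
  then obtain t where "t \<in> triangles" "e = region t" unfolding elementary_regions_eq by blast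
  then obtain c s b where t: "(c, s, b) \<in> triangles" "e = region (c, s, b)" by (metis prod_cases3)
  obtain h where h: "right_isosceles_triangle (region (c, s, b)) h" "h \<subseteq> frontier (diamond n)"
    using E t(2) by blast
  have "s \<in> signs" using t by (simp add: triangles_def)
  then have "b \<Longrightarrow> replaced c \<noteq> True" using right_isosceles_port(1)[of s c h] h(1) by simp
  then show "e \<in> region ` cluster True n"
    using frontier_edge_cluster[OF t(1) right_isosceles_edge[OF h(1)] h(2)] t(2) by blast
next
  fix c s assume c: "(c, s, True) \<in> triangles" "c \<notin> cells n" "replaced c \<noteq> True" "across c s \<in> cells n"
  then have s: "s \<in> signs" "\<not> replaced c" by (simp_all add: triangles_def)
  show "region (c, s, True) \<in> {e \<in> elementary_regions replaced_lattice.
      \<exists>h. right_isosceles_triangle e h \<and> h \<subseteq> frontier (diamond n)}"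
    using hypotenuse_in_frontier[OF c(1,2,4)] right_isosceles_port(2)[OF s] c(1)
    by (auto simp: elementary_regions_eq)
qed

lemma num_tilings_S2: "num_tilings replaced_lattice (S2 n) = card (matchings id tri_edges (cluster False n))"
  unfolding S2_eq by (rule num_tilings_eq) (auto simp: cluster_def)

lemma num_tilings_S3: "num_tilings replaced_lattice (S3 n) = card (matchings id tri_edges (cluster True n))"
  unfolding S3_eq by (rule num_tilings_eq) (auto simp: cluster_def)

section \<open>From triangles to Aztec diamonds\<close>

text \<open>The formula of \<open>mweight_four_cycle\<close> as a function of the covered corners,
  listed anticlockwise from the north-east.\<close>

definition cycle_value :: "real \<Rightarrow> real \<Rightarrow> real \<Rightarrow> real \<Rightarrow> bool \<Rightarrow> bool \<Rightarrow> bool \<Rightarrow> bool \<Rightarrow> real" where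
  "cycle_value n w s e A B C D =
    of_bool (\<not> A \<and> \<not> B \<and> \<not> C \<and> \<not> D) + n * of_bool (A \<and> B \<and> \<not> C \<and> \<not> D) +
    w * of_bool (\<not> A \<and> B \<and> C \<and> \<not> D) + s * of_bool (\<not> A \<and> \<not> B \<and> C \<and> D) +
    e * of_bool (A \<and> \<not> B \<and> \<not> C \<and> D) + (n * s + w * e) * of_bool (A \<and> B \<and> C \<and> D)"

lemma mweight_uncovered:
  assumes "v \<in> V" "v \<notin> (\<Union>e\<in>E. d e)"
  shows "mweight d w E V = 0"
proof -
  have "matchings d E V = {}" using assms by (auto simp: matchings_def)
  then show ?thesis by (simp add: mweight_def)
qed

lemma mweight_pendant:
  assumes E: "finite E" and v: "v \<notin> \<Union> E"
  shows "mweight id w (insert {u, v} E) V =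
    (if v \<in> V then if u \<in> V then w {u, v} * mweight id w E (V - {u, v}) else 0 else mweight id w E V)"
proof -
  have "{u, v} \<notin> E" using v by blast
  then have "mweight id w (insert {u, v} E) V =
      mweight id w E V + (if {u, v} \<subseteq> V then w {u, v} * mweight id w E (V - {u, v}) else 0)"
    using mweight_insert[OF E, of "{u, v}" id w V] by simp
  moreover have "v \<in> V \<Longrightarrow> mweight id w E V = 0"
    by (rule mweight_uncovered[of v]) (use v in auto)
  ultimately show ?thesis by auto
qed

text \<open>A leaf \<open>v i\<close> in \<open>V\<close> forces its edge and removes
  \<open>u i\<close>; a leaf outside \<open>V\<close> makes the edge unusable. No choice is left at
  the pendant edges.\<close>

lemma mweight_pendants:
  assumes "finite I" "finite E" "inj_on u I" "inj_on v I" "u ` I \<inter> v ` I = {}" "v ` I \<inter> \<Union> E = {}" "u ` I \<subseteq> V"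
  shows "mweight id (\<lambda>_. 1) ((\<lambda>i. {u i, v i}) ` I \<union> E) V =
    mweight id (\<lambda>_. 1) E (V - (u ` {i\<in>I. v i \<in> V} \<union> v ` {i\<in>I. v i \<in> V}))"
  using assms(1,3-7)
proof (induction I arbitrary: V rule: finite_induct)
  case empty
  then show ?case by simp
next
  case (insert i I)
  let ?F = "(\<lambda>i. {u i, v i}) ` I \<union> E"
  have new: "u i \<notin> u ` I" "v i \<notin> v ` I" "v i \<notin> u ` I" "u i \<notin> v ` I" "u i \<noteq> v i" "v i \<notin> \<Union> E" "u i \<in> V"
    using insert.prems insert.hyps by (auto simp: inj_on_def)
  have step: "mweight id (\<lambda>_. 1) (insert {u i, v i} ?F) V =
      (if v i \<in> V then if u i \<in> V then 1 * mweight id (\<lambda>_. 1) ?F (V - {u i, v i}) else 0 else mweight id (\<lambda>_. 1) ?F V)"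
    by (rule mweight_pendant) (use new insert.hyps assms(2) in auto)
  have IH: "mweight id (\<lambda>_. 1) ?F W =
      mweight id (\<lambda>_. 1) E (W - (u ` {i\<in>I. v i \<in> W} \<union> v ` {i\<in>I. v i \<in> W}))" if "u ` I \<subseteq> W" for W
    using that insert.prems by (intro insert.IH) auto
  have cov: "mweight id (\<lambda>_. 1) ?F (V - {u i, v i}) =
      mweight id (\<lambda>_. 1) E (V - (u ` {j\<in>insert i I. v j \<in> V} \<union> v ` {j\<in>insert i I. v j \<in> V}))" if "v i \<in> V"
  proof -
    have "v j \<noteq> u i \<and> v j \<noteq> v i" if "j \<in> I" for j using new that by (metis imageI)
    then have J: "{j\<in>I. v j \<in> V - {u i, v i}} = {j\<in>I. v j \<in> V}" by auto
    have J': "{j\<in>insert i I. v j \<in> V} = insert i {j\<in>I. v j \<in> V}" using that by auto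
    have sub: "u ` I \<subseteq> V - {u i, v i}" using insert.prems(5) new(1,3) by blast
    have "V - {u i, v i} - (u ` K \<union> v ` K) = V - (u ` insert i K \<union> v ` insert i K)" for K by auto
    then show ?thesis unfolding IH[OF sub] J J' by simp
  qed
  have unc: "mweight id (\<lambda>_. 1) ?F V =
      mweight id (\<lambda>_. 1) E (V - (u ` {j\<in>insert i I. v j \<in> V} \<union> v ` {j\<in>insert i I. v j \<in> V}))" if "v i \<notin> V"
  proof -
    have J: "{j\<in>insert i I. v j \<in> V} = {j\<in>I. v j \<in> V}" using that by auto
    have sub: "u ` I \<subseteq> V" using insert.prems by auto
    show ?thesis unfolding J by (rule IH[OF sub])
  qed
  have "(\<lambda>i. {u i, v i}) ` insert i I \<union> E = insert {u i, v i} ?F" by simp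
  then show ?case
    using cov unc new(7) by (cases "v i \<in> V") (simp_all only: step if_True if_False mult_1 simp_thms)
qed

definition ring :: "(int \<times> int \<Rightarrow> 'v) \<Rightarrow> 'v set set" where
  "ring f = {{f (1, 1), f (-1, 1)}, {f (-1, 1), f (-1, -1)}, {f (-1, -1), f (1, -1)}, {f (1, -1), f (1, 1)}}"

text \<open>The adjacency graph of a replaced city: \<open>f\<close> names the four inner triangles,
  which form a ring, and \<open>g\<close> the outer ones, joined to their inner partners and, in two
  pairs, across the axis of the added vertices.\<close>

definition ladder :: "bool \<Rightarrow> (int \<times> int \<Rightarrow> 'v) \<Rightarrow> (int \<times> int \<Rightarrow> 'v) \<Rightarrow> 'v set set" where
  "ladder k f g = (if k then {{g (1, 1), g (-1, 1)}, {g (-1, -1), g (1, -1)}}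
      else {{g (1, 1), g (1, -1)}, {g (-1, 1), g (-1, -1)}}) \<union>
    ((\<lambda>s. {f s, g s}) ` signs \<union> ring f)"

definition sign_value :: "real \<Rightarrow> real \<Rightarrow> (int \<times> int \<Rightarrow> bool) \<Rightarrow> real" where
  "sign_value n e P = cycle_value n e n e (P (1, 1)) (P (-1, 1)) (P (-1, -1)) (P (1, -1))"

lemma finite_ring: "finite (ring f)" "finite signs"
  by (simp_all add: ring_def signs_def)

lemma Union_ring: "\<Union> (ring f) = f ` signs"
  by (auto simp: ring_def signs_def)

lemma signs_mem: "(1, 1) \<in> signs" "(-1, 1) \<in> signs" "(-1, -1) \<in> signs" "(1, -1) \<in> signs"
  by (simp_all add: signs_def)

lemma mweight_ring:
  assumes f: "inj_on f signs" and V: "V \<subseteq> f ` signs"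
  shows "mweight id (\<lambda>_. 1) (ring f) V = sign_value 1 1 (\<lambda>s. f s \<in> V)"
proof -
  have ne: "f (1, 1) \<noteq> f (-1, 1)" "f (1, 1) \<noteq> f (-1, -1)" "f (1, 1) \<noteq> f (1, -1)"
    "f (-1, 1) \<noteq> f (-1, -1)" "f (-1, 1) \<noteq> f (1, -1)" "f (-1, -1) \<noteq> f (1, -1)"
    using inj_on_eq_iff[OF f] signs_mem by simp_all
  show ?thesis
    unfolding sign_value_def cycle_value_def ring_def
    by (rule mweight_four_cycle) (use ne V in \<open>auto simp: doubleton_eq_iff signs_def\<close>)
qed

text \<open>Instances of the renewal identity. The factor 5 is 2 * (1/4 + 9/4), the value at the
  full set, by which the complement is normalised.\<close>

lemma sign_value_complement:
  "sign_value 1 1 (\<lambda>s. \<not> P s) = 2 * sign_value (1/2) (1/2) P"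
  "2 * sign_value (1/2) (3/2) (\<lambda>s. \<not> P s) = 5 * sign_value (1/5) (3/5) P"
  "2 * sign_value (3/2) (1/2) (\<lambda>s. \<not> P s) = 5 * sign_value (3/5) (1/5) P"
  unfolding sign_value_def
  by (cases "P (1, 1)"; cases "P (-1, 1)"; cases "P (-1, -1)"; cases "P (1, -1)"; simp add: cycle_value_def)+

lemma sign_value_cong: "(\<And>s. s \<in> signs \<Longrightarrow> P s \<longleftrightarrow> Q s) \<Longrightarrow> sign_value n e P = sign_value n e Q"
  by (simp add: sign_value_def signs_mem)

text \<open>A port \<open>g s\<close> that is present must be matched with \<open>f s\<close>; the
  ring then has to match the inner vertices whose port is absent. Passing to the complement gives a
  four-cycle of weights 1/2, normalised by the two matchings of the full ring.\<close>

lemma mweight_ring_pendants: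
  assumes f: "inj_on f signs" and g: "inj_on g signs" and fg: "f ` signs \<inter> g ` signs = {}"
    and V: "f ` signs \<subseteq> V" "V \<subseteq> f ` signs \<union> g ` signs"
  shows "mweight id (\<lambda>_. 1) ((\<lambda>s. {f s, g s}) ` signs \<union> ring f) V = 2 * sign_value (1/2) (1/2) (\<lambda>s. g s \<in> V)"
proof -
  let ?J = "{s\<in>signs. g s \<in> V}"
  let ?W = "V - (f ` ?J \<union> g ` ?J)"
  have "mweight id (\<lambda>_. 1) ((\<lambda>s. {f s, g s}) ` signs \<union> ring f) V = mweight id (\<lambda>_. 1) (ring f) ?W"
    by (rule mweight_pendants) (use assms in \<open>auto simp: finite_ring Union_ring\<close>)
  also have "\<dots> = sign_value 1 1 (\<lambda>s. f s \<in> ?W)"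
    by (rule mweight_ring[OF f]) (use V in auto)
  also have "\<dots> = sign_value 1 1 (\<lambda>s. \<not> g s \<in> V)"
  proof (rule sign_value_cong)
    fix s assume s: "s \<in> signs"
    have "f s \<in> f ` ?J \<longleftrightarrow> s \<in> ?J" by (rule inj_on_image_mem_iff[OF f s]) auto
    moreover have "f s \<notin> g ` ?J" using fg s by auto
    ultimately show "f s \<in> ?W \<longleftrightarrow> \<not> g s \<in> V" using V s by auto
  qed
  finally show ?thesis by (simp only: sign_value_complement)
qed

text \<open>Two covered ports joined by an extra edge are matched either with the inner ring,
  contributing 1/2 after normalisation, or with each other, contributing 1: this is the weight 3/2.
  The other neighbouring ports keep 1/2, and the full set gives 1/2 + 2 * 1/2 + 1 = 5/2 = 1/4 +
  9/4.\<close>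

lemma mweight_ladder:
  assumes f: "inj_on f signs" and g: "inj_on g signs" and fg: "f ` signs \<inter> g ` signs = {}"
    and V: "f ` signs \<subseteq> V" "V \<subseteq> f ` signs \<union> g ` signs"
  shows "mweight id (\<lambda>_. 1) (ladder k f g) V =
    2 * (if k then sign_value (3/2) (1/2) (\<lambda>s. g s \<in> V) else sign_value (1/2) (3/2) (\<lambda>s. g s \<in> V))"
proof -
  define a b c d where abcd: "a = g (1, 1)" "b = g (-1, 1)" "c = g (-1, -1)" "d = g (1, -1)"
  define E where "E = (\<lambda>s. {f s, g s}) ` signs \<union> ring f"
  have fin: "finite E" by (simp add: E_def finite_ring)
  have ne: "a \<noteq> b" "a \<noteq> c" "a \<noteq> d" "b \<noteq> c" "b \<noteq> d" "c \<noteq> d" "b \<noteq> a" "c \<noteq> a" "d \<noteq> a" "c \<noteq> b" "d \<noteq> b" "d \<noteq> c"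
    using inj_on_eq_iff[OF g] signs_mem by (simp_all add: abcd)
  have gs: "g ` signs = {a, b, c, d}" by (auto simp: abcd signs_def)
  have ni: "{x, y} \<notin> E" if "x \<in> {a, b, c, d}" "y \<in> {a, b, c, d}" for x y
  proof
    assume "{x, y} \<in> E"
    moreover have "\<forall>e\<in>E. \<exists>s\<in>signs. f s \<in> e" unfolding E_def ring_def using signs_mem by auto
    ultimately obtain s where "s \<in> signs" "f s \<in> {x, y}" by blast
    then show False using fg that unfolding gs by auto
  qed
  have R: "mweight id (\<lambda>_. 1) E W = 2 * cycle_value (1/2) (1/2) (1/2) (1/2) (a \<in> W) (b \<in> W) (c \<in> W) (d \<in> W)"
    if "f ` signs \<subseteq> W" "W \<subseteq> f ` signs \<union> g ` signs" for W
    using mweight_ring_pendants[OF f g fg that] by (simp add: E_def sign_value_def abcd)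
  have sub: "f ` signs \<subseteq> V - X" "V - X \<subseteq> f ` signs \<union> g ` signs" if "X \<subseteq> {a, b, c, d}" for X
    using V fg that unfolding gs by blast+
  have two: "mweight id (\<lambda>_. 1) ({{x, y}, {x', y'}} \<union> E) V =
      mweight id (\<lambda>_. 1) E V + (if {x', y'} \<subseteq> V then mweight id (\<lambda>_. 1) E (V - {x', y'}) else 0) +
      (if {x, y} \<subseteq> V then mweight id (\<lambda>_. 1) E (V - {x, y}) +
        (if {x', y'} \<subseteq> V - {x, y} then mweight id (\<lambda>_. 1) E (V - {x, y} - {x', y'}) else 0) else 0)"
    if "x \<in> {a, b, c, d}" "y \<in> {a, b, c, d}" "x' \<in> {a, b, c, d}" "y' \<in> {a, b, c, d}" "{x, y} \<noteq> {x', y'}" for x y x' y'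
  proof -
    have "{x', y'} \<notin> E" "{x, y} \<notin> insert {x', y'} E" using ni that by simp_all
    then show ?thesis using fin by (simp add: mweight_insert)
  qed
  have Rd: "mweight id (\<lambda>_. 1) E (V - X) =
      2 * cycle_value (1/2) (1/2) (1/2) (1/2) (a \<in> V - X) (b \<in> V - X) (c \<in> V - X) (d \<in> V - X)"
    if "X \<subseteq> {a, b, c, d}" for X
    by (rule R[OF sub[OF that]])
  have Rd2: "mweight id (\<lambda>_. 1) E (V - X - Y) =
      2 * cycle_value (1/2) (1/2) (1/2) (1/2) (a \<in> V - X - Y) (b \<in> V - X - Y) (c \<in> V - X - Y) (d \<in> V - X - Y)"
    if "X \<subseteq> {a, b, c, d}" "Y \<subseteq> {a, b, c, d}" for X Y
  proof -
    have "V - X - Y = V - (X \<union> Y)" by blast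
    then show ?thesis using Rd[of "X \<union> Y"] that by simp
  qed
  have ad: "mweight id (\<lambda>_. 1) ({{a, d}, {b, c}} \<union> E) V = 2 * cycle_value (1/2) (3/2) (1/2) (3/2) (a \<in> V) (b \<in> V) (c \<in> V) (d \<in> V)"
    using ne by (subst two) (auto simp: R[OF V] Rd Rd2 cycle_value_def doubleton_eq_iff)
  have ab: "mweight id (\<lambda>_. 1) ({{a, b}, {c, d}} \<union> E) V = 2 * cycle_value (3/2) (1/2) (3/2) (1/2) (a \<in> V) (b \<in> V) (c \<in> V) (d \<in> V)"
    using ne by (subst two) (auto simp: R[OF V] Rd Rd2 cycle_value_def doubleton_eq_iff)
  show ?thesis
    using ad ab by (cases k) (simp_all only: ladder_def E_def abcd sign_value_def if_True if_False)
qed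

text \<open>If the crossings are charged to the replaced city itself, its ports become private, and
  a used spoke takes its port away from the ladder; the formula for the ladder appears at the
  complement.\<close>

lemma mweight_ladder_pendants:
  assumes f: "inj_on f signs" and g: "inj_on g signs" and h: "inj_on h signs"
    and dis: "f ` signs \<inter> g ` signs = {}" "h ` signs \<inter> (f ` signs \<union> g ` signs) = {}"
    and V: "f ` signs \<union> g ` signs \<subseteq> V" "V \<subseteq> f ` signs \<union> g ` signs \<union> h ` signs"
  shows "mweight id (\<lambda>_. 1) ((\<lambda>s. {g s, h s}) ` signs \<union> ladder k f g) V =
    2 * (if k then sign_value (3/2) (1/2) (\<lambda>s. \<not> h s \<in> V) else sign_value (1/2) (3/2) (\<lambda>s. \<not> h s \<in> V))"
proof -
  let ?J = "{s\<in>signs. h s \<in> V}"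
  let ?W = "V - (g ` ?J \<union> h ` ?J)"
  let ?E = "ladder k f g"
  have fin: "finite ?E" by (simp add: ladder_def finite_ring)
  have "\<Union> ?E \<subseteq> f ` signs \<union> g ` signs" by (auto simp: ladder_def Union_ring signs_mem)
  then have hE: "h ` signs \<inter> \<Union> ?E = {}" using dis(2) by blast
  have gh: "g ` signs \<inter> h ` signs = {}" and gV: "g ` signs \<subseteq> V" using dis(2) V by blast+
  have "mweight id (\<lambda>_. 1) ((\<lambda>s. {g s, h s}) ` signs \<union> ?E) V = mweight id (\<lambda>_. 1) ?E ?W"
    by (rule mweight_pendants[OF finite_ring(2) fin g h gh hE gV])
  also have "\<dots> = 2 * (if k then sign_value (3/2) (1/2) (\<lambda>s. g s \<in> ?W) else sign_value (1/2) (3/2) (\<lambda>s. g s \<in> ?W))"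
    by (rule mweight_ladder[OF f g dis(1)]) (use V dis in auto)
  finally have eq: "mweight id (\<lambda>_. 1) ((\<lambda>s. {g s, h s}) ` signs \<union> ?E) V =
    2 * (if k then sign_value (3/2) (1/2) (\<lambda>s. g s \<in> ?W) else sign_value (1/2) (3/2) (\<lambda>s. g s \<in> ?W))" .
  have "sign_value n e (\<lambda>s. g s \<in> ?W) = sign_value n e (\<lambda>s. \<not> h s \<in> V)" for n e
  proof (rule sign_value_cong)
    fix s assume s: "s \<in> signs"
    have "g s \<in> g ` ?J \<longleftrightarrow> s \<in> ?J" by (rule inj_on_image_mem_iff[OF g s]) auto
    moreover have "g s \<notin> h ` ?J" using dis s by auto
    ultimately show "g s \<in> ?W \<longleftrightarrow> \<not> h s \<in> V" using V s by auto
  qed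
  then show ?thesis unfolding eq by (simp only:)
qed

section \<open>Cities, their sides and their gadgets\<close>

definition neg :: "int \<times> int \<Rightarrow> int \<times> int" where
  "neg s = (- fst s, - snd s)"

text \<open>Twice the midpoint of the side of the city in quadrant \<open>s\<close>; both cities at
  the side give the same point, a site of the Aztec diamond.\<close>

definition side :: "int \<times> int \<Rightarrow> int \<times> int \<Rightarrow> int \<times> int" where
  "side c s = (2 * fst c + fst s, 2 * snd c + snd s)"

definition mirror :: "int \<times> int \<Rightarrow> int \<times> int \<Rightarrow> tri" where
  "mirror c s = (across c s, neg s, True)"

definition core :: "int \<times> int \<Rightarrow> tri set set" where
  "core c = (if replaced c then ladder (second_kind c) (\<lambda>s. (c, s, False)) (\<lambda>s. (c, s, True))
    else ring (\<lambda>s. (c, s, True)))"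

text \<open>
  The tiles that cross a side are assigned to the plain city if \<open>z\<close> is false and to the replaced city if
  \<open>z\<close> is true; the side is then represented by the triangle \<open>port z\<close> of the other city.
\<close>

definition gadget :: "bool \<Rightarrow> int \<times> int \<Rightarrow> tri set set" where
  "gadget z c = (if replaced c = z then (\<lambda>s. {(c, s, True), mirror c s}) ` signs else {}) \<union> core c"

definition own :: "bool \<Rightarrow> int \<times> int \<Rightarrow> tri set" where
  "own z c = {(c, s, b) | s b. s \<in> signs \<and> (b \<or> replaced c) \<and> (replaced c = z \<or> \<not> b)}"

text \<open>For odd \<open>x\<close>, the one of the two integers next to \<open>x / 2\<close> with
  parity \<open>i\<close>. The parities select the city of the wanted type among the two at a
  site.\<close>

definition nearest :: "int \<Rightarrow> int \<Rightarrow> int" where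
  "nearest i x = (if ((x - 1) div 2) mod 2 = i then (x - 1) div 2 else (x - 1) div 2 + 1)"

definition port :: "bool \<Rightarrow> int \<times> int \<Rightarrow> tri" where
  "port z v = (let p = nearest (of_bool (\<not> z)) (fst v); q = nearest (of_bool z) (snd v)
     in ((p, q), (fst v - 2 * p, snd v - 2 * q), True))"

lemma nearest_side:
  assumes "s = 1 \<or> s = -1" "i = 0 \<or> i = 1"
  shows "nearest i (2 * p + s) = (if p mod 2 = i then p else p + s)"
proof -
  have "(2 * p + s - 1) div 2 = (if s = 1 then p else p - 1)" using assms(1) by auto
  moreover have "(p - 1) mod 2 = i \<longleftrightarrow> p mod 2 \<noteq> i" using assms(2) by presburger
  ultimately show ?thesis using assms(1) unfolding nearest_def by auto
qed

lemma inj_port: "inj_on (port z) A"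
  by (rule inj_onI) (auto simp: port_def Let_def prod_eq_iff)

lemma port_side:
  assumes "s \<in> signs" "city c"
  shows "port z (side c s) = (if replaced c = z then mirror c s else (c, s, True))"
proof -
  have s: "fst s = 1 \<or> fst s = -1" "snd s = 1 \<or> snd s = -1" using assms(1) by (auto simp: signs_def)
  have rep: "replaced c \<longleftrightarrow> odd (fst c)" "replaced c \<longleftrightarrow> even (snd c)"
    using assms(2) by (auto simp: replaced_def city_def)
  have "nearest (of_bool (\<not> z)) (fst (side c s)) = (if replaced c = z then fst c + fst s else fst c)"
    using nearest_side[OF s(1), of "of_bool (\<not> z)" "fst c"]
    by (cases z; cases "odd (fst c)") (simp_all add: side_def rep(1) mod_2_eq_odd)
  moreover have "nearest (of_bool z) (snd (side c s)) = (if replaced c = z then snd c + snd s else snd c)"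
    using nearest_side[OF s(2), of "of_bool z" "snd c"]
    by (cases z; cases "odd (snd c)") (simp_all add: side_def rep(2) mod_2_eq_odd)
  ultimately show ?thesis
    unfolding port_def Let_def by (auto simp: side_def mirror_def across_def neg_def prod_eq_iff)
qed

lemma face_sites_side: "face_sites c = side c ` signs"
  by (cases c) (auto simp: face_sites_def side_def signs_def)

lemma city_across: "s \<in> signs \<Longrightarrow> city (across c s) \<longleftrightarrow> city c"
  by (auto simp: city_def across_def signs_def)

lemma replaced_across: "s \<in> signs \<Longrightarrow> city c \<Longrightarrow> replaced (across c s) \<longleftrightarrow> \<not> replaced c"
  by (auto simp: city_def across_def signs_def replaced_def)

lemma across_across: "across (across c s) (neg s) = c"
  by (simp add: across_def neg_def)

lemma neg_signs: "s \<in> signs \<Longrightarrow> neg s \<in> signs"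
  by (auto simp: neg_def signs_def)

lemma neg_neg: "neg (neg s) = s"
  by (simp add: neg_def)

lemma side_across: "side (across c s) (neg s) = side c s"
  by (simp add: side_def across_def neg_def)

lemma city_mweight:
  assumes c: "city c" and Y: "Y \<subseteq> face_sites c"
  shows "mweight ends (city_weight x y z) (face_edges c) Y =
    (if replaced c then if second_kind c then sign_value y z (\<lambda>s. side c s \<in> Y) else sign_value z y (\<lambda>s. side c s \<in> Y)
     else sign_value x x (\<lambda>s. side c s \<in> Y))"
proof -
  obtain p q where pq: "c = (p, q)" by fastforce
  have "mweight ends (city_weight x y z) (face_edges (p, q)) Y =
    cycle_value (city_weight x y z (2*p, 2*q+1)) (city_weight x y z (2*p-1, 2*q)) (city_weight x y z (2*p, 2*q-1))
      (city_weight x y z (2*p+1, 2*q)) ((2*p+1, 2*q+1) \<in> Y) ((2*p-1, 2*q+1) \<in> Y) ((2*p-1, 2*q-1) \<in> Y) ((2*p+1, 2*q-1) \<in> Y)"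
    unfolding face_edges_def prod.case cycle_value_def
    by (rule mweight_four_cycle) (use Y in \<open>auto simp: ends_def face_sites_def pq\<close>)
  moreover have par: "odd (p + q)" using c by (simp add: city_def pq)
  ultimately have gen: "mweight ends (city_weight x y z) (face_edges c) Y =
      cycle_value (city_weight x y z (2*p, 2*q+1)) (city_weight x y z (2*p-1, 2*q)) (city_weight x y z (2*p, 2*q-1))
      (city_weight x y z (2*p+1, 2*q)) (side c (1, 1) \<in> Y) (side c (-1, 1) \<in> Y) (side c (-1, -1) \<in> Y) (side c (1, -1) \<in> Y)"
    by (simp add: pq side_def)
  show ?thesis
  proof (cases "replaced c")
    case True
    then have rp: "odd p" "even q" by (simp_all add: replaced_def pq)
    have "(p + q) mod 4 = 3 \<longleftrightarrow> \<not> (p + q) mod 4 = 1" using par by presburger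
    then have "(p + q) mod 4 = 3 \<longleftrightarrow> \<not> second_kind c" using True by (simp add: second_kind_def pq)
    then show ?thesis
      using True unfolding gen sign_value_def by (simp add: city_weight_replaced_face[OF rp])
  next
    case False
    then have rp: "even p" "odd q" using par by (auto simp: replaced_def pq)
    then show ?thesis
      using False unfolding gen sign_value_def by (simp add: city_weight_plain_face)
  qed
qed

lemma port_mem_iff:
  assumes "s \<in> signs" "city c" "Y \<subseteq> face_sites c" "O' \<inter> port z ` face_sites c = {}"
  shows "port z (side c s) \<in> O' \<union> port z ` Y \<longleftrightarrow> side c s \<in> Y"
proof -
  have "side c s \<in> face_sites c" using assms(1) by (simp add: face_sites_side)
  then show ?thesis
    using assms(3,4) inj_on_image_mem_iff[OF inj_port[of z UNIV], of "side c s" Y] by blast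
qed

lemma signs_inj:
  "inj_on (\<lambda>s. (c, s, b)) A" "inj_on (mirror c) A"
  by (auto simp: inj_on_def mirror_def across_def prod_eq_iff)

lemma port_image:
  assumes "city c"
  shows "port z ` face_sites c = (if replaced c = z then mirror c ` signs else (\<lambda>s. (c, s, True)) ` signs)"
  unfolding face_sites_side image_image using port_side[OF _ assms] by (auto simp: image_iff)

lemma own_eq:
  "own z c = (if replaced c then (\<lambda>s. (c, s, False)) ` signs else {}) \<union>
    (if replaced c = z then (\<lambda>s. (c, s, True)) ` signs else {})"
  by (auto simp: own_def)

lemma mirror_fst_ne: "s \<in> signs \<Longrightarrow> fst (mirror c s) \<noteq> c"
  by (auto simp: mirror_def across_def signs_def prod_eq_iff)

text \<open>The four combinations are a ring, a ring with pendants, a ladder and a ladder with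
  pendants. The factors 1, 2, 2 and 5 are their matching counts when \<open>Y\<close> is
  empty.\<close>

lemma gadget_mweight:
  assumes c: "city c" and Y: "Y \<subseteq> face_sites c"
  shows "mweight id (\<lambda>_. 1) (gadget z c) (own z c \<union> port z ` Y) =
    (if z then (if replaced c then 5 else 1) * mweight ends (city_weight 1 (3/5) (1/5)) (face_edges c) Y
     else 2 * mweight ends (city_weight (1/2) (3/2) (1/2)) (face_edges c) Y)"
proof -
  let ?V = "own z c \<union> port z ` Y"
  let ?I = "\<lambda>s. (c, s, False)" and ?P = "\<lambda>s. (c, s, True)"
  have mirror: "mirror c ` signs \<inter> (?I ` signs \<union> ?P ` signs) = {}" 
  proof -
    have "mirror c s \<noteq> (c, s', b)" if "s \<in> signs" for s s' b
      using mirror_fst_ne[OF that, of c] by auto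
    then show ?thesis by blast
  qed
  have dis: "?I ` signs \<inter> ?P ` signs = {}" by auto
  have Yp: "port z ` Y \<subseteq> port z ` face_sites c" using Y by blast
  have own_port: "own z c \<inter> port z ` face_sites c = {}"
    unfolding port_image[OF c] own_eq using mirror dis by auto
  have mem: "port z (side c s) \<in> ?V \<longleftrightarrow> side c s \<in> Y" if "s \<in> signs" for s
    by (rule port_mem_iff[OF that c Y own_port])
  show ?thesis
  proof (cases "replaced c")
    case False
    show ?thesis
    proof (cases z)
      case True
      have "mweight id (\<lambda>_. 1) (gadget z c) ?V = sign_value 1 1 (\<lambda>s. ?P s \<in> ?V)"
        using False True Yp unfolding gadget_def core_def
        by (simp add: mweight_ring[OF signs_inj(1)] own_eq port_image[OF c])
      also have "\<dots> = sign_value 1 1 (\<lambda>s. side c s \<in> Y)"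
        by (rule sign_value_cong) (use mem False True port_side[OF _ c] in simp)
      finally show ?thesis using False True by (simp add: city_mweight[OF c Y])
    next
      case nz: False
      have "mweight id (\<lambda>_. 1) ((\<lambda>s. {?P s, mirror c s}) ` signs \<union> ring ?P) ?V = 2 * sign_value (1/2) (1/2) (\<lambda>s. mirror c s \<in> ?V)"
        by (rule mweight_ring_pendants[OF signs_inj])
           (use False nz Yp mirror in \<open>auto simp: own_eq port_image[OF c]\<close>)
      also have "sign_value (1/2) (1/2) (\<lambda>s. mirror c s \<in> ?V) = sign_value (1/2) (1/2) (\<lambda>s. side c s \<in> Y)"
        by (rule sign_value_cong) (use mem False nz port_side[OF _ c] in simp)
      finally show ?thesis by (simp only: city_mweight[OF c Y] gadget_def core_def False nz if_True if_False simp_thms)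
    qed
  next
    case True
    show ?thesis
    proof (cases z)
      case False
      have V: "?I ` signs \<subseteq> ?V" "?V \<subseteq> ?I ` signs \<union> ?P ` signs"
        using True False Yp by (auto simp: own_eq port_image[OF c])
      have S: "sign_value n e (\<lambda>s. ?P s \<in> ?V) = sign_value n e (\<lambda>s. side c s \<in> Y)" for n e
        by (rule sign_value_cong) (use mem False True port_side[OF _ c] in simp)
      have "gadget z c = ladder (second_kind c) ?I ?P" using True False by (simp add: gadget_def core_def)
      then have "mweight id (\<lambda>_. 1) (gadget z c) ?V = 2 * (if second_kind c
          then sign_value (3/2) (1/2) (\<lambda>s. ?P s \<in> ?V) else sign_value (1/2) (3/2) (\<lambda>s. ?P s \<in> ?V))"
        by (simp only: mweight_ladder[OF signs_inj(1,1) dis V])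
      then show ?thesis unfolding S city_mweight[OF c Y] using True False by simp
    next
      case z: True
      have V: "?I ` signs \<union> ?P ` signs \<subseteq> ?V" "?V \<subseteq> ?I ` signs \<union> ?P ` signs \<union> mirror c ` signs"
        using True z Yp by (auto simp: own_eq port_image[OF c])
      have S: "sign_value n e (\<lambda>s. \<not> mirror c s \<in> ?V) = sign_value n e (\<lambda>s. \<not> side c s \<in> Y)" for n e
        by (rule sign_value_cong) (use mem z True port_side[OF _ c] in simp)
      have "gadget z c = (\<lambda>s. {?P s, mirror c s}) ` signs \<union> ladder (second_kind c) ?I ?P"
        using True z by (simp add: gadget_def core_def)
      then have "mweight id (\<lambda>_. 1) (gadget z c) ?V = 2 * (if second_kind c
          then sign_value (3/2) (1/2) (\<lambda>s. \<not> mirror c s \<in> ?V) else sign_value (1/2) (3/2) (\<lambda>s. \<not> mirror c s \<in> ?V))"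
        by (simp only: mweight_ladder_pendants[OF signs_inj(1) signs_inj(1) signs_inj(2) dis mirror V])
      then show ?thesis
        unfolding S city_mweight[OF c Y] using True z
        by (cases "second_kind c") (simp_all only: if_True if_False simp_thms sign_value_complement)
    qed
  qed
qed

section \<open>Distribution of the tiles over the cities\<close>

lemma sides_eq_flip:
  assumes "s \<in> signs" "s' \<in> signs" "s' = (fst s, - snd s) \<or> s' = (- fst s, snd s)"
  shows "{f s, f s'} \<in> ring f"
proof -
  have R: "{f (1, 1), f (-1, 1)} \<in> ring f" "{f (-1, 1), f (1, 1)} \<in> ring f"
    "{f (-1, 1), f (-1, -1)} \<in> ring f" "{f (-1, -1), f (-1, 1)} \<in> ring f"
    "{f (-1, -1), f (1, -1)} \<in> ring f" "{f (1, -1), f (-1, -1)} \<in> ring f"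
    "{f (1, -1), f (1, 1)} \<in> ring f" "{f (1, 1), f (1, -1)} \<in> ring f"
    unfolding ring_def by blast+
  show ?thesis
    using assms unfolding signs_def by (elim insertE emptyE disjE) (simp_all add: R)
qed

lemma ring_flip:
  "e \<in> ring f \<Longrightarrow> \<exists>s\<in>signs. \<exists>s'\<in>signs. e = {f s, f s'} \<and> s \<noteq> s' \<and> (s' = (fst s, - snd s) \<or> s' = (- fst s, snd s))"
proof -
  assume "e \<in> ring f"
  then consider "e = {f (1, 1), f (-1, 1)}" | "e = {f (-1, 1), f (-1, -1)}"
    | "e = {f (-1, -1), f (1, -1)}" | "e = {f (1, -1), f (1, 1)}"
    unfolding ring_def by blast
  then show ?thesis
  proof cases
    case 1
    then show ?thesis by (intro bexI[of _ "(1, 1)"] bexI[of _ "(-1, 1)"]) (simp_all add: signs_mem)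
  next
    case 2
    then show ?thesis by (intro bexI[of _ "(-1, 1)"] bexI[of _ "(-1, -1)"]) (simp_all add: signs_mem)
  next
    case 3
    then show ?thesis by (intro bexI[of _ "(-1, -1)"] bexI[of _ "(1, -1)"]) (simp_all add: signs_mem)
  next
    case 4
    then show ?thesis by (intro bexI[of _ "(1, -1)"] bexI[of _ "(1, 1)"]) (simp_all add: signs_mem)
  qed
qed

lemma ports_flip:
  assumes "e \<in> (if k then {{g (1, 1), g (-1, 1)}, {g (-1, -1), g (1, -1)}}
    else {{g (1, 1), g (1, -1)}, {g (-1, 1), g (-1, -1)}})"
  shows "\<exists>s\<in>signs. e = {g s, g (if k then (- fst s, snd s) else (fst s, - snd s))}"
proof -
  consider "k" "e = {g (1, 1), g (-1, 1)}" | "k" "e = {g (-1, -1), g (1, -1)}"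
    | "\<not> k" "e = {g (1, 1), g (1, -1)}" | "\<not> k" "e = {g (-1, 1), g (-1, -1)}"
    using assms by (cases k) auto
  then show ?thesis
  proof cases
    case 1
    then show ?thesis by (intro bexI[of _ "(1, 1)"]) (simp_all add: signs_mem)
  next
    case 2
    then show ?thesis by (intro bexI[of _ "(-1, -1)"]) (simp_all add: signs_mem)
  next
    case 3
    then show ?thesis by (intro bexI[of _ "(1, 1)"]) (simp_all add: signs_mem)
  next
    case 4
    then show ?thesis by (intro bexI[of _ "(-1, 1)"]) (simp_all add: signs_mem)
  qed
qed

lemma ports_flip_mem:
  assumes "s \<in> signs"
  shows "{g s, g (if k then (- fst s, snd s) else (fst s, - snd s))} \<in>
    (if k then {{g (1, 1), g (-1, 1)}, {g (-1, -1), g (1, -1)}}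
     else {{g (1, 1), g (1, -1)}, {g (-1, 1), g (-1, -1)}})"
  using assms unfolding signs_def
  by (elim insertE emptyE; cases k; simp only: fst_conv snd_conv if_True if_False minus_minus simp_thms; blast)

text \<open>Identifies the explicit graphs used for counting with the adjacency relation inside one
  city.\<close>

lemma core_tri_edges:
  assumes c: "city c"
  shows "e \<in> core c \<longleftrightarrow> (\<exists>s b s' b'. e = {(c, s, b), (c, s', b')} \<and> (c, s, b) \<in> triangles \<and> (c, s', b') \<in> triangles \<and>
    (c, s, b) \<noteq> (c, s', b') \<and> tri_adj (c, s, b) (c, s', b'))"
proof
  assume "e \<in> core c"
  then consider (ring) b where "e \<in> ring (\<lambda>s. (c, s, b))" "b \<longleftrightarrow> \<not> replaced c"
    | (rung) s where "replaced c" "s \<in> signs" "e = {(c, s, False), (c, s, True)}"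
    | (ports) s s' where "replaced c" "s \<in> signs" "s' \<in> signs" "e = {(c, s, True), (c, s', True)}"
        "s' = (if second_kind c then (- fst s, snd s) else (fst s, - snd s))"
  proof -
    note alt = that
    let ?flip = "\<lambda>s. if second_kind c then (- fst s, snd s) else (fst s, - snd s :: int)"
    consider "e \<in> ring (\<lambda>s. (c, s, \<not> replaced c))"
      | "replaced c" "e \<in> (\<lambda>s. {(c, s, False), (c, s, True)}) ` signs"
      | "replaced c" "\<exists>s\<in>signs. e = {(c, s, True), (c, ?flip s, True)}"
    proof (cases "replaced c")
      case False
      then show ?thesis using \<open>e \<in> core c\<close> that(1) by (simp add: core_def)
    next
      case True
      then show ?thesis
        using \<open>e \<in> core c\<close> that ports_flip[of e "second_kind c" "\<lambda>s. (c, s, True)"]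
        unfolding core_def if_P[OF True] ladder_def by simp blast
    qed
    then show ?thesis
    proof cases
      case 1
      then show ?thesis using alt(1)[of "\<not> replaced c"] by simp
    next
      case 2
      then show ?thesis using alt(2) by blast
    next
      case 3
      then obtain s where s: "s \<in> signs" "e = {(c, s, True), (c, ?flip s, True)}" by blast
      moreover have "?flip s \<in> signs" using s(1) by (auto simp: signs_def)
      ultimately show ?thesis using alt(3)[of s "?flip s"] 3(1) by simp
    qed
  qed
  then show "\<exists>s b s' b'. e = {(c, s, b), (c, s', b')} \<and> (c, s, b) \<in> triangles \<and> (c, s', b') \<in> triangles \<and>
    (c, s, b) \<noteq> (c, s', b') \<and> tri_adj (c, s, b) (c, s', b')"
  proof cases
    case ring
    then obtain s s' where s: "s \<in> signs" "s' \<in> signs" "e = {(c, s, b), (c, s', b)}" "s \<noteq> s'"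
      and flip: "s' = (fst s, - snd s) \<or> s' = (- fst s, snd s)"
      using ring_flip[of e "\<lambda>s. (c, s, b)"] by blast
    have "tri_adj (c, s, b) (c, s', b)" unfolding tri_adj_def prod.case using flip ring(2) by (auto simp: second_kind_def)
    moreover have "(c, s, b) \<in> triangles" "(c, s', b) \<in> triangles" using s c ring(2) by (simp_all add: triangles_def)
    ultimately show ?thesis using s(3,4) by blast
  next
    case rung
    have "tri_adj (c, s, False) (c, s, True)" by (simp add: tri_adj_def)
    moreover have "(c, s, False) \<in> triangles" "(c, s, True) \<in> triangles" using rung c by (simp_all add: triangles_def)
    ultimately show ?thesis using rung(3) by blast
  next
    case ports
    have "tri_adj (c, s, True) (c, s', True)" unfolding tri_adj_def prod.case using ports(5) by auto
    moreover have "(c, s, True) \<in> triangles" "(c, s', True) \<in> triangles" using ports c by (simp_all add: triangles_def)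
    moreover have "s \<noteq> s'" using ports(2,5) by (auto simp: signs_def)
    ultimately show ?thesis using ports(4) by blast
  qed
next
  assume "\<exists>s b s' b'. e = {(c, s, b), (c, s', b')} \<and> (c, s, b) \<in> triangles \<and> (c, s', b') \<in> triangles \<and>
    (c, s, b) \<noteq> (c, s', b') \<and> tri_adj (c, s, b) (c, s', b')"
  then obtain s b s' b' where e: "e = {(c, s, b), (c, s', b')}" and t: "(c, s, b) \<in> triangles" "(c, s', b') \<in> triangles"
    and adj: "tri_adj (c, s, b) (c, s', b')" by blast
  have s: "s \<in> signs" "s' \<in> signs" using t by (simp_all add: triangles_def)
  have "fst s \<noteq> 0" using s by (auto simp: signs_def)
  then have "c \<noteq> (fst c + fst s, snd c + snd s)" by (simp add: prod_eq_iff)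
  then have adj': "if b \<noteq> b' then s' = s
        else (s' = (fst s, - snd s) \<and> \<not> (b \<and> second_kind c)) \<or>
             (s' = (- fst s, snd s) \<and> \<not> (b \<and> replaced c \<and> \<not> second_kind c))"
    using adj unfolding tri_adj_def prod.case by blast
  have flip: "{(c, s, b), (c, s', b)} \<in> ring (\<lambda>s. (c, s, b))" if "b = b'"
    using sides_eq_flip[OF s, of "\<lambda>s. (c, s, b)"] adj' that by auto
  show "e \<in> core c"
  proof (cases "replaced c")
    case False
    then have "b" "b'" using t by (auto simp: triangles_def)
    then show ?thesis using flip False e by (simp add: core_def)
  next
    case True
    consider "b \<noteq> b'" | "\<not> b" "\<not> b'" | "b" "b'" by blast
    then show ?thesis
    proof cases
      case 1
      then have "e = {(c, s, False), (c, s, True)}" using adj' e by auto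
      then show ?thesis using True s by (auto simp: core_def ladder_def)
    next
      case 2
      then show ?thesis using True flip e by (simp add: core_def ladder_def)
    next
      case 3
      then have "s' = (if second_kind c then (- fst s, snd s) else (fst s, - snd s))"
        using adj' True by auto
      then have eq: "e = {(c, s, True), (c, if second_kind c then (- fst s, snd s) else (fst s, - snd s), True)}"
        using e 3 by simp
      show ?thesis
        unfolding core_def if_P[OF True] ladder_def
        by (rule UnI1, subst eq) (rule ports_flip_mem[OF s(1), of "\<lambda>s. (c, s, True)" "second_kind c"])
    qed
  qed
qed

text \<open>Here \<open>z\<close> is arbitrary: the two cities of a crossing tile have opposite
  types, so the tile can be attributed to the one with \<open>replaced c = z\<close>.\<close>

lemma tri_edges_iff:
  "e \<in> tri_edges \<longleftrightarrow> (\<exists>c. city c \<and> e \<in> core c) \<or>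
    (\<exists>c s. city c \<and> replaced c = z \<and> s \<in> signs \<and> e = {(c, s, True), mirror c s})"
proof
  assume "e \<in> tri_edges"
  then obtain t t' where e: "e = {t, t'}" and t: "t \<in> triangles" "t' \<in> triangles" "t \<noteq> t'" "tri_adj t t'"
    unfolding tri_edges_def by blast
  obtain c s b c' s' b' where tt: "t = (c, s, b)" "t' = (c', s', b')" by (metis prod_cases3)
  have T: "city c" "s \<in> signs" "city c'" "s' \<in> signs" using t by (simp_all add: tt triangles_def)
  show "(\<exists>c. city c \<and> e \<in> core c) \<or> (\<exists>c s. city c \<and> replaced c = z \<and> s \<in> signs \<and> e = {(c, s, True), mirror c s})"
  proof (cases "c' = c")
    case True
    then have "e \<in> core c" unfolding core_tri_edges[OF T(1)] using e t tt by blast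
    then show ?thesis using T(1) by blast
  next
    case False
    then have b: "b" "b'" and c': "c' = across c s" "s' = neg s"
      using t(4) by (auto simp: tt tri_adj_def across_def neg_def)
    have 1: "e = {(c, s, True), mirror c s}" using e b c' by (simp add: tt mirror_def)
    have "mirror c' s' = (c, s, True)" unfolding c' mirror_def by (simp add: across_across neg_neg)
    then have 2: "e = {(c', s', True), mirror c' s'}" using e b by (auto simp: tt)
    show ?thesis
    proof (cases "replaced c = z")
      case True
      then show ?thesis using 1 T by blast
    next
      case False
      then have "replaced c' = z" using replaced_across[OF T(2,1)] unfolding c' by blast
      then show ?thesis using 2 T by blast
    qed
  qed
next
  assume "(\<exists>c. city c \<and> e \<in> core c) \<or> (\<exists>c s. city c \<and> replaced c = z \<and> s \<in> signs \<and> e = {(c, s, True), mirror c s})"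
  then show "e \<in> tri_edges"
  proof
    assume "\<exists>c. city c \<and> e \<in> core c"
    then obtain c where c: "city c" "e \<in> core c" by blast
    then show ?thesis unfolding core_tri_edges[OF c(1)] tri_edges_def by blast
  next
    assume "\<exists>c s. city c \<and> replaced c = z \<and> s \<in> signs \<and> e = {(c, s, True), mirror c s}"
    then obtain c s where c: "city c" "s \<in> signs" and e: "e = {(c, s, True), mirror c s}" by blast
    have "(c, s, True) \<in> triangles" "mirror c s \<in> triangles"
      using c by (simp_all add: triangles_def mirror_def city_across neg_signs)
    moreover have "(c, s, True) \<noteq> mirror c s" using mirror_fst_ne[OF c(2), of c] by (metis fst_conv)
    moreover have "tri_adj (c, s, True) (mirror c s)" by (simp add: tri_adj_def mirror_def across_def neg_def)
    ultimately show ?thesis unfolding tri_edges_def e by blast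
  qed
qed

lemma cells_city: "c \<in> cells n \<Longrightarrow> city c"
  by (cases c) (auto simp: cells_def aztec_faces_def city_def)

text \<open>For positive order this is read off from the incidence count, which is nonzero exactly
  at the sites.\<close>

lemma aztec_sites_eq: "aztec_sites h n = (\<Union>c\<in>aztec_faces h n. face_sites c)"
proof (cases n)
  case 0
  have "z \<notin> aztec_sites h 0" for z
    using aztec_weight_0 by (auto simp: aztec_sites_def) presburger
  then show ?thesis using 0 by (auto simp: aztec_faces_0)
next
  case (Suc m)
  have "v \<in> aztec_sites h (Suc m) \<longleftrightarrow> {c \<in> aztec_faces h (Suc m). v \<in> face_sites c} \<noteq> {}" for v
  proof -
    have "v \<in> aztec_sites h m \<Longrightarrow> v \<in> aztec_sites h (Suc m)" by (auto simp: aztec_sites_def)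
    then have "v \<in> aztec_sites h (Suc m) \<longleftrightarrow> card {c \<in> aztec_faces h (Suc m). v \<in> face_sites c} \<noteq> 0"
      unfolding card_faces_at_site by auto
    then show ?thesis using finite_aztec_faces[of h "Suc m"] by simp
  qed
  then show ?thesis unfolding Suc by blast
qed

lemma own_triangles: "city c \<Longrightarrow> t \<in> own z c \<longleftrightarrow> t \<in> triangles \<and> fst t = c \<and> (replaced c = z \<or> \<not> snd (snd t))"
  by (cases t) (auto simp: own_def triangles_def)

text \<open>Besides triangles of cities inside, the ports include those of cities just outside the
  diamond; these are the triangles attached at the boundary.\<close>

lemma port_sites: "port z ` aztec_sites (int n) n =
    {(c, s, True) | c s. city c \<and> s \<in> signs \<and> replaced c \<noteq> z \<and> (c \<in> cells n \<or> across c s \<in> cells n)}"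
proof (intro equalityI subsetI)
  fix t assume "t \<in> port z ` aztec_sites (int n) n"
  then obtain c s where c: "c \<in> cells n" and s: "s \<in> signs" and t: "t = port z (side c s)"
    unfolding aztec_sites_eq cells_def[symmetric] by (auto simp: face_sites_side)
  have city: "city c" using cells_city[OF c] .
  show "t \<in> {(c, s, True) | c s. city c \<and> s \<in> signs \<and> replaced c \<noteq> z \<and> (c \<in> cells n \<or> across c s \<in> cells n)}"
  proof (cases "replaced c = z")
    case True
    then have "t = (across c s, neg s, True)" using port_side[OF s city] t by (simp add: mirror_def)
    moreover have "city (across c s)" "neg s \<in> signs" "replaced (across c s) \<noteq> z"
      using city s True by (simp_all add: city_across neg_signs replaced_across)
    ultimately show ?thesis
      unfolding mem_Collect_eq
      by (intro exI[of _ "across c s"] exI[of _ "neg s"]) (simp add: across_across c)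
  next
    case False
    then have "t = (c, s, True)" using port_side[OF s city] t by simp
    then show ?thesis
      unfolding mem_Collect_eq by (intro exI[of _ c] exI[of _ s]) (simp add: c city s False)
  qed
next
  fix t assume "t \<in> {(c, s, True) | c s. city c \<and> s \<in> signs \<and> replaced c \<noteq> z \<and> (c \<in> cells n \<or> across c s \<in> cells n)}"
  then obtain c s where t: "t = (c, s, True)" and c: "city c" "s \<in> signs" "replaced c \<noteq> z"
    and mem: "c \<in> cells n \<or> across c s \<in> cells n" by blast
  have "t = port z (side c s)" using port_side[OF c(2,1)] c(3) t by simp
  moreover have "side c s \<in> face_sites c" "side c s \<in> face_sites (across c s)"
    using c(2) neg_signs[OF c(2)] side_across[of c s] by (auto simp: face_sites_side intro: rev_image_eqI)
  ultimately show "t \<in> port z ` aztec_sites (int n) n"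
    unfolding aztec_sites_eq cells_def[symmetric] using mem by blast
qed

lemma cluster_eq: "cluster z n = (\<Union>c\<in>cells n. own z c) \<union> port z ` aztec_sites (int n) n"
proof (intro equalityI subsetI)
  fix t assume t: "t \<in> cluster z n"
  obtain c s b where tt: "t = (c, s, b)" by (metis prod_cases3)
  have T: "t \<in> triangles" "city c" "s \<in> signs" using t by (auto simp: cluster_def tt triangles_def)
  show "t \<in> (\<Union>c\<in>cells n. own z c) \<union> port z ` aztec_sites (int n) n"
  proof (cases "c \<in> cells n \<and> (replaced c = z \<or> \<not> b)")
    case True
    then have "t \<in> own z c" using T by (simp add: own_triangles[OF T(2)] tt)
    then show ?thesis using True by blast
  next
    case False
    then have "b" "replaced c \<noteq> z" "c \<in> cells n \<or> across c s \<in> cells n"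
      using t by (auto simp: cluster_def tt)
    then have "t \<in> port z ` aztec_sites (int n) n" unfolding port_sites tt using T by blast
    then show ?thesis by blast
  qed
next
  fix t assume "t \<in> (\<Union>c\<in>cells n. own z c) \<union> port z ` aztec_sites (int n) n"
  then show "t \<in> cluster z n"
  proof
    assume "t \<in> (\<Union>c\<in>cells n. own z c)"
    then obtain c where c: "c \<in> cells n" "t \<in> own z c" by blast
    then show ?thesis using own_triangles[OF cells_city[OF c(1)]] by (cases t) (auto simp: cluster_def)
  next
    assume "t \<in> port z ` aztec_sites (int n) n"
    then show ?thesis unfolding port_sites by (auto simp: cluster_def triangles_def)
  qed
qed

text \<open>Reaching an inside city from an outside one has to decrease both coordinate distances to
  the centre, which fixes both signs. Hence a city outside contributes at most one triangle to the
  region, and no tile of the region lies within it.\<close>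

lemma unique_neighbour_cell:
  assumes c: "city c" "c \<notin> cells n" and s: "s \<in> signs" "s' \<in> signs"
    and a: "across c s \<in> cells n" "across c s' \<in> cells n"
  shows "s = s'"
proof -
  have step: "(fst r = 1 \<or> fst r = -1) \<and> (snd r = 1 \<or> snd r = -1) \<and>
      \<bar>fst c - int n + fst r\<bar> < \<bar>fst c - int n\<bar> \<and> \<bar>snd c + snd r\<bar> < \<bar>snd c\<bar>"
    if r: "r \<in> signs" "across c r \<in> cells n" for r
  proof -
    have pm: "(fst r = 1 \<or> fst r = -1) \<and> (snd r = 1 \<or> snd r = -1)" using r(1) by (auto simp: signs_def)
    have "\<bar>fst c + fst r - int n\<bar> + \<bar>snd c + snd r\<bar> < int n"
      using r cells_iff[of "across c r" n] c(1) by (simp add: city_across) (simp add: across_def)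
    moreover have "fst c + fst r - int n = fst c - int n + fst r" by simp
    ultimately have lt: "\<bar>fst c - int n + fst r\<bar> + \<bar>snd c + snd r\<bar> < int n" by simp
    have "\<bar>fst c - int n + fst r\<bar> \<ge> \<bar>fst c - int n\<bar> - 1" "\<bar>snd c + snd r\<bar> \<ge> \<bar>snd c\<bar> - 1"
      using pm by auto
    then show ?thesis using pm lt not_cells[OF c] by auto
  qed
  have flip: "x = x'" if "x = 1 \<or> x = -1" "x' = 1 \<or> x' = -1" "\<bar>a + x\<bar> < \<bar>a\<bar>" "\<bar>a + x'\<bar> < \<bar>a\<bar>" for a x x' :: int
    using that by auto
  show ?thesis
    using step[OF s(1) a(1)] step[OF s(2) a(2)] flip[of "fst s" "fst s'" "fst c - int n"] flip[of "snd s" "snd s'" "snd c"]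
    by (simp add: prod_eq_iff)
qed

lemma gadget_edges: "{e \<in> tri_edges. e \<subseteq> cluster z n} = (\<Union>c\<in>cells n. gadget z c)"
proof (intro equalityI subsetI)
  fix e assume e: "e \<in> {e \<in> tri_edges. e \<subseteq> cluster z n}"
  then consider (core) c where "city c" "e \<in> core c"
    | (spoke) c s where "city c" "replaced c = z" "s \<in> signs" "e = {(c, s, True), mirror c s}"
  proof -
    have "e \<in> tri_edges" using e by simp
    then show ?thesis using that unfolding tri_edges_iff[of e z] by blast
  qed
  then show "e \<in> (\<Union>c\<in>cells n. gadget z c)"
  proof cases
    case core
    have "c \<in> cells n"
    proof (rule ccontr)
      assume nc: "c \<notin> cells n"
      obtain s b s' b' where x: "e = {(c, s, b), (c, s', b')}" "(c, s, b) \<noteq> (c, s', b')"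
        using core(2) unfolding core_tri_edges[OF core(1)] by blast
      then have "(c, s, b) \<in> cluster z n" "(c, s', b') \<in> cluster z n" using e by auto
      then have "b" "b'" "s \<in> signs" "s' \<in> signs" "across c s \<in> cells n" "across c s' \<in> cells n"
        using nc by (auto simp: cluster_def triangles_def)
      then show False using unique_neighbour_cell[OF core(1) nc] x(2) by blast
    qed
    then show ?thesis using core by (auto simp: gadget_def)
  next
    case spoke
    then have "(c, s, True) \<in> cluster z n" using e by auto
    then have "c \<in> cells n" using spoke by (auto simp: cluster_def)
    then show ?thesis using spoke by (auto simp: gadget_def)
  qed
next
  fix e assume "e \<in> (\<Union>c\<in>cells n. gadget z c)"
  then obtain c where c: "c \<in> cells n" "e \<in> gadget z c" by blast
  have city: "city c" using cells_city[OF c(1)] .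
  consider (core) "e \<in> core c" | (spoke) s where "replaced c = z" "s \<in> signs" "e = {(c, s, True), mirror c s}"
    using c(2) unfolding gadget_def by (auto split: if_splits)
  then show "e \<in> {e \<in> tri_edges. e \<subseteq> cluster z n}"
  proof cases
    case core
    then have "e \<in> tri_edges" unfolding tri_edges_iff[of e z] using city by blast
    moreover have "e \<subseteq> cluster z n" using core c(1) unfolding core_tri_edges[OF city] by (auto simp: cluster_def)
    ultimately show ?thesis by blast
  next
    case spoke
    then have "e \<in> tri_edges" unfolding tri_edges_iff[of e z] using city by blast
    moreover have "(c, s, True) \<in> cluster z n" using spoke city c(1) by (auto simp: cluster_def triangles_def)
    moreover have "mirror c s \<in> cluster z n"
      using spoke city c(1) by (auto simp: cluster_def triangles_def mirror_def across_across city_across neg_signs replaced_across)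
    ultimately show ?thesis using spoke by blast
  qed
qed

text \<open>A tile in the gadget of \<open>c\<close> has a triangle in \<open>c\<close>, and a
  foreign one only if \<open>replaced c = z\<close>, then in a city of the other type. Membership in
  two gadgets would require contradictory types.\<close>

lemma gadget_members:
  assumes "city c" "e \<in> gadget z c"
  shows "(\<exists>t\<in>e. fst t = c) \<and> (\<forall>t\<in>e. fst t = c \<or> (replaced c = z \<and> replaced (fst t) \<noteq> z))"
proof -
  consider (core) "e \<in> core c" | (spoke) s where "replaced c = z" "s \<in> signs" "e = {(c, s, True), mirror c s}"
    using assms(2) unfolding gadget_def by (auto split: if_splits)
  then show ?thesis
  proof cases
    case core
    then show ?thesis unfolding core_tri_edges[OF assms(1)] by auto
  next
    case spoke
    then show ?thesis using replaced_across[OF spoke(2) assms(1)] by (auto simp: mirror_def)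
  qed
qed

lemma gadget_disjoint: "disjoint_family_on (gadget z) (cells n)"
proof -
  have False if c: "c \<in> cells n" "c' \<in> cells n" "c \<noteq> c'" "e \<in> gadget z c" "e \<in> gadget z c'" for c c' e
    using gadget_members[OF cells_city[OF c(1)] c(4)] gadget_members[OF cells_city[OF c(2)] c(5)] c(3) by metis
  then show ?thesis unfolding disjoint_family_on_def by blast
qed

text \<open>The port splitting with the sites as names of the ports. The index set of the sum does
  not depend on \<open>z\<close> and is the one belonging to the weighted Aztec diamond.\<close>

lemma cluster_matchings:
  "card (matchings id tri_edges (cluster z n)) =
    (\<Sum>Y\<in>splittings (cells n) face_sites (aztec_sites (int n) n).
      \<Prod>c\<in>cells n. mweight id (\<lambda>_. 1) (gadget z c) (own z c \<union> port z ` Y c))"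
proof -
  have "real (card (matchings id tri_edges (cluster z n))) = mweight id (\<lambda>_. 1) (\<Union>c\<in>cells n. gadget z c) (cluster z n)"
    unfolding mweight_one[symmetric] by (subst mweight_restrict) (simp add: gadget_edges)
  also have "\<dots> = (\<Sum>Y\<in>splittings (cells n) face_sites (aztec_sites (int n) n).
      \<Prod>c\<in>cells n. mweight id (\<lambda>_. 1) (gadget z c) (own z c \<union> port z ` Y c))"
    unfolding cluster_eq
  proof (rule mweight_split_ports)
    show "finite (cells n)" by (simp add: cells_def finite_aztec_faces)
    show "disjoint_family_on (gadget z) (cells n)" by (rule gadget_disjoint)
    show "finite (gadget z c)" for c by (simp add: gadget_def core_def ladder_def finite_ring)
    show "finite (face_sites c)" for c by (rule finite_face_sites)
    show "finite (own z c)" for c by (simp add: own_eq finite_ring)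
    show "inj_on (port z) (\<Union>c\<in>cells n. face_sites c)" by (rule inj_port)
    show "disjoint_family_on (own z) (cells n)"
      using own_triangles[OF cells_city] by (auto simp: disjoint_family_on_def)
    show "aztec_sites (int n) n \<subseteq> (\<Union>c\<in>cells n. face_sites c)" by (simp add: aztec_sites_eq cells_def)
    show "own z c \<inter> port z ` face_sites c' = {}" if "c \<in> cells n" "c' \<in> cells n" for c c'
    proof -
      have "port z ` face_sites c' \<subseteq> port z ` aztec_sites (int n) n"
        using that(2) by (auto simp: aztec_sites_eq cells_def)
      then show ?thesis using own_triangles[OF cells_city[OF that(1)]] unfolding port_sites by auto
    qed
    show "id e \<subseteq> own z c \<union> port z ` face_sites c" if c: "c \<in> cells n" "e \<in> gadget z c" for c e
    proof -
      have city: "city c" using cells_city[OF c(1)] .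
      consider (core) "e \<in> core c" | (spoke) s where "replaced c = z" "s \<in> signs" "e = {(c, s, True), mirror c s}"
        using c(2) unfolding gadget_def by (auto split: if_splits)
      then show ?thesis
      proof cases
        case core
        then show ?thesis
          unfolding core_tri_edges[OF city] port_image[OF city] by (auto simp: own_eq triangles_def)
      next
        case spoke
        then show ?thesis unfolding port_image[OF city] own_eq by auto
      qed
    qed
  qed
  finally show ?thesis .
qed

section \<open>Comparison with the weighted Aztec diamonds\<close>

lemma aztec_weight_splittings:
  "aztec_weight h n w = (\<Sum>Y\<in>splittings (aztec_faces h n) face_sites (aztec_sites h n).
    \<Prod>c\<in>aztec_faces h n. mweight ends w (face_edges c) (Y c))"
  unfolding aztec_weight_def aztec_edges_def
  by (intro mweight_split finite_aztec_faces disjoint_face_edges finite_face_edges finite_face_sites ends_face_edge)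

lemma splittings_subset: "Y \<in> splittings C K U \<Longrightarrow> c \<in> C \<Longrightarrow> Y c \<subseteq> K c"
  unfolding splittings_def by auto

lemma cluster_weight:
  "real (card (matchings id tri_edges (cluster False n))) = weight2 n"
  "real (card (matchings id tri_edges (cluster True n))) = weight3 n"
proof -
  show "real (card (matchings id tri_edges (cluster False n))) = weight2 n"
    unfolding cluster_matchings weight2_def aztec_weight_splittings sum_distrib_left cells_def
  proof (intro sum.cong refl)
    fix Y assume Y: "Y \<in> splittings (aztec_faces (int n) n) face_sites (aztec_sites (int n) n)"
    have "mweight id (\<lambda>_. 1) (gadget False c) (own False c \<union> port False ` Y c) =
        2 * mweight ends (city_weight (1/2) (3/2) (1/2)) (face_edges c) (Y c)"
      if c: "c \<in> aztec_faces (int n) n" for c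
      using gadget_mweight[OF cells_city[unfolded cells_def, OF c] splittings_subset[OF Y c], of False] by simp
    then show "(\<Prod>c\<in>aztec_faces (int n) n. mweight id (\<lambda>_. 1) (gadget False c) (own False c \<union> port False ` Y c)) =
        (\<Prod>c\<in>aztec_faces (int n) n. 2) *
        (\<Prod>c\<in>aztec_faces (int n) n. mweight ends (city_weight (1/2) (3/2) (1/2)) (face_edges c) (Y c))"
      by (simp only: prod.distrib cong: prod.cong)
  qed
  show "real (card (matchings id tri_edges (cluster True n))) = weight3 n"
    unfolding cluster_matchings weight3_def aztec_weight_splittings sum_distrib_left cells_def
  proof (intro sum.cong refl)
    fix Y assume Y: "Y \<in> splittings (aztec_faces (int n) n) face_sites (aztec_sites (int n) n)"
    have "mweight id (\<lambda>_. 1) (gadget True c) (own True c \<union> port True ` Y c) =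
        (if even (snd c) then 5 else 1) * mweight ends (city_weight 1 (3/5) (1/5)) (face_edges c) (Y c)"
      if c: "c \<in> aztec_faces (int n) n" for c
    proof -
      have city: "city c" using cells_city[unfolded cells_def, OF c] .
      then have "replaced c \<longleftrightarrow> even (snd c)" by (auto simp: replaced_def city_def)
      then show ?thesis using gadget_mweight[OF city splittings_subset[OF Y c], of True] by simp
    qed
    then show "(\<Prod>c\<in>aztec_faces (int n) n. mweight id (\<lambda>_. 1) (gadget True c) (own True c \<union> port True ` Y c)) =
        (\<Prod>c\<in>aztec_faces (int n) n. if even (snd c) then 5 else 1) *
        (\<Prod>c\<in>aztec_faces (int n) n. mweight ends (city_weight 1 (3/5) (1/5)) (face_edges c) (Y c))"
      by (simp only: prod.distrib cong: prod.cong)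
  qed
qed

lemma num_tilings_weight:
  "real (num_tilings replaced_lattice (S2 n)) = weight2 n"
  "real (num_tilings replaced_lattice (S3 n)) = weight3 n"
  unfolding num_tilings_S2 num_tilings_S3 by (rule cluster_weight)+

theorem corollary5p3:
  shows
    "(\<forall>n::nat.
        num_tilings replaced_lattice (S2 (4*n)) = 7 ^ (n*(2*n+1)) * 2 ^ (12*n^2 - 2*n) \<and>
        num_tilings replaced_lattice (S2 (4*n+1)) = 5 * 7 ^ (n*(2*n+2)) * 2 ^ (12*n^2 + 4*n) \<and>
        num_tilings replaced_lattice (S2 (4*n+2)) = 7 ^ (n*(2*n+3) + 1) * 2 ^ (12*n^2 + 10*n + 2) \<and>
        num_tilings replaced_lattice (S2 (4*n+3)) = 7 ^ (n*(2*n+4) + 2) * 2 ^ (12*n^2 + 16*n + 5)) \<and>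
     (\<forall>n::nat.
        num_tilings replaced_lattice (S3 (4*n)) = 7 ^ (n*(2*n-1)) * 2 ^ (n*(12*n+2)) \<and>
        num_tilings replaced_lattice (S3 (4*n+1)) = 7 ^ (2*n^2) * 2 ^ (n*(12*n+8) + 1) \<and>
        num_tilings replaced_lattice (S3 (4*n+2)) = 7 ^ (n*(2*n+1)) * 2 ^ (n*(12*n+14) + 4) \<and>
        num_tilings replaced_lattice (S3 (4*n+3)) = 5 * 7 ^ (2*n*(n+1)) * 2 ^ (n*(12*n+20) + 8))"
  \<comment> \<open>The weights are real sums, so the equalities of natural numbers are proved after
    embedding into the reals; the exponents remain natural numbers.\<close>
  by (intro conjI allI; rule of_nat_eq_iff[where 'a = real, THEN iffD1];
      simp only: num_tilings_weight weight_closed of_nat_mult of_nat_power of_nat_numeral)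

end
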